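(* Suppose that $\Omega$ is a minimal and uniquely ergodic space of aperiodic tilings of $\mathbb{R}^d$ with finite local complexity (FLC), that $\Omega'$ is a space of FLC tilings of $\mathbb{R}^d$, and that $h:\Omega\to\Omega'$ is a homeomorphism. Then there exist an FLC tiling space $\Omega''$ and homeomorphisms $\tau_s:\Omega\to\Omega$, $h_{sc}:\Omega\to\Omega''$ and $\phi:\Omega'\to\Omega''$ such that: (1) $\phi\circ h=h_{sc}\circ\tau_s$, or equivalently $h=\phi^{-1}\circ h_{sc}\circ\tau_s$; (2) $\tau_s$ is a quasi-translation; (3) $h_{sc}$ is a shape change transformation; (4) $\phi$ is an MLD equivalence.
   Context: **Tiling spaces.** A tile is a convex polytope in $\mathbb{R}^d$ with non-empty interior, possibly carrying a label in a compact metric space; the set of prototiles (tiles up to translation) is compact. A tiling is a collection of tiles covering $\mathbb{R}^d$, any two of which meet only along their boundaries. A Delone set is a uniformly discrete and relatively dense subset of $\mathbb{R}^d$, possibly with labels in a compact metric space. Tilings and labelled Delone sets are used interchangeably. $\mathbb{R}^d$ acts by translation, $T\mapsto T-x$. The patch $T\cap B(x,R)$ is the set of labelled tiles meeting $B(x,R)$ (for Delone sets: labelled points in $B(x,R)$). Two tilings (Delone sets) are $\varepsilon$-close if on a ball of radius about $1/\varepsilon$ around the origin there is a one-to-one correspondence between their tiles (points), corresponding tiles being $\varepsilon$-close in Hausdorff distance (points being $\varepsilon$-close) with $\varepsilon$-close labels. A tiling space is a compact translation-invariant set of tilings (or labelled Delone sets), such as the orbit closure of a tiling. It is minimal if every $\mathbb{R}^d$-orbit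 is dense, aperiodic if $T-x=T$ implies $x=0$ for each of its elements $T$, uniquely ergodic if it carries exactly one translation-invariant Borel probability measure. It has finite local complexity (FLC) if for each $R$ there are finitely many patches of radius $R$ up to translation. **Quasi-translation.** A map $\tau_s:\Omega\to\Omega$ homotopic to the identity; equivalently $\tau_s(T)=T-s(T)$ for a continuous $s:\Omega\to\mathbb{R}^d$. **MLD equivalence.** A factor map is a continuous onto map $\phi$ with $\phi(T-x)=\phi(T)-x$. A local derivation between FLC tiling spaces is a factor map such that for all $r>0$ there is $R>0$ with: $T\cap B(0,R)=T'\cap B(0,R)$ implies $\phi(T)\cap B(0,r)=\phi(T')\cap B(0,r)$. An MLD equivalence is a local derivation that is a homeomorphism whose inverse is a local derivation. **Shape change transformation (FLC case).** Let $\Omega$ be a minimal FLC tiling space and $T\in\Omega$ a tiling with a vertex at $0$; let $\Lambda$ be its vertex set (or an associated Delone set). A smooth $\mathbb{R}^d$-valued 1-form $\omega$ on $\mathbb{R}^d$ is strongly pattern-equivariant (PE) with radius $R$ with respect to $T$ if its coefficients take the same value at $x$ and $y$ whenever $(T-x)\cap B(0,R)=(T-y)\cap B(0,R)$. Let $\omega$ be closed and strongly PE with radius $R$, let $A(x)=\int_0^x\omega$, and suppose $A:\mathbb{R}^d\to\mathbb{R}^d$ is a homeomorphism. Label each $p\in\Lambda$ by the patch of $T$ of radius $R_0$ around $p$, where $R_0$ exceeds $R$ plus the greatest distance between neighbouring points of $\Lambda$. Let $\Lambda'$ be obtained by moving each $p\in\Lambda$ to $A(p)$, keeping its label; view $\Lambda'$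 as (the vertex set of) a new tiling $T'$, and let $\Omega''$ be the orbit closure of $T'$. The map $h_\omega(T-x)=T'-A(x)$ extends to a homeomorphism $h_\omega:\Omega\to\Omega''$, called the shape change transformation associated to $\omega$. *)

theory Defs
  imports "HOL-Probability.Probability"
begin

section \<open>Patterns: tilings and labelled Delone sets\<close>

text \<open>
  A pattern is a set of labelled subsets of $R^d$, where $R^d$ is a type \<open>'a\<close> of class
  \<open>euclidean_space\<close>. Tilings are patterns of labelled polytopes; a labelled Delone set is
  encoded as the pattern of its labelled singletons. Translation, patches and closeness then need
  only one definition each. The label space is a library metric space \<open>L :: 'l metric\<close>.
\<close>

type_synonym ('a, 'l) tile = "'a set \<times> 'l"
type_synonym ('a, 'l) pattern = "('a, 'l) tile set"

definition tile_minus :: "('a::euclidean_space, 'l) tile \<Rightarrow> 'a \<Rightarrow> ('a, 'l) tile" where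
  "tile_minus t x = ((\<lambda>y. y - x) ` fst t, snd t)"

definition pattern_minus :: "('a::euclidean_space, 'l) pattern \<Rightarrow> 'a \<Rightarrow> ('a, 'l) pattern" where
  "pattern_minus T x = (\<lambda>t. tile_minus t x) ` T"

definition orbit :: "('a::euclidean_space, 'l) pattern \<Rightarrow> ('a, 'l) pattern set" where
  "orbit T = range (pattern_minus T)"

definition patch :: "('a::euclidean_space, 'l) pattern \<Rightarrow> 'a \<Rightarrow> real \<Rightarrow> ('a, 'l) pattern" where
  "patch T x R = {t \<in> T. fst t \<inter> ball x R \<noteq> {}}"

text \<open>The Hausdorff distance of two nonempty compact sets.\<close>

definition hausdorff_dist :: "'a::metric_space set \<Rightarrow> 'a set \<Rightarrow> real" where
  "hausdorff_dist K K' = max (SUP x\<in>K. infdist x K') (SUP y\<in>K'. infdist y K)"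

definition tile_dist :: "'l metric \<Rightarrow> ('a::euclidean_space, 'l) tile \<Rightarrow> ('a, 'l) tile \<Rightarrow> real" where
  "tile_dist L t t' = max (hausdorff_dist (fst t) (fst t')) (mdist L (snd t) (snd t'))"

definition is_tile :: "'l metric \<Rightarrow> ('a::euclidean_space, 'l) tile \<Rightarrow> bool" where
  "is_tile L t \<longleftrightarrow> polytope (fst t) \<and> interior (fst t) \<noteq> {} \<and> snd t \<in> mspace L"

text \<open>A prototile is given by a representative of its translation class, so a compact set of
  prototiles is a compact set of representatives.\<close>

definition prototile_set :: "'l metric \<Rightarrow> ('a::euclidean_space, 'l) tile set \<Rightarrow> bool" where
  "prototile_set L P \<longleftrightarrow>
     (\<forall>p\<in>P. is_tile L p) \<and> compact_space (Metric_space.mtopology P (tile_dist L))"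

definition tiling :: "('a::euclidean_space, 'l) tile set \<Rightarrow> ('a, 'l) pattern \<Rightarrow> bool" where
  "tiling P T \<longleftrightarrow>
     (\<forall>t\<in>T. \<exists>p\<in>P. \<exists>x. t = tile_minus p x) \<and>
     (\<Union>t\<in>T. fst t) = UNIV \<and>
     (\<forall>t\<in>T. \<forall>t'\<in>T. t \<noteq> t' \<longrightarrow> fst t \<inter> fst t' \<subseteq> frontier (fst t) \<inter> frontier (fst t'))"

definition delone :: "'a::euclidean_space set \<Rightarrow> bool" where
  "delone \<Lambda> \<longleftrightarrow>
     (\<exists>r>0. \<forall>p\<in>\<Lambda>. \<forall>q\<in>\<Lambda>. p \<noteq> q \<longrightarrow> r \<le> dist p q) \<and>
     (\<exists>R. \<forall>x. \<exists>p\<in>\<Lambda>. dist x p \<le> R)"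

definition labelled_points :: "'a::euclidean_space set \<Rightarrow> ('a \<Rightarrow> 'l) \<Rightarrow> ('a, 'l) pattern" where
  "labelled_points \<Lambda> lab = (\<lambda>p. ({p}, lab p)) ` \<Lambda>"

definition labelled_delone :: "'l metric \<Rightarrow> ('a::euclidean_space, 'l) pattern \<Rightarrow> bool" where
  "labelled_delone L T \<longleftrightarrow>
     (\<exists>\<Lambda> lab. delone \<Lambda> \<and> lab ` \<Lambda> \<subseteq> mspace L \<and> T = labelled_points \<Lambda> lab)"


section \<open>The topology on patterns\<close>

text \<open>
  The one-to-one correspondence is a bijection between subpatterns \<open>P\<close>, \<open>P'\<close> that contain
  everything meeting the ball of radius $1/\varepsilon$; they may contain more, which is how
  ``a ball of radius about $1/\varepsilon$'' is read: a tile that meets the ball may correspond to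
  one that just misses it.
\<close>

definition pattern_close ::
  "'l metric \<Rightarrow> real \<Rightarrow> ('a::euclidean_space, 'l) pattern \<Rightarrow> ('a, 'l) pattern \<Rightarrow> bool" where
  "pattern_close L \<epsilon> T T' \<longleftrightarrow>
     (\<exists>P P' f. patch T 0 (1 / \<epsilon>) \<subseteq> P \<and> P \<subseteq> T \<and> patch T' 0 (1 / \<epsilon>) \<subseteq> P' \<and> P' \<subseteq> T' \<and>
        bij_betw f P P' \<and> (\<forall>t\<in>P. tile_dist L t (f t) < \<epsilon>))"

definition pattern_topology ::
  "'l metric \<Rightarrow> ('a::euclidean_space, 'l) pattern set \<Rightarrow> ('a, 'l) pattern topology" where
  "pattern_topology L X =
     topology (\<lambda>U. U \<subseteq> X \<and> (\<forall>T\<in>U. \<exists>\<epsilon>>0. \<forall>T'\<in>X. pattern_close L \<epsilon> T T' \<longrightarrow> T' \<in> U))"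

lemma pattern_close_mono:
  assumes "pattern_close L \<delta> T T'" "0 < \<delta>" "\<delta> \<le> \<epsilon>"
  shows "pattern_close L \<epsilon> T T'"
proof -
  have r: "1 / \<epsilon> \<le> 1 / \<delta>"
    using assms by (simp add: frac_le)
  have sub: "patch S 0 (1 / \<epsilon>) \<subseteq> patch S 0 (1 / \<delta>)" for S :: "('c::euclidean_space, 'd) pattern"
    using subset_ball[OF r] by (fastforce simp: patch_def)
  from assms(1) obtain P P' f where
    "patch T 0 (1 / \<delta>) \<subseteq> P" "P \<subseteq> T" "patch T' 0 (1 / \<delta>) \<subseteq> P'" "P' \<subseteq> T'"
    "bij_betw f P P'" "\<forall>t\<in>P. tile_dist L t (f t) < \<delta>"
    unfolding pattern_close_def by blast
  moreover from this(6) have "\<forall>t\<in>P. tile_dist L t (f t) < \<epsilon>"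
    using assms(3) by fastforce
  ultimately show ?thesis
    unfolding pattern_close_def using sub[of T] sub[of T'] by (meson subset_trans)
qed

lemma openin_pattern_topology:
  "openin (pattern_topology L X) U \<longleftrightarrow>
     U \<subseteq> X \<and> (\<forall>T\<in>U. \<exists>\<epsilon>>0. \<forall>T'\<in>X. pattern_close L \<epsilon> T T' \<longrightarrow> T' \<in> U)"
proof -
  let ?O = "\<lambda>U. U \<subseteq> X \<and> (\<forall>T\<in>U. \<exists>\<epsilon>>0. \<forall>T'\<in>X. pattern_close L \<epsilon> T T' \<longrightarrow> T' \<in> U)"
  have "?O (S \<inter> S')" if S: "?O S" and S': "?O S'" for S S'
  proof (intro conjI ballI)
    show "S \<inter> S' \<subseteq> X" using S by blast
    fix T assume T: "T \<in> S \<inter> S'"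
    from S T obtain a where a: "a > 0" "\<forall>T'\<in>X. pattern_close L a T T' \<longrightarrow> T' \<in> S" by blast
    from S' T obtain b where b: "b > 0" "\<forall>T'\<in>X. pattern_close L b T T' \<longrightarrow> T' \<in> S'" by blast
    have "\<forall>T'\<in>X. pattern_close L (min a b) T T' \<longrightarrow> T' \<in> S \<inter> S'"
      using a b pattern_close_mono[of L "min a b" T] by auto
    then show "\<exists>\<epsilon>>0. \<forall>T'\<in>X. pattern_close L \<epsilon> T T' \<longrightarrow> T' \<in> S \<inter> S'"
      using a(1) b(1) by (intro exI[of _ "min a b"]) auto
  qed
  moreover have "?O (\<Union>\<K>)" if "\<forall>K\<in>\<K>. ?O K" for \<K>
    using that by (smt (verit) Sup_le_iff Union_iff)
  ultimately have "istopology ?O"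
    unfolding istopology_def by blast
  then show ?thesis
    by (simp add: pattern_topology_def topology_inverse')
qed

lemma topspace_pattern_topology [simp]: "topspace (pattern_topology L X) = X"
proof
  show "topspace (pattern_topology L X) \<subseteq> X"
    by (auto simp: topspace_def openin_pattern_topology)
  have "openin (pattern_topology L X) X"
    by (auto simp: openin_pattern_topology intro: exI[of _ 1])
  then show "X \<subseteq> topspace (pattern_topology L X)"
    by (rule openin_subset)
qed


section \<open>Tiling spaces\<close>

definition tiling_space :: "'l metric \<Rightarrow> ('a::euclidean_space, 'l) pattern set \<Rightarrow> bool" where
  "tiling_space L \<Omega> \<longleftrightarrow>
     compact_space (mtopology_of L) \<and>
     ((\<exists>P. prototile_set L P \<and> (\<forall>T\<in>\<Omega>. tiling P T)) \<or> (\<forall>T\<in>\<Omega>. labelled_delone L T)) \<and>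
     (\<forall>T\<in>\<Omega>. \<forall>x. pattern_minus T x \<in> \<Omega>) \<and>
     compact_space (pattern_topology L \<Omega>)"

definition minimal_space :: "'l metric \<Rightarrow> ('a::euclidean_space, 'l) pattern set \<Rightarrow> bool" where
  "minimal_space L \<Omega> \<longleftrightarrow> (\<forall>T\<in>\<Omega>. pattern_topology L \<Omega> closure_of orbit T = \<Omega>)"

definition aperiodic_space :: "('a::euclidean_space, 'l) pattern set \<Rightarrow> bool" where
  "aperiodic_space \<Omega> \<longleftrightarrow> (\<forall>T\<in>\<Omega>. \<forall>x. pattern_minus T x = T \<longrightarrow> x = 0)"

definition invariant_prob_measure ::
  "'l metric \<Rightarrow> ('a::euclidean_space, 'l) pattern set \<Rightarrow> ('a, 'l) pattern measure \<Rightarrow> bool" where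
  "invariant_prob_measure L \<Omega> \<mu> \<longleftrightarrow>
     prob_space \<mu> \<and> space \<mu> = \<Omega> \<and>
     sets \<mu> = sigma_sets \<Omega> {U. openin (pattern_topology L \<Omega>) U} \<and>
     (\<forall>x. \<forall>E\<in>sets \<mu>. emeasure \<mu> ((\<lambda>T. pattern_minus T x) ` E) = emeasure \<mu> E)"

definition uniquely_ergodic :: "'l metric \<Rightarrow> ('a::euclidean_space, 'l) pattern set \<Rightarrow> bool" where
  "uniquely_ergodic L \<Omega> \<longleftrightarrow> (\<exists>!\<mu>. invariant_prob_measure L \<Omega> \<mu>)"

definition FLC :: "('a::euclidean_space, 'l) pattern set \<Rightarrow> bool" where
  "FLC \<Omega> \<longleftrightarrow>
     (\<forall>R. \<exists>F. finite F \<and> (\<forall>T\<in>\<Omega>. \<forall>x. \<exists>Q\<in>F. \<exists>y. patch T x R = pattern_minus Q y))"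


section \<open>Maps between tiling spaces\<close>

text \<open>The second conjunct of the following definition is the equivalent description, which
  exhibits \<open>s\<close>.\<close>

definition quasi_translation ::
  "'l metric \<Rightarrow> ('a::euclidean_space, 'l) pattern set \<Rightarrow> (('a, 'l) pattern \<Rightarrow> 'a) \<Rightarrow>
   (('a, 'l) pattern \<Rightarrow> ('a, 'l) pattern) \<Rightarrow> bool" where
  "quasi_translation L \<Omega> s \<tau> \<longleftrightarrow>
     homotopic_with (\<lambda>_. True) (pattern_topology L \<Omega>) (pattern_topology L \<Omega>) id \<tau> \<and>
     continuous_map (pattern_topology L \<Omega>) euclidean s \<and>
     (\<forall>T\<in>\<Omega>. \<tau> T = pattern_minus T (s T))"

definition factor_map ::
  "'l metric \<Rightarrow> ('a::euclidean_space, 'l) pattern set \<Rightarrow>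
   'm metric \<Rightarrow> ('a, 'm) pattern set \<Rightarrow> (('a, 'l) pattern \<Rightarrow> ('a, 'm) pattern) \<Rightarrow> bool" where
  "factor_map L \<Omega> L' \<Omega>' \<phi> \<longleftrightarrow>
     continuous_map (pattern_topology L \<Omega>) (pattern_topology L' \<Omega>') \<phi> \<and>
     \<phi> ` \<Omega> = \<Omega>' \<and>
     (\<forall>T\<in>\<Omega>. \<forall>x. \<phi> (pattern_minus T x) = pattern_minus (\<phi> T) x)"

definition local_derivation ::
  "'l metric \<Rightarrow> ('a::euclidean_space, 'l) pattern set \<Rightarrow>
   'm metric \<Rightarrow> ('a, 'm) pattern set \<Rightarrow> (('a, 'l) pattern \<Rightarrow> ('a, 'm) pattern) \<Rightarrow> bool" where
  "local_derivation L \<Omega> L' \<Omega>' \<phi> \<longleftrightarrow>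
     factor_map L \<Omega> L' \<Omega>' \<phi> \<and>
     (\<forall>r>0. \<exists>R>0. \<forall>T\<in>\<Omega>. \<forall>T'\<in>\<Omega>.
        patch T 0 R = patch T' 0 R \<longrightarrow> patch (\<phi> T) 0 r = patch (\<phi> T') 0 r)"

definition MLD_equivalence ::
  "'l metric \<Rightarrow> ('a::euclidean_space, 'l) pattern set \<Rightarrow>
   'm metric \<Rightarrow> ('a, 'm) pattern set \<Rightarrow> (('a, 'l) pattern \<Rightarrow> ('a, 'm) pattern) \<Rightarrow> bool" where
  "MLD_equivalence L \<Omega> L' \<Omega>' \<phi> \<longleftrightarrow>
     local_derivation L \<Omega> L' \<Omega>' \<phi> \<and>
     (\<exists>\<psi>. homeomorphic_maps (pattern_topology L \<Omega>) (pattern_topology L' \<Omega>') \<phi> \<psi> \<and>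
          local_derivation L' \<Omega>' L \<Omega> \<psi>)"


section \<open>Shape change transformations\<close>

text \<open>
  An $R^d$-valued 1-form on $R^d$ is a function into \<open>'a \<Rightarrow>\<^sub>L 'a\<close>. Smoothness is $C^\infty$: all
  iterated directional derivatives exist and are Frechet differentiable everywhere.
\<close>

primrec iterated_derivative ::
  "'a::real_normed_vector list \<Rightarrow> ('a \<Rightarrow> 'b::real_normed_vector) \<Rightarrow> 'a \<Rightarrow> 'b" where
  "iterated_derivative [] f = f"
| "iterated_derivative (v # vs) f = (\<lambda>x. frechet_derivative (iterated_derivative vs f) (at x) v)"

definition smooth :: "('a::real_normed_vector \<Rightarrow> 'b::real_normed_vector) \<Rightarrow> bool" where
  "smooth f \<longleftrightarrow> (\<forall>vs x. iterated_derivative vs f differentiable (at x))"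

definition closed_form :: "('a::euclidean_space \<Rightarrow> ('a \<Rightarrow>\<^sub>L 'a)) \<Rightarrow> bool" where
  "closed_form \<omega> \<longleftrightarrow>
     (\<forall>x u v. blinfun_apply (frechet_derivative \<omega> (at x) u) v =
              blinfun_apply (frechet_derivative \<omega> (at x) v) u)"

definition strongly_PE ::
  "('a::euclidean_space, 'l) pattern \<Rightarrow> real \<Rightarrow> ('a \<Rightarrow> ('a \<Rightarrow>\<^sub>L 'a)) \<Rightarrow> bool" where
  "strongly_PE T R \<omega> \<longleftrightarrow>
     (\<forall>x y. patch (pattern_minus T x) 0 R = patch (pattern_minus T y) 0 R \<longrightarrow> \<omega> x = \<omega> y)"

text \<open>The integral of a form from \<open>0\<close> to \<open>x\<close>, taken along the segment; for a closed form
  the path does not matter.\<close>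

definition form_integral :: "('a::euclidean_space \<Rightarrow> ('a \<Rightarrow>\<^sub>L 'a)) \<Rightarrow> 'a \<Rightarrow> 'a" where
  "form_integral \<omega> x = integral {0..1} (\<lambda>t. blinfun_apply (\<omega> (t *\<^sub>R x)) x)"

text \<open>For a labelled Delone set, encoded by singletons, the vertices are the points.\<close>

definition vertex_set :: "('a::euclidean_space, 'l) pattern \<Rightarrow> 'a set" where
  "vertex_set T = {v. \<exists>t\<in>T. v extreme_point_of fst t}"

text \<open>Two vertices are neighbours if they belong to a common tile or, as is usual for Delone
  sets, if their Voronoi cells meet.\<close>

definition neighbouring :: "('a::euclidean_space, 'l) pattern \<Rightarrow> 'a \<Rightarrow> 'a \<Rightarrow> bool" where
  "neighbouring T p q \<longleftrightarrow>
     p \<in> vertex_set T \<and> q \<in> vertex_set T \<and> p \<noteq> q \<and>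
     ((\<exists>t\<in>T. p extreme_point_of fst t \<and> q extreme_point_of fst t) \<or>
      (\<exists>z. dist z p = dist z q \<and> (\<forall>r\<in>vertex_set T. dist z p \<le> dist z r)))"

text \<open>The patch of radius \<open>R\<^sub>0\<close> around \<open>p\<close>, up to translation: it is moved to the origin.\<close>

definition vertex_label ::
  "('a::euclidean_space, 'l) pattern \<Rightarrow> real \<Rightarrow> 'a \<Rightarrow> ('a, 'l) pattern" where
  "vertex_label T R\<^sub>0 p = patch (pattern_minus T p) 0 R\<^sub>0"

text \<open>Under FLC there are finitely many labels, hence the discrete metric.\<close>

definition vertex_label_metric ::
  "('a::euclidean_space, 'l) pattern \<Rightarrow> real \<Rightarrow> ('a, 'l) pattern metric" where
  "vertex_label_metric T R\<^sub>0 = metric (vertex_label T R\<^sub>0 ` vertex_set T, discrete_metric.dd)"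

text \<open>Each vertex \<open>p\<close> of \<open>T\<close> is moved to \<open>A p\<close> and keeps its label.\<close>

definition deformed_pattern ::
  "('a::euclidean_space, 'l) pattern \<Rightarrow> real \<Rightarrow> ('a \<Rightarrow> 'a) \<Rightarrow> ('a, ('a, 'l) pattern) pattern" where
  "deformed_pattern T R\<^sub>0 A = (\<lambda>p. ({A p}, vertex_label T R\<^sub>0 p)) ` vertex_set T"

definition delone_orbit_closure ::
  "'l metric \<Rightarrow> ('a::euclidean_space, 'l) pattern \<Rightarrow> ('a, 'l) pattern set" where
  "delone_orbit_closure L T = pattern_topology L {S. labelled_delone L S} closure_of orbit T"

definition shape_change ::
  "'l metric \<Rightarrow> ('a::euclidean_space, 'l) pattern set \<Rightarrow>
   ('a, 'l) pattern metric \<Rightarrow> ('a, ('a, 'l) pattern) pattern set \<Rightarrow>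
   (('a, 'l) pattern \<Rightarrow> ('a, ('a, 'l) pattern) pattern) \<Rightarrow> bool" where
  "shape_change L \<Omega> L'' \<Omega>'' h \<longleftrightarrow>
     (\<exists>T\<in>\<Omega>. \<exists>\<omega> R D R\<^sub>0.
        let A = form_integral \<omega>; T' = deformed_pattern T R\<^sub>0 A in
        0 \<in> vertex_set T \<and>
        0 < R \<and> smooth \<omega> \<and> closed_form \<omega> \<and> strongly_PE T R \<omega> \<and>
        homeomorphic_map euclidean euclidean A \<and>
        (\<forall>p q. neighbouring T p q \<longrightarrow> dist p q \<le> D) \<and> R + D < R\<^sub>0 \<and>
        L'' = vertex_label_metric T R\<^sub>0 \<and>
        \<Omega>'' = delone_orbit_closure L'' T' \<and>
        homeomorphic_map (pattern_topology L \<Omega>) (pattern_topology L'' \<Omega>'') h \<and>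
        (\<forall>x. h (pattern_minus T x) = pattern_minus T' (A x)))"

end

theory Submission
  imports Defs
begin

text \<open>
  \<^bold>\<open>The cocycle.\<close> By finite local complexity, two patterns of a tiling space are close exactly if
  they agree on a large ball up to a small translation (lemma \<open>pattern_close_imp_near\<close>), and since
  vertices are separated that translation is unique. A homeomorphism \<open>h\<close> therefore carries short
  orbit segments to short orbit segments (\<open>small_step\<close>), and as $R^d$ is simply connected this
  integrates to a cocycle with $h(T-x)=h(T)-f_T(x)$ (\<open>exists_cocycle\<close>). The cocycle need not be
  local: if \<open>T'\<close> agrees with \<open>T\<close> near the origin, then \<open>h T'\<close> agrees with a small translate
  $h(T)-z(T,T')$, and $f_{T'}(x)-f_T(x)=z(T-x,T'-x)-z(T,T')$ (\<open>f_shift\<close>).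

  \<^bold>\<open>A local representative.\<close> A function \<open>s\<close> on the tiling space with $s(T')=s(T)-z(T,T')$ whenever
  \<open>T\<close> and \<open>T'\<close> agree on a fixed ball is called adapted. For such \<open>s\<close> the cohomologous cocycle
  $A_T(x)=f_T(x)+s(T-x)-s(T)$ at bounded \<open>x\<close> depends only on a bounded patch of \<open>T\<close>
  (\<open>corrected_local\<close>). Adapted functions exist because the relation of agreeing on the ball is an
  equivalence relation on which \<open>z\<close> is additive. Spreading one over the vertices with smooth weights
  makes \<open>A\<close> smooth along orbits; averaging over finitely many translates preserves adaptedness and
  averages the derivatives of \<open>A\<close>.

  \<^bold>\<open>Unique ergodicity.\<close> For a continuous function on a uniquely ergodic space, averages over suitable
  finite sets of translates are uniformly close to a constant (\<open>uniform_average\<close>): otherwise the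
  Hahn-Banach theorem would give two invariant positive functionals that differ on the function, and
  hence two invariant measures. So the averages can be chosen to bring the derivative of every $A_T$ close
  to one linear map. That map is invertible, since $A_T$ stays within bounded distance of $f_T$, which
  grows at least linearly because $h^{-1}$ has a cocycle too. Consequently every $A_T$ is a bi-Lipschitz
  homeomorphism (\<open>exists_adapted_bilipschitz\<close>).

  \<^bold>\<open>The factorization.\<close> The closed form $dA_{T_0}$ is strongly pattern-equivariant, and the shape change
  that it defines is the map \<open>deform\<close>, which moves each vertex \<open>p\<close> of \<open>T\<close> to $A_T(p)$. By
  construction $\phi(h(T))=\mathrm{deform}(T)+s(T)$ defines a map that commutes with translations; it is an
  MLD equivalence because agreement of patterns leaves only a common small translation
  undetermined, which must vanish (\<open>common_displacement\<close>, \<open>MLD_conjugacy\<close>). Finally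
  $\mathrm{deform}(T)+s(T)=\mathrm{deform}(T-x)$ for the unique \<open>x\<close> with $A_T(x)=-s(T)$, and
  $T\mapsto T-x$ is the quasi-translation.
\<close>

section \<open>Translating and comparing patterns\<close>

lemma tile_minus_minus: "tile_minus (tile_minus t x) y = tile_minus t (x + y)"
  by (auto simp: tile_minus_def image_image algebra_simps)

lemma tile_minus_0 [simp]: "tile_minus t 0 = t"
  by (simp add: tile_minus_def)

lemma snd_tile_minus [simp]: "snd (tile_minus t x) = snd t"
  by (simp add: tile_minus_def)

lemma fst_tile_minus: "fst (tile_minus t x) = (\<lambda>y. y - x) ` fst t"
  by (simp add: tile_minus_def)

lemma mem_fst_tile_minus: "z \<in> fst (tile_minus t x) \<longleftrightarrow> z + x \<in> fst t"
  by (force simp: tile_minus_def)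

lemma pattern_minus_minus: "pattern_minus (pattern_minus T x) y = pattern_minus T (x + y)"
  by (simp add: pattern_minus_def image_image tile_minus_minus)

lemma pattern_minus_0 [simp]: "pattern_minus T 0 = T"
  by (simp add: pattern_minus_def)

lemma mem_pattern_minus: "t \<in> pattern_minus T x \<longleftrightarrow> tile_minus t (- x) \<in> T"
proof
  assume "tile_minus t (- x) \<in> T"
  then have "tile_minus (tile_minus t (- x)) x \<in> pattern_minus T x"
    unfolding pattern_minus_def by blast
  then show "t \<in> pattern_minus T x" by (simp add: tile_minus_minus)
qed (auto simp: pattern_minus_def tile_minus_minus)

lemma tile_minus_mem_pattern_minus: "tile_minus t y \<in> pattern_minus T x \<longleftrightarrow> tile_minus t (y - x) \<in> T"
  by (simp add: mem_pattern_minus tile_minus_minus)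

lemma pattern_minus_eqD: "pattern_minus T x = pattern_minus T' y \<Longrightarrow> T' = pattern_minus T (x - y)"
  by (metis add.right_inverse diff_conv_add_uminus pattern_minus_0 pattern_minus_minus)

lemma mem_patch: "t \<in> patch T x R \<longleftrightarrow> t \<in> T \<and> (\<exists>z\<in>fst t. dist x z < R)"
  by (auto simp: patch_def)

lemma patch_subset: "patch T x R \<subseteq> T"
  by (auto simp: patch_def)

lemma patch_mono: "R \<le> R' \<Longrightarrow> patch T x R \<subseteq> patch T x R'"
  by (auto simp: mem_patch) (meson less_le_trans)

lemma patch_pattern_minus: "patch (pattern_minus T x) c R = pattern_minus (patch T (c + x) R) x"
proof -
  have "(\<exists>z\<in>fst t. dist c z < R) \<longleftrightarrow> (\<exists>z\<in>fst (tile_minus t (- x)). dist (c + x) z < R)" for t :: "('a,'b) tile"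
    by (force simp: fst_tile_minus dist_norm)
  then show ?thesis
    by (auto simp: mem_pattern_minus mem_patch)
qed

lemma patch_eq_mono:
  assumes "patch T 0 R = patch T' 0 R" "r \<le> R"
  shows "patch T 0 r = patch T' 0 r"
proof -
  have "patch S 0 r = patch (patch S 0 R) 0 r" for S :: "('a,'b) pattern"
    by (auto simp: mem_patch) (meson assms(2) less_le_trans)
  then show ?thesis by (metis assms(1))
qed

lemma patch_eq_shift:
  assumes "patch T 0 R = patch T' 0 R" "norm x + r \<le> R"
  shows "patch (pattern_minus T x) 0 r = patch (pattern_minus T' x) 0 r"
proof -
  have "patch S x r = patch (patch S 0 R) x r" for S :: "('a,'b) pattern"
  proof -
    have "norm z < R" if "dist x z < r" for z
      using that assms(2) norm_triangle_sub[of z x] by (simp add: dist_norm norm_minus_commute)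
    then show ?thesis by (fastforce simp: mem_patch)
  qed
  then show ?thesis by (metis add_0 assms(1) patch_pattern_minus)
qed

lemma patch_eq_unshift:
  assumes "patch (pattern_minus T x) 0 R = patch (pattern_minus T' y) 0 R" "norm x + r \<le> R"
  shows "patch T 0 r = patch (pattern_minus T' (y - x)) 0 r"
  using patch_eq_shift[OF assms(1), of "- x" r] assms(2) by (simp add: pattern_minus_minus)

lemma pattern_eqI_patch:
  assumes "\<And>t. t \<in> T \<union> T' \<Longrightarrow> fst t \<noteq> {}" and "\<And>R. R \<ge> R0 \<Longrightarrow> patch T 0 R = patch T' 0 R"
  shows "T = T'"
proof -
  have *: "t \<in> S \<longleftrightarrow> (\<exists>R\<ge>R0. t \<in> patch S 0 R)" if "fst t \<noteq> {}" for t and S :: "('a,'b) pattern"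
  proof -
    from that obtain z where "z \<in> fst t" by blast
    then have "t \<in> S \<Longrightarrow> t \<in> patch S 0 (max R0 (norm z + 1))" by (force simp: mem_patch)
    moreover have "max R0 (norm z + 1) \<ge> R0" by simp
    ultimately show ?thesis by (metis mem_patch)
  qed
  show ?thesis
  proof (intro set_eqI)
    fix t
    show "t \<in> T \<longleftrightarrow> t \<in> T'"
    proof (cases "fst t = {}")
      case True then show ?thesis using assms(1) by blast
    next
      case False then show ?thesis using *[OF False] assms(2) by metis
    qed
  qed
qed

lemma vertex_set_minus: "v \<in> vertex_set (pattern_minus T x) \<longleftrightarrow> v + x \<in> vertex_set T"
proof -
  have *: "v extreme_point_of fst (tile_minus t y) \<longleftrightarrow> v + y extreme_point_of fst t" for t :: "('a,'b) tile" and v y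
    using extreme_point_of_translation_eq[of "- y" "v + y" "fst t"]
    by (simp add: fst_tile_minus algebra_simps)
  show ?thesis
    by (simp add: vertex_set_def pattern_minus_def *)
qed

lemma vertex_set_patch: "norm v < R \<Longrightarrow> v \<in> vertex_set (patch T 0 R) \<longleftrightarrow> v \<in> vertex_set T"
proof -
  assume "norm v < R"
  then have "t \<in> T \<Longrightarrow> v extreme_point_of fst t \<Longrightarrow> t \<in> patch T 0 R" for t
    unfolding mem_patch extreme_point_of_def by (metis dist_0_norm)
  then show ?thesis
    unfolding vertex_set_def using patch_subset by blast
qed

lemma vertex_set_patch_eq:
  "patch T 0 R = patch T' 0 R \<Longrightarrow> norm v < R \<Longrightarrow> v \<in> vertex_set T \<longleftrightarrow> v \<in> vertex_set T'"
  using vertex_set_patch by metis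


section \<open>A metric on locally finite patterns\<close>

lemma hausdorff_dist_le_iff:
  fixes K :: "'a::euclidean_space set"
  assumes "compact K" "compact K'" "K \<noteq> {}" "K' \<noteq> {}"
  shows "hausdorff_dist K K' \<le> e \<longleftrightarrow> (\<forall>x\<in>K. \<exists>y\<in>K'. dist x y \<le> e) \<and> (\<forall>y\<in>K'. \<exists>x\<in>K. dist x y \<le> e)"
proof -
  have *: "(SUP x\<in>A. infdist x B) \<le> e \<longleftrightarrow> (\<forall>x\<in>A. \<exists>y\<in>B. dist x y \<le> e)"
    if c: "compact A" "compact B" "A \<noteq> {}" "B \<noteq> {}" for A B :: "'a set"
  proof -
    have "compact ((\<lambda>x. infdist x B) ` A)"
      by (intro compact_continuous_image continuous_intros c)
    then have bdd: "bdd_above ((\<lambda>x. infdist x B) ` A)"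
      by (intro bounded_imp_bdd_above compact_imp_bounded)
    have "infdist x B \<le> e \<longleftrightarrow> (\<exists>y\<in>B. dist x y \<le> e)" for x
    proof -
      obtain y where y: "y \<in> B" "\<And>z. z \<in> B \<Longrightarrow> dist x y \<le> dist x z"
        using distance_attains_inf[OF compact_imp_closed[OF c(2)] c(4), of x] by blast
      then have "infdist x B = dist x y"
        unfolding infdist_notempty[OF c(4)] by (intro cInf_eq_minimum) auto
      then show ?thesis using y by (metis infdist_le2)
    qed
    then show ?thesis using cSUP_le_iff[OF c(3) bdd] by simp
  qed
  show ?thesis
    unfolding hausdorff_dist_def max.bounded_iff using *[OF assms] *[OF assms(2,1,4,3)]
    by (simp add: dist_commute)
qed

definition closed_tile :: "'l metric \<Rightarrow> ('a::euclidean_space, 'l) tile \<Rightarrow> bool" where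
  "closed_tile L t \<longleftrightarrow> compact (fst t) \<and> fst t \<noteq> {} \<and> snd t \<in> mspace L"

lemma tile_dist_le_iff:
  assumes "closed_tile L t" "closed_tile L t'"
  shows "tile_dist L t t' \<le> e \<longleftrightarrow> (\<forall>x\<in>fst t. \<exists>y\<in>fst t'. dist x y \<le> e) \<and>
     (\<forall>y\<in>fst t'. \<exists>x\<in>fst t. dist x y \<le> e) \<and> mdist L (snd t) (snd t') \<le> e"
  using assms hausdorff_dist_le_iff[of "fst t" "fst t'" e] by (auto simp: tile_dist_def closed_tile_def)

lemma tile_dist_nonneg: "0 \<le> tile_dist L t t'"
  by (simp add: tile_dist_def le_max_iff_disj)

lemma tile_dist_commute: "tile_dist L t t' = tile_dist L t' t"
  by (simp add: tile_dist_def hausdorff_dist_def max.commute mdist_commute)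

lemma tile_dist_triangle:
  fixes t :: "('a::euclidean_space, 'l) tile"
  assumes "closed_tile L t" "closed_tile L t'" "closed_tile L t''"
  shows "tile_dist L t t'' \<le> tile_dist L t t' + tile_dist L t' t''"
proof -
  note 1 = tile_dist_le_iff[OF assms(1,2), THEN iffD1, OF order_refl]
  note 2 = tile_dist_le_iff[OF assms(2,3), THEN iffD1, OF order_refl]
  have tr: "dist x z \<le> tile_dist L t t' + tile_dist L t' t''"
    if "dist x y \<le> tile_dist L t t'" "dist y z \<le> tile_dist L t' t''" for x y z :: 'a
    using that dist_triangle[of x z y] by linarith
  show ?thesis
    unfolding tile_dist_le_iff[OF assms(1,3)]
  proof (intro conjI ballI)
    show "\<exists>z\<in>fst t''. dist x z \<le> tile_dist L t t' + tile_dist L t' t''" if "x \<in> fst t" for x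
      using 1 2 that tr by meson
    show "\<exists>x\<in>fst t. dist x z \<le> tile_dist L t t' + tile_dist L t' t''" if "z \<in> fst t''" for z
      using 1 2 that tr by meson
    show "mdist L (snd t) (snd t'') \<le> tile_dist L t t' + tile_dist L t' t''"
      using 1 2 mdist_triangle[of "snd t" L "snd t'" "snd t''"] assms by (auto simp: closed_tile_def)
  qed
qed

lemma tile_dist_self [simp]: 
  assumes "closed_tile L t" shows "tile_dist L t t = 0"
proof (rule antisym)
  show "tile_dist L t t \<le> 0"
    unfolding tile_dist_le_iff[OF assms assms]
  proof (intro conjI ballI)
    have "mdist L (snd t) (snd t) = 0"
      using assms by (simp add: closed_tile_def)
    then show "mdist L (snd t) (snd t) \<le> 0" by simp
  qed (metis dist_self order_refl)+
qed (rule tile_dist_nonneg)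

lemma tile_dist_eq_0:
  assumes "closed_tile L t" "closed_tile L t'" "tile_dist L t t' = 0"
  shows "t = t'"
proof (rule prod_eqI)
  note 1 = tile_dist_le_iff[OF assms(1,2), THEN iffD1, of 0]
  show "fst t = fst t'"
    using 1 assms(3) by fastforce
  show "snd t = snd t'"
    using 1 assms mdist_zero[of "snd t" L "snd t'"] mdist_nonneg[of L "snd t" "snd t'"]
    by (auto simp: closed_tile_def)
qed

lemma closed_tile_minus [simp]:
  fixes t :: "('a::euclidean_space, 'l) tile"
  shows "closed_tile L (tile_minus t x) \<longleftrightarrow> closed_tile L t"
proof -
  have "closed_tile L (tile_minus s y)" if "closed_tile L s" for s :: "('a,'l) tile" and y
    using that by (auto simp: closed_tile_def fst_tile_minus intro!: compact_continuous_image continuous_intros)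
  from this[of t x] this[of "tile_minus t x" "- x"] show ?thesis
    by (auto simp: tile_minus_minus)
qed

lemma tile_dist_minus_le:
  assumes "closed_tile L t"
  shows "tile_dist L (tile_minus t x) (tile_minus t y) \<le> norm (x - y)"
proof -
  have c: "closed_tile L (tile_minus t x)" "closed_tile L (tile_minus t y)"
    using assms by auto
  have "mdist L (snd t) (snd t) = 0"
    using assms by (simp add: closed_tile_def)
  then show ?thesis
    unfolding tile_dist_le_iff[OF c]
    by (auto simp: fst_tile_minus dist_norm norm_minus_commute intro!: bexI)
qed

lemma tile_dist_meets:
  assumes "closed_tile L t" "closed_tile L t'" "tile_dist L t t' < e" "z \<in> fst t" "dist x z < r"
  shows "\<exists>z'\<in>fst t'. dist x z' < r + e"
proof -
  obtain z' where "z' \<in> fst t'" "dist z z' \<le> tile_dist L t t'"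
    using tile_dist_le_iff[OF assms(1,2), THEN iffD1, OF order_refl] assms(4) by blast
  then show ?thesis
    using assms(3,5) dist_triangle[of x z' z] by (intro bexI[of _ z']) auto
qed

definition locally_finite :: "'l metric \<Rightarrow> ('a::euclidean_space, 'l) pattern \<Rightarrow> bool" where
  "locally_finite L T \<longleftrightarrow> (\<forall>t\<in>T. closed_tile L t) \<and> (\<forall>x R. finite (patch T x R))"

lemma locally_finiteD:
  "locally_finite L T \<Longrightarrow> t \<in> T \<Longrightarrow> closed_tile L t"
  "locally_finite L T \<Longrightarrow> finite (patch T x R)"
  by (auto simp: locally_finite_def)

lemma pattern_close_commute:
  assumes "pattern_close L e T T'"
  shows "pattern_close L e T' T"
proof -
  from assms obtain P P' f where *: "patch T 0 (1 / e) \<subseteq> P" "P \<subseteq> T" "patch T' 0 (1 / e) \<subseteq> P'" "P' \<subseteq> T'"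
    "bij_betw f P P'" "\<forall>t\<in>P. tile_dist L t (f t) < e"
    unfolding pattern_close_def by blast
  have "bij_betw (inv_into P f) P' P" by (rule bij_betw_inv_into) fact
  moreover have "\<forall>t\<in>P'. tile_dist L t (inv_into P f t) < e"
  proof
    fix t assume t: "t \<in> P'"
    then have "inv_into P f t \<in> P" "f (inv_into P f t) = t"
      using *(5) by (auto simp: bij_betw_def inv_into_into f_inv_into_f)
    then show "tile_dist L t (inv_into P f t) < e"
      using *(6) by (metis tile_dist_commute)
  qed
  ultimately show ?thesis unfolding pattern_close_def using * by blast
qed

text \<open>Along the correspondences a tile moves by less than \<open>d1\<close> and \<open>d2\<close>, so the tiles that meet the
  smaller ball of radius \<open>1 / (d1 + d2)\<close> stay within reach of both: this is where \<open>d1 + d2 \<le> 1\<close>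
  enters.\<close>

lemma pattern_close_triangle:
  assumes lf: "locally_finite L T1" "locally_finite L T2" "locally_finite L T3"
    and cl: "pattern_close L d1 T1 T2" "pattern_close L d2 T2 T3"
    and d: "0 < d1" "0 < d2" "d1 + d2 \<le> 1"
  shows "pattern_close L (d1 + d2) T1 T3"
proof -
  let ?e = "d1 + d2"
  obtain P1 P2 f where f: "patch T1 0 (1 / d1) \<subseteq> P1" "P1 \<subseteq> T1" "patch T2 0 (1 / d1) \<subseteq> P2" "P2 \<subseteq> T2"
    "bij_betw f P1 P2" "\<forall>t\<in>P1. tile_dist L t (f t) < d1"
    using cl(1) unfolding pattern_close_def by blast
  obtain Q2 Q3 g where g: "patch T2 0 (1 / d2) \<subseteq> Q2" "Q2 \<subseteq> T2" "patch T3 0 (1 / d2) \<subseteq> Q3" "Q3 \<subseteq> T3"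
    "bij_betw g Q2 Q3" "\<forall>t\<in>Q2. tile_dist L t (g t) < d2"
    using cl(2) unfolding pattern_close_def by blast
  have r: "1 / ?e + d1 \<le> 1 / d2" "1 / ?e + d2 \<le> 1 / d1"
  proof -
    have "d2 * ?e \<le> 1" "d1 * ?e \<le> 1"
      using d by (intro mult_le_one; simp)+
    then have "d1 * (d2 * ?e) \<le> d1 * 1" "d2 * (d1 * ?e) \<le> d2 * 1"
      using d by (intro mult_left_mono; simp)+
    then show "1 / ?e + d1 \<le> 1 / d2" "1 / ?e + d2 \<le> 1 / d1"
      using d by (simp_all add: field_simps)
  qed
  define P where "P = {t \<in> P1. f t \<in> Q2}"
  have fP: "f ` P = P2 \<inter> Q2"
    using bij_betw_imp_surj_on[OF f(5)] by (auto simp: P_def)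
  have bf: "bij_betw f P (P2 \<inter> Q2)"
    using inj_on_subset[OF bij_betw_imp_inj_on[OF f(5)], of P] fP by (auto simp: bij_betw_def P_def)
  have bg: "bij_betw g (P2 \<inter> Q2) (g ` (P2 \<inter> Q2))"
    using g(5) by (meson bij_betw_def inf_le2 inj_on_subset)
  have "patch T1 0 (1 / ?e) \<subseteq> P"
  proof
    fix t assume t: "t \<in> patch T1 0 (1 / ?e)"
    have "t \<in> patch T1 0 (1 / d1)"
      using t r(2) d patch_mono[of "1 / ?e" "1 / d1" T1 0] by auto
    then have tP: "t \<in> P1" using f(1) by blast
    then have ft: "f t \<in> T2" "tile_dist L t (f t) < d1"
      using f by (auto simp: bij_betw_def)
    obtain z where "z \<in> fst t" "dist 0 z < 1 / ?e"
      using t by (auto simp: mem_patch)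
    then obtain z' where "z' \<in> fst (f t)" "dist 0 z' < 1 / ?e + d1"
      using tile_dist_meets[of L t "f t" d1] lf ft tP f(2) by (meson locally_finiteD(1) subsetD)
    then have "f t \<in> patch T2 0 (1 / d2)"
      using ft r by (force simp: mem_patch)
    then show "t \<in> P" using tP g(1) by (auto simp: P_def)
  qed
  moreover have "patch T3 0 (1 / ?e) \<subseteq> g ` (P2 \<inter> Q2)"
  proof
    fix t assume t: "t \<in> patch T3 0 (1 / ?e)"
    have "t \<in> patch T3 0 (1 / d2)"
      using t r(1) d patch_mono[of "1 / ?e" "1 / d2" T3 0] by auto
    then have "t \<in> Q3" using g(3) by blast
    then obtain u where u: "u \<in> Q2" "t = g u" using g(5) by (auto simp: bij_betw_def)
    then have ut: "u \<in> T2" "t \<in> T3" "tile_dist L t u < d2"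
      using g t by (auto simp: mem_patch tile_dist_commute)
    obtain z where "z \<in> fst t" "dist 0 z < 1 / ?e"
      using t by (auto simp: mem_patch)
    then obtain z' where "z' \<in> fst u" "dist 0 z' < 1 / ?e + d2"
      using tile_dist_meets[of L t u d2] lf ut by (meson locally_finiteD(1))
    then have "u \<in> patch T2 0 (1 / d1)"
      using ut r by (force simp: mem_patch)
    then show "t \<in> g ` (P2 \<inter> Q2)" using u f(3) by auto
  qed
  moreover have "\<forall>t\<in>P. tile_dist L t ((g \<circ> f) t) < ?e"
  proof
    fix t assume "t \<in> P"
    then have t: "t \<in> P1" "f t \<in> Q2" by (auto simp: P_def)
    then have "closed_tile L t" "closed_tile L (f t)" "closed_tile L (g (f t))"
      using lf f(2) g(2,4,5) by (meson bij_betwE locally_finiteD(1) subsetD)+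
    then show "tile_dist L t ((g \<circ> f) t) < ?e"
      using tile_dist_triangle[of L t "f t" "g (f t)"] f(6) g(6) t by fastforce
  qed
  moreover have "P \<subseteq> T1" "g ` (P2 \<inter> Q2) \<subseteq> T3"
    using f(2) g(4,5) by (auto simp: P_def bij_betw_def)
  ultimately show ?thesis
    unfolding pattern_close_def using bij_betw_trans[OF bf bg] by blast
qed

text \<open>The cap at \<open>1\<close> is harmless for the topology and makes the triangle inequality hold, as
  \<open>pattern_close_triangle\<close> covers only sums up to \<open>1\<close>.\<close>

definition pattern_dist :: "'l metric \<Rightarrow> ('a::euclidean_space, 'l) pattern \<Rightarrow> ('a, 'l) pattern \<Rightarrow> real" where
  "pattern_dist L T T' = Inf (insert 1 {e. 0 < e \<and> pattern_close L e T T'})"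

lemma pattern_dist_bdd: "bdd_below (insert 1 {e. 0 < e \<and> pattern_close L e T T'})"
  by (intro bdd_belowI[of _ 0]) auto

lemma pattern_dist_le: "0 < e \<Longrightarrow> pattern_close L e T T' \<Longrightarrow> pattern_dist L T T' \<le> e"
  unfolding pattern_dist_def by (rule cInf_lower[OF _ pattern_dist_bdd]) auto

lemma pattern_dist_le_1: "pattern_dist L T T' \<le> 1"
  unfolding pattern_dist_def by (rule cInf_lower[OF _ pattern_dist_bdd]) auto

lemma pattern_dist_nonneg: "0 \<le> pattern_dist L T T'"
  unfolding pattern_dist_def by (rule cInf_greatest) auto

lemma pattern_dist_less: 
  assumes "pattern_dist L T T' < e" "e \<le> 1"
  shows "pattern_close L e T T'"
proof -
  obtain d where "d \<in> insert 1 {e. 0 < e \<and> pattern_close L e T T'}" "d < e"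
    using assms(1) unfolding pattern_dist_def by (meson cInf_lessD insert_not_empty)
  then show ?thesis using assms(2) pattern_close_mono[of L d T T' e] by auto
qed

lemma pattern_close_refl: 
  assumes "locally_finite L T" "0 < e" shows "pattern_close L e T T"
  unfolding pattern_close_def using assms
  by (intro exI[of _ T] exI[of _ id]) (auto simp: patch_def locally_finite_def)

lemma pattern_dist_commute: "pattern_dist L T T' = pattern_dist L T' T"
proof -
  have "pattern_close L e T T' \<longleftrightarrow> pattern_close L e T' T" for e
    using pattern_close_commute by blast
  then show ?thesis by (simp add: pattern_dist_def)
qed

text \<open>A tile of the first pattern has partners at arbitrarily small distance among the tiles of the
  second; by local finiteness there are finitely many candidates, so some partner is at distance \<open>0\<close>.\<close>

lemma pattern_dist_eq_0:
  assumes lf: "locally_finite L T" "locally_finite L T'" and 0: "pattern_dist L T T' = 0"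
  shows "T = T'"
proof -
  have "S \<subseteq> S'" if lf: "locally_finite L S" "locally_finite L S'" and 0: "pattern_dist L S S' = 0" for S S'
  proof
    fix t assume t: "t \<in> S"
    then have ct: "closed_tile L t" using lf locally_finiteD by blast
    then obtain z where z: "z \<in> fst t" by (auto simp: closed_tile_def)
    define F where "F = patch S' 0 (norm z + 2)"
    have near: "\<exists>t'\<in>F. tile_dist L t t' < e" if e: "0 < e" for e
    proof -
      define d where "d = min e (1 / (norm z + 1))"
      have "1 / (norm z + 1) \<le> 1" by (simp add: add_nonneg_pos)
      then have d: "0 < d" "d \<le> e" "d \<le> 1 / (norm z + 1)" "d \<le> 1" 
        using e unfolding d_def by (auto simp: min_def intro: add_nonneg_pos)
      have "norm z + 1 \<le> 1 / d"
        using d(1,3) le_imp_inverse_le[of d "1 / (norm z + 1)"] by (simp add: inverse_eq_divide)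
      have "pattern_close L d S S'" using 0 d by (intro pattern_dist_less) auto
      then obtain P P' f where f: "patch S 0 (1 / d) \<subseteq> P" "P \<subseteq> S" "P' \<subseteq> S'"
        "bij_betw f P P'" "\<forall>t\<in>P. tile_dist L t (f t) < d"
        unfolding pattern_close_def by blast
      have "t \<in> patch S 0 (1 / d)" using t z \<open>norm z + 1 \<le> 1 / d\<close> by (force simp: mem_patch)
      then have *: "f t \<in> S'" "tile_dist L t (f t) < d" using f by (auto simp: bij_betw_def)
      have "f t \<in> F"
        using tile_dist_meets[of L t "f t" d z 0 "norm z + 1"] ct lf(2) * z d
        by (force simp: F_def mem_patch locally_finite_def)
      then show ?thesis using * d by force
    qed
    have fin: "finite F" unfolding F_def using lf by (simp add: locally_finite_def)
    have "\<exists>t'\<in>F. tile_dist L t t' = 0"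
    proof (rule ccontr)
      assume c: "\<not> ?thesis"
      have "F \<noteq> {}" using near[of 1] by auto
      define m where "m = Min (tile_dist L t ` F)"
      have "m \<in> tile_dist L t ` F" unfolding m_def using fin \<open>F \<noteq> {}\<close> by (intro Min_in) auto
      then have "0 < m" using c tile_dist_nonneg[of L t] by (force simp: less_le)
      then obtain t' where "t' \<in> F" "tile_dist L t t' < m" using near by blast
      then show False unfolding m_def using fin by (meson Min_le finite_imageI image_eqI leD)
    qed
    then obtain t' where "t' \<in> F" "tile_dist L t t' = 0" by blast
    then show "t \<in> S'" using tile_dist_eq_0[OF ct] lf(2) 
      by (metis F_def locally_finiteD(1) patch_subset subsetD)
  qed
  moreover have "pattern_dist L T' T = 0"
    using 0 by (simp add: pattern_dist_commute)
  ultimately show ?thesis using lf 0 by blast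
qed

lemma Metric_space_pattern_dist:
  assumes "\<And>T. T \<in> X \<Longrightarrow> locally_finite L T"
  shows "Metric_space X (pattern_dist L)"
proof
  show "0 \<le> pattern_dist L x y" for x y by (rule pattern_dist_nonneg)
  show "pattern_dist L x y = pattern_dist L y x" for x y
    by (rule pattern_dist_commute)
  show "(pattern_dist L x y = 0) = (x = y)" if "x \<in> X" "y \<in> X" for x y
  proof
    assume "x = y"
    then have "pattern_dist L x y \<le> e" if "0 < e" for e
      using that \<open>x \<in> X\<close> assms by (auto intro!: pattern_dist_le pattern_close_refl)
    then show "pattern_dist L x y = 0" 
      using pattern_dist_nonneg[of L x y] by (metis field_le_epsilon add_0 antisym)
  qed (use assms that pattern_dist_eq_0 in blast)
  show "pattern_dist L x z \<le> pattern_dist L x y + pattern_dist L y z" if xyz: "x \<in> X" "y \<in> X" "z \<in> X" for x y z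
  proof (rule field_le_epsilon)
    fix e :: real assume "0 < e"
    let ?a = "pattern_dist L x y + e / 2" and ?b = "pattern_dist L y z + e / 2"
    show "pattern_dist L x z \<le> pattern_dist L x y + pattern_dist L y z + e"
    proof (cases "?a + ?b \<le> 1")
      case True
      have pos: "0 < ?a" "0 < ?b" using \<open>0 < e\<close> pattern_dist_nonneg by (smt (verit) half_gt_zero)+
      then have "pattern_close L ?a x y" "pattern_close L ?b y z"
        using True \<open>0 < e\<close> pos by (intro pattern_dist_less; simp)+
      then have "pattern_close L (?a + ?b) x z"
        using pattern_close_triangle[of L x y z ?a ?b] True pos assms xyz by blast
      then have "pattern_dist L x z \<le> ?a + ?b" using pos by (intro pattern_dist_le) auto
      then show ?thesis by simp
    qed (use pattern_dist_le_1[of L x z] in auto)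
  qed
qed

lemma pattern_topology_eq_mtopology:
  assumes "\<And>T. T \<in> X \<Longrightarrow> locally_finite L T"
  shows "pattern_topology L X = Metric_space.mtopology X (pattern_dist L)"
proof -
  interpret Metric_space X "pattern_dist L" by (rule Metric_space_pattern_dist[OF assms])
  have "(\<exists>e>0. \<forall>T'\<in>X. pattern_close L e T T' \<longrightarrow> T' \<in> U) \<longleftrightarrow> (\<exists>r>0. mball T r \<subseteq> U)" 
    if "U \<subseteq> X" "T \<in> U" for U T
  proof
    assume "\<exists>e>0. \<forall>T'\<in>X. pattern_close L e T T' \<longrightarrow> T' \<in> U"
    then obtain e where e: "0 < e" "\<forall>T'\<in>X. pattern_close L e T T' \<longrightarrow> T' \<in> U" by blast
    have "mball T (min e 1) \<subseteq> U"
    proof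
      fix S assume "S \<in> mball T (min e 1)"
      then have "S \<in> X" "pattern_close L (min e 1) T S" by (auto intro!: pattern_dist_less)
      then show "S \<in> U" using e pattern_close_mono[of L "min e 1" T S e] by auto
    qed
    then show "\<exists>r>0. mball T r \<subseteq> U" using e by (intro exI[of _ "min e 1"]) auto
  next
    assume "\<exists>r>0. mball T r \<subseteq> U"
    then obtain r where r: "0 < r" "mball T r \<subseteq> U" by blast
    have "S \<in> U" if "S \<in> X" "pattern_close L (r/2) T S" for S
      using pattern_dist_le[of "r/2" L T S] that r \<open>T \<in> U\<close> \<open>U \<subseteq> X\<close> by (force simp: in_mball)
    then show "\<exists>e>0. \<forall>T'\<in>X. pattern_close L e T T' \<longrightarrow> T' \<in> U"
      using r by (intro exI[of _ "r/2"]) auto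
  qed
  then show ?thesis
    unfolding topology_eq openin_pattern_topology openin_mtopology by blast
qed


section \<open>Local finiteness of tilings and labelled Delone sets\<close>

text \<open>Compactness in the form in which it is used below: a constant that can be chosen locally, and
  may always be decreased, can be chosen globally.\<close>

lemma compact_space_uniform:
  fixes Q :: "real \<Rightarrow> 'x \<Rightarrow> bool"
  assumes "compact_space \<tau>"
    and local: "\<And>x. x \<in> topspace \<tau> \<Longrightarrow> \<exists>e>0. \<exists>U. openin \<tau> U \<and> x \<in> U \<and> (\<forall>y\<in>U. Q e y)"
    and anti: "\<And>e e' y. 0 < e' \<Longrightarrow> e' \<le> e \<Longrightarrow> Q e y \<Longrightarrow> Q e' y"
  shows "\<exists>e>0. \<forall>y\<in>topspace \<tau>. Q e y"
proof -
  define \<U> where "\<U> = {U. openin \<tau> U \<and> (\<exists>e>0. \<forall>y\<in>U. Q e y)}"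
  have "(\<forall>U\<in>\<U>. openin \<tau> U) \<and> topspace \<tau> \<subseteq> \<Union>\<U>"
    using local unfolding \<U>_def by blast
  then obtain \<F> where F: "finite \<F>" "\<F> \<subseteq> \<U>" "topspace \<tau> \<subseteq> \<Union>\<F>"
    using assms(1) unfolding compact_space_alt by meson
  then have "\<forall>U\<in>\<F>. \<exists>e>0. \<forall>y\<in>U. Q e y" unfolding \<U>_def by blast
  then obtain e where e: "\<And>U. U \<in> \<F> \<Longrightarrow> 0 < e U" "\<And>U y. U \<in> \<F> \<Longrightarrow> y \<in> U \<Longrightarrow> Q (e U) y"
    by metis
  define m where "m = Min (insert 1 (e ` \<F>))"
  have "0 < m" unfolding m_def using F(1) e(1) by auto
  moreover have "m \<le> e U" if "U \<in> \<F>" for U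
    unfolding m_def using F(1) that by simp
  ultimately show ?thesis using F(3) e(2) anti by (meson Union_iff subsetD)
qed

lemma separated_bounded_finite:
  fixes S :: "'a::euclidean_space set"
  assumes "0 < e" "\<And>x y. x \<in> S \<Longrightarrow> y \<in> S \<Longrightarrow> x \<noteq> y \<Longrightarrow> e \<le> dist x y" "bounded S"
  shows "finite S"
proof (rule ccontr)
  assume "infinite S"
  then obtain x where "x islimpt S"
    using assms(3) by (metis bounded_infinite_imp_islimpt order_refl)
  then show False
    using discrete_imp_not_islimpt[OF assms(1), of S x] assms(2) by (metis leD)
qed

text \<open>A point of the smaller ball outside \<open>K'\<close> would be cut off from \<open>K'\<close> by a hyperplane, and
  the point of the larger ball farthest beyond that hyperplane would be too far from \<open>K'\<close>.\<close>

lemma convex_near_ball: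
  fixes K K' :: "'a::euclidean_space set"
  assumes "cball c r \<subseteq> K" "convex K'" "closed K'" "\<And>x. x \<in> K \<Longrightarrow> \<exists>y\<in>K'. dist x y \<le> h" "0 \<le> r"
  shows "ball c (r - h) \<subseteq> K'"
proof
  fix y assume y: "y \<in> ball c (r - h)"
  show "y \<in> K'"
  proof (rule ccontr)
    assume "y \<notin> K'"
    then obtain a b where ab: "a \<bullet> y < b" "\<forall>x\<in>K'. b < a \<bullet> x"
      using separating_hyperplane_closed_point[OF assms(2,3)] by blast
    define x where "x = c - (r / norm a) *\<^sub>R a"
    have "x \<in> cball c r" using assms(5) by (simp add: x_def dist_norm)
    then obtain x' where x': "x' \<in> K'" "dist x x' \<le> h" using assms(1,4) by blast
    then have "a \<noteq> 0" using ab by auto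
    have "a \<bullet> (x' - x) \<le> norm a * h"
      using Cauchy_Schwarz_ineq2[of a "x' - x"] x'(2) mult_left_mono[of "norm (x' - x)" h "norm a"]
      by (simp add: dist_norm norm_minus_commute)
    moreover have "a \<bullet> x = a \<bullet> c - r * norm a"
      using \<open>a \<noteq> 0\<close> by (simp add: x_def inner_diff_right dot_square_norm power2_eq_square)
    moreover have "a \<bullet> (c - y) \<le> norm a * dist c y"
      using Cauchy_Schwarz_ineq2[of a "c - y"] by (simp add: dist_norm)
    moreover have "norm a * dist c y \<le> norm a * (r - h)"
      using y by (intro mult_left_mono) auto
    ultimately show False using ab x'(1) by (force simp: inner_diff_right algebra_simps)
  qed
qed

lemma is_tile_closed_tile: "is_tile L t \<Longrightarrow> closed_tile L t"
  unfolding is_tile_def closed_tile_def using polytope_imp_compact interior_empty by metis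

text \<open>Inradius and diameter are controlled locally in the Hausdorff distance, the inradius by
  \<open>convex_near_ball\<close>; compactness of the set of prototiles makes the control uniform.\<close>

lemma prototile_set_bounds:
  fixes P :: "('a::euclidean_space, 'l) tile set"
  assumes "prototile_set L P"
  shows "\<exists>e>0. \<forall>p\<in>P. (\<exists>c. ball c e \<subseteq> fst p) \<and> (\<forall>u\<in>fst p. \<forall>v\<in>fst p. dist u v \<le> 1 / e)"
proof -
  have tiles: "is_tile L p" "closed_tile L p" if "p \<in> P" for p
    using assms that is_tile_closed_tile unfolding prototile_set_def by blast+
  interpret Metric_space P "tile_dist L"
  proof
    show "0 \<le> tile_dist L p q" for p q :: "('a, 'l) tile" by (rule tile_dist_nonneg)
    show "tile_dist L p q = tile_dist L q p" for p q :: "('a, 'l) tile" by (rule tile_dist_commute)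
    show "tile_dist L p q = 0 \<longleftrightarrow> p = q" if "p \<in> P" "q \<in> P" for p q
      using tile_dist_eq_0[of L p q] tile_dist_self[of L p] tiles[OF that(1)] tiles[OF that(2)] by blast
    show "tile_dist L p t \<le> tile_dist L p q + tile_dist L q t" if "p \<in> P" "q \<in> P" "t \<in> P" for p q t
      using tile_dist_triangle[of L p q t] tiles that by auto
  qed
  let ?Q = "\<lambda>e p. (\<exists>c. ball c e \<subseteq> fst p) \<and> (\<forall>u\<in>fst p. \<forall>v\<in>fst p. dist u v \<le> 1 / e)"
  have "\<exists>e>0. \<forall>p\<in>topspace mtopology. ?Q e p"
  proof (rule compact_space_uniform)
    show "compact_space mtopology"
      using assms by (simp add: prototile_set_def)
    show "?Q e' p" if "0 < e'" "e' \<le> e" "?Q e p" for e e' and p :: "('a, 'l) tile"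
    proof -
      have "1 / e \<le> 1 / e'" using that by (simp add: frac_le)
      then show ?thesis using that subset_ball[OF that(2)] by (meson order_trans)
    qed
    fix p assume "p \<in> topspace mtopology"
    then have p: "p \<in> P" by simp
    then have pt: "polytope (fst p)" "interior (fst p) \<noteq> {}" using tiles[of p] by (auto simp: is_tile_def)
    obtain c r where r: "0 < r" "cball c r \<subseteq> fst p"
      using pt(2) by (metis all_not_in_conv mem_interior_cball)
    obtain D where D: "\<forall>u\<in>fst p. \<forall>v\<in>fst p. dist u v \<le> D"
      using bounded_two_points polytope_imp_bounded[OF pt(1)] by blast
    define e where "e = min (r / 2) (1 / (\<bar>D\<bar> + r))"
    have e: "0 < e" "e \<le> r / 2" "e \<le> 1 / (\<bar>D\<bar> + r)" using r(1) unfolding e_def by auto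
    have "\<bar>D\<bar> + r \<le> 1 / e"
      using e(1,3) le_imp_inverse_le[of e "1 / (\<bar>D\<bar> + r)"] by (simp add: inverse_eq_divide)
    have "?Q e q" if "q \<in> mball p (r / 2)" for q
    proof -
      have q: "q \<in> P" "tile_dist L p q \<le> r / 2" using that by auto
      have qt: "polytope (fst q)" using tiles[OF q(1)] by (auto simp: is_tile_def)
      note pq = tile_dist_le_iff[OF tiles(2)[OF p] tiles(2)[OF q(1)], THEN iffD1, OF q(2)]
      have "ball c (r - r / 2) \<subseteq> fst q"
        using r pq polytope_imp_convex[OF qt] polytope_imp_closed[OF qt]
        by (intro convex_near_ball[of c r "fst p"]) auto
      then have "ball c e \<subseteq> fst q" using subset_ball[of e "r/2" c] e(2) by auto
      moreover have "dist u v \<le> 1 / e" if uv: "u \<in> fst q" "v \<in> fst q" for u v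
      proof -
        obtain u' v' where "u' \<in> fst p" "v' \<in> fst p" "dist u' u \<le> r / 2" "dist v' v \<le> r / 2"
          using pq uv by meson
        moreover have "dist u v \<le> dist u' u + dist u' v' + dist v' v"
          using dist_triangle[of u v u'] dist_triangle[of u' v v'] by (simp add: dist_commute)
        ultimately show ?thesis using D \<open>\<bar>D\<bar> + r \<le> 1 / e\<close> by fastforce
      qed
      ultimately show ?thesis by blast
    qed
    then show "\<exists>e>0. \<exists>U. openin mtopology U \<and> p \<in> U \<and> (\<forall>q\<in>U. ?Q e q)"
      using e(1) r(1) p by (intro exI[of _ e] conjI exI[of _ "mball p (r/2)"]) auto
  qed
  then show ?thesis by simp
qed

text \<open>What the arguments below use of tilings and of labelled Delone sets alike.\<close>

definition vertex_pattern :: "'l metric \<Rightarrow> ('a::euclidean_space, 'l) pattern \<Rightarrow> bool" where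
  "vertex_pattern L T \<longleftrightarrow> locally_finite L T \<and> T \<noteq> {} \<and>
     (\<forall>t\<in>T. finite {v. v extreme_point_of fst t} \<and> {v. v extreme_point_of fst t} \<noteq> {})"

lemma vertex_pattern_labelled_delone:
  fixes T :: "('a::euclidean_space, 'l) pattern"
  assumes "labelled_delone L T"
  shows "vertex_pattern L T"
proof -
  obtain \<Lambda> lab r R where \<Lambda>: "lab ` \<Lambda> \<subseteq> mspace L" "T = labelled_points \<Lambda> lab"
    and r: "0 < r" "\<forall>p\<in>\<Lambda>. \<forall>q\<in>\<Lambda>. p \<noteq> q \<longrightarrow> r \<le> dist p q" and R: "\<forall>x. \<exists>p\<in>\<Lambda>. dist x p \<le> R"
    using assms unfolding labelled_delone_def delone_def by auto
  have "finite (patch T x s)" for x s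
  proof -
    have "finite (\<Lambda> \<inter> ball x s)"
      using r by (intro separated_bounded_finite[of r]) auto
    moreover have "patch T x s \<subseteq> (\<lambda>p. ({p}, lab p)) ` (\<Lambda> \<inter> ball x s)"
      by (auto simp: \<Lambda>(2) labelled_points_def patch_def)
    ultimately show ?thesis using finite_surj by blast
  qed
  moreover have "T \<noteq> {}" using R by (auto simp: \<Lambda>(2) labelled_points_def)
  moreover have "{v. v extreme_point_of {p}} = {p}" for p
    by (auto simp: extreme_point_of_def)
  ultimately show ?thesis
    using \<Lambda> by (auto simp: vertex_pattern_def locally_finite_def closed_tile_def labelled_points_def)
qed

text \<open>Distinct tiles have disjoint interiors, so the centres of balls of a common radius
  inscribed in them are uniformly separated.\<close>

lemma vertex_pattern_tiling:
  assumes "prototile_set L P" "tiling P T"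
  shows "vertex_pattern L T"
proof -
  obtain e where e: "0 < e" "\<forall>p\<in>P. (\<exists>c. ball c e \<subseteq> fst p) \<and> (\<forall>u\<in>fst p. \<forall>v\<in>fst p. dist u v \<le> 1 / e)"
    using prototile_set_bounds[OF assms(1)] by blast
  have tile: "closed_tile L t \<and> polytope (fst t) \<and> (\<exists>c. ball c e \<subseteq> fst t) \<and>
      (\<forall>u\<in>fst t. \<forall>v\<in>fst t. dist u v \<le> 1 / e)" if "t \<in> T" for t
  proof -
    from assms(2)[unfolded tiling_def] that obtain p x where px: "p \<in> P" "t = tile_minus p x"
      by metis
    have p: "is_tile L p" using assms(1) px(1) unfolding prototile_set_def by blast
    have eq: "fst t = (+) (- x) ` fst p" by (simp add: px fst_tile_minus)
    obtain c where c: "ball c e \<subseteq> fst p" using e px by blast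
    have "ball (c - x) e \<subseteq> fst t"
    proof
      fix z assume "z \<in> ball (c - x) e"
      then have "z + x \<in> ball c e" by (simp add: dist_norm algebra_simps)
      then show "z \<in> fst t" using c by (auto simp: px(2) mem_fst_tile_minus)
    qed
    moreover have "polytope (fst t)"
      using p polytope_translation_eq[of "- x" "fst p"] unfolding eq is_tile_def by blast
    moreover have "\<forall>u\<in>fst t. \<forall>v\<in>fst t. dist u v \<le> 1 / e"
      using e(2) px(1) unfolding eq by (auto simp: dist_norm)
    ultimately show ?thesis using is_tile_closed_tile[OF p] px(2) by auto
  qed
  have "finite (patch T x R)" for x R
  proof -
    have "\<forall>t\<in>T. \<exists>c. ball c e \<subseteq> fst t" using tile by blast
    then obtain c where c: "\<And>t. t \<in> T \<Longrightarrow> ball (c t) e \<subseteq> fst t" by metis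
    have ct: "c t \<in> fst t" if "t \<in> T" for t using c[OF that] e(1) by force
    have sep: "e \<le> dist (c t) (c t')" if "t \<in> T" "t' \<in> T" "t \<noteq> t'" for t t'
    proof (rule ccontr)
      assume "\<not> ?thesis"
      then have "c t' \<in> interior (fst t)"
        using c[OF that(1)] interior_maximal[of "ball (c t) e" "fst t"] by auto
      moreover have "c t' \<in> frontier (fst t)"
        using calculation ct[OF that(2)] assms(2) that interior_subset unfolding tiling_def by blast
      ultimately show False by (simp add: frontier_def)
    qed
    have "finite (c ` patch T x R)"
    proof (rule separated_bounded_finite[OF e(1)])
      have "c ` patch T x R \<subseteq> cball x (R + 1 / e)"
      proof clarify
        fix t assume "t \<in> patch T x R"
        then obtain z where "t \<in> T" "z \<in> fst t" "dist x z < R" by (auto simp: mem_patch)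
        then show "c t \<in> cball x (R + 1 / e)"
          using tile[of t] ct[of t] dist_triangle[of x "c t" z] by fastforce
      qed
      then show "bounded (c ` patch T x R)" using bounded_cball bounded_subset by blast
    qed (use sep patch_subset in blast)
    moreover have "inj_on c (patch T x R)"
      using sep e(1) by (fastforce simp: inj_on_def mem_patch)
    ultimately show ?thesis using finite_imageD by blast
  qed
  moreover have "T \<noteq> {}"
    using assms(2) by (auto simp: tiling_def)
  moreover have "finite {v. v extreme_point_of fst t} \<and> {v. v extreme_point_of fst t} \<noteq> {}" if "t \<in> T" for t
  proof -
    have t: "polytope (fst t)" "fst t \<noteq> {}" using tile[OF that] by (auto simp: closed_tile_def)
    have "fst t = convex hull {v. v extreme_point_of fst t}"
      using t by (intro Krein_Milman_Minkowski polytope_imp_compact polytope_imp_convex)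
    then show ?thesis
      using t finite_polyhedron_extreme_points[OF polytope_imp_polyhedron[OF t(1)]] convex_hull_empty
      by metis
  qed
  ultimately show ?thesis
    using tile by (auto simp: vertex_pattern_def locally_finite_def)
qed

lemma vertex_pattern_tiling_space: "tiling_space L X \<Longrightarrow> T \<in> X \<Longrightarrow> vertex_pattern L T"
  unfolding tiling_space_def using vertex_pattern_tiling vertex_pattern_labelled_delone by blast

lemma finite_vertices_in_ball:
  assumes "vertex_pattern L T"
  shows "finite (vertex_set T \<inter> ball x R)"
proof (rule finite_subset)
  show "vertex_set T \<inter> ball x R \<subseteq> (\<Union>t\<in>patch T x R. {v. v extreme_point_of fst t})"
    by (auto simp: vertex_set_def patch_def extreme_point_of_def)
  show "finite (\<Union>t\<in>patch T x R. {v. v extreme_point_of fst t})"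
    using assms patch_subset by (intro finite_UN_I) (auto simp: vertex_pattern_def locally_finite_def patch_def)
qed


section \<open>Tiling spaces with finite local complexity\<close>

locale flc_space =
  fixes L :: "'l metric" and X :: "('a::euclidean_space, 'l) pattern set"
  assumes tiling_space: "tiling_space L X" and FLC: "FLC X"
begin

lemma vertex_pattern: "T \<in> X \<Longrightarrow> vertex_pattern L T"
  using vertex_pattern_tiling_space tiling_space by blast

lemma locally_finite: "T \<in> X \<Longrightarrow> locally_finite L T"
  using vertex_pattern by (simp add: vertex_pattern_def)

lemma topology_eq: "pattern_topology L X = Metric_space.mtopology X (pattern_dist L)"
  by (rule pattern_topology_eq_mtopology) (rule locally_finite)

lemma metric_space: "Metric_space X (pattern_dist L)"
  by (rule Metric_space_pattern_dist) (rule locally_finite)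

lemma translate_in [simp]: "T \<in> X \<Longrightarrow> pattern_minus T x \<in> X"
  using tiling_space by (simp add: tiling_space_def)

lemma compact: "compact_space (pattern_topology L X)"
  using tiling_space by (simp add: tiling_space_def)

lemma pattern_eqI:
  assumes "T \<in> X" "T' \<in> X" "\<And>R. R \<ge> R0 \<Longrightarrow> patch T 0 R = patch T' 0 R"
  shows "T = T'"
  by (rule pattern_eqI_patch[of T T' R0])
    (use assms locally_finite in \<open>auto simp: locally_finite_def closed_tile_def\<close>)

text \<open>The finite sets in the definition of finite local complexity may contain patterns that are no
  patches at all; here these are discarded.\<close>

lemma finite_patches:
  "\<exists>F. finite F \<and> (\<forall>Q\<in>F. finite Q \<and> (\<exists>T\<in>X. Q \<subseteq> T)) \<and> (\<forall>T\<in>X. \<forall>x. \<exists>Q\<in>F. \<exists>y. patch T x R = pattern_minus Q y)"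
proof -
  obtain F where F: "finite F" "\<forall>T\<in>X. \<forall>x. \<exists>Q\<in>F. \<exists>y. patch T x R = pattern_minus Q y"
    using FLC[unfolded FLC_def, THEN spec, of R] by (elim exE conjE)
  define F' where "F' = {Q\<in>F. finite Q \<and> (\<exists>T\<in>X. Q \<subseteq> T)}"
  have "\<exists>Q\<in>F'. \<exists>y. patch T x R = pattern_minus Q y" if T: "T \<in> X" for T x
  proof -
    obtain Q y where Q: "Q \<in> F" "patch T x R = pattern_minus Q y" using F(2) T by metis
    then have eq: "Q = pattern_minus (patch T x R) (- y)" by (simp add: pattern_minus_minus)
    have "finite Q"
      using locally_finite[OF T] unfolding eq pattern_minus_def by (auto simp: locally_finite_def)
    moreover have "Q \<subseteq> pattern_minus T (- y)"
      using patch_subset[of T x R] unfolding eq pattern_minus_def by blast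
    ultimately have "Q \<in> F'" using Q(1) T unfolding F'_def by (auto intro: bexI[of _ "pattern_minus T (- y)"])
    then show ?thesis using Q(2) by blast
  qed
  then show ?thesis using F(1) by (intro exI[of _ F']) (auto simp: F'_def)
qed

text \<open>Two vertices at distance less than \<open>1\<close> belong to tiles of a common patch of radius \<open>1\<close>, and
  finitely many patches have finitely many differences of vertices.\<close>

lemma vertex_separation:
  "\<exists>\<kappa>>0. \<forall>T\<in>X. \<forall>v\<in>vertex_set T. \<forall>w\<in>vertex_set T. v \<noteq> w \<longrightarrow> \<kappa> \<le> dist v w"
proof -
  obtain F where F: "finite F" "\<forall>Q\<in>F. finite Q \<and> (\<exists>T\<in>X. Q \<subseteq> T)"
    "\<forall>T\<in>X. \<forall>x. \<exists>Q\<in>F. \<exists>y. patch T x 1 = pattern_minus Q y"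
    using finite_patches[of 1] by (elim exE conjE)
  define E where "E = (\<Union>Q\<in>F. \<Union>t\<in>Q. {v. v extreme_point_of fst t})"
  have "finite E"
    unfolding E_def using F(1,2) vertex_pattern by (intro finite_UN_I) (auto simp: vertex_pattern_def)
  define \<kappa> where "\<kappa> = Min (insert 1 (norm ` ((\<lambda>(a, b). a - b) ` (E \<times> E) - {0})))"
  have fin: "finite (insert 1 (norm ` ((\<lambda>(a, b). a - b) ` (E \<times> E) - {0})))"
    using \<open>finite E\<close> by simp
  then have "0 < \<kappa>" unfolding \<kappa>_def by auto
  moreover have "\<kappa> \<le> dist v w" if T: "T \<in> X" and vw: "v \<in> vertex_set T" "w \<in> vertex_set T" "v \<noteq> w" for T v w
  proof (cases "dist v w < 1")
    case True
    obtain Q y where Q: "Q \<in> F" "patch T v 1 = pattern_minus Q y" using F(3) T by metis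
    have "u + y \<in> E" if "u \<in> vertex_set T" "dist v u < 1" for u
    proof -
      from that(1) obtain t where t: "t \<in> T" "u extreme_point_of fst t" by (auto simp: vertex_set_def)
      then have "t \<in> pattern_minus Q y"
        using that(2) unfolding Q(2)[symmetric] by (auto simp: mem_patch extreme_point_of_def)
      then obtain q where "q \<in> Q" "t = tile_minus q y" by (auto simp: pattern_minus_def)
      then show ?thesis
        using t(2) vertex_set_minus[of u "{q}" y] Q(1) by (auto simp: vertex_set_def E_def pattern_minus_def)
    qed
    then have "v + y \<in> E" "w + y \<in> E" using vw True by auto
    then have "(v + y) - (w + y) \<in> (\<lambda>(a, b). a - b) ` (E \<times> E) - {0}"
      using vw(3) by (intro DiffI image_eqI[of _ _ "(v + y, w + y)"]) auto
    then have "dist v w \<in> insert 1 (norm ` ((\<lambda>(a, b). a - b) ` (E \<times> E) - {0}))"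
      by (auto simp: dist_norm image_iff)
    then show ?thesis using Min_le[OF fin] by (simp add: \<kappa>_def)
  next
    case False
    have "\<kappa> \<le> 1" using fin by (simp add: \<kappa>_def)
    then show ?thesis using False by simp
  qed
  ultimately show ?thesis by blast
qed

lemma tile_diameter_bound: "\<exists>D. \<forall>T\<in>X. \<forall>t\<in>T. \<forall>u\<in>fst t. \<forall>v\<in>fst t. dist u v \<le> D"
proof -
  obtain F where F: "finite F" "\<forall>Q\<in>F. finite Q \<and> (\<exists>T\<in>X. Q \<subseteq> T)"
    "\<forall>T\<in>X. \<forall>x. \<exists>Q\<in>F. \<exists>y. patch T x 1 = pattern_minus Q y"
    using finite_patches[of 1] by (elim exE conjE)
  have "bounded (\<Union>Q\<in>F. \<Union>t\<in>Q. fst t)"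
  proof (intro bounded_UN F(1) ballI)
    fix Q t assume "Q \<in> F" "t \<in> Q"
    then show "bounded (fst t)"
      using F(2) locally_finite unfolding locally_finite_def closed_tile_def by (meson compact_imp_bounded subsetD)
  qed (use F(2) in blast)
  then obtain D where D: "\<forall>u\<in>(\<Union>Q\<in>F. \<Union>t\<in>Q. fst t). \<forall>v\<in>(\<Union>Q\<in>F. \<Union>t\<in>Q. fst t). dist u v \<le> D"
    using bounded_two_points by blast
  have "dist u v \<le> D" if "T \<in> X" "t \<in> T" "u \<in> fst t" "v \<in> fst t" for T t u v
  proof -
    from F(3) that obtain Q y where Q: "Q \<in> F" "patch T u 1 = pattern_minus Q y" by metis
    have "t \<in> patch T u 1" using that by (force simp: mem_patch)
    then obtain q where "q \<in> Q" "t = tile_minus q y" unfolding Q(2) by (auto simp: pattern_minus_def)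
    then have "u + y \<in> (\<Union>Q\<in>F. \<Union>t\<in>Q. fst t)" "v + y \<in> (\<Union>Q\<in>F. \<Union>t\<in>Q. fst t)"
      using that Q(1) by (auto simp: mem_fst_tile_minus)
    then have "dist (u + y) (v + y) \<le> D" using D by blast
    then show ?thesis by simp
  qed
  then show ?thesis by blast
qed

text \<open>Every pattern has a tile within some distance of the origin; by compactness this distance can
  be chosen uniformly, and by translation the origin replaced by any point.\<close>

lemma vertices_relatively_dense: "\<exists>\<rho>>0. \<forall>T\<in>X. \<forall>x. \<exists>v\<in>vertex_set T. dist x v < \<rho>"
proof -
  obtain D where D: "\<forall>T\<in>X. \<forall>t\<in>T. \<forall>u\<in>fst t. \<forall>v\<in>fst t. dist u v \<le> D"
    using tile_diameter_bound by blast
  let ?Q = "\<lambda>e T. patch T 0 (1 / e) \<noteq> {}"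
  have "\<exists>e>0. \<forall>T\<in>topspace (pattern_topology L X). ?Q e T"
  proof (rule compact_space_uniform[OF compact])
    show "?Q e' T" if "0 < e'" "e' \<le> e" "?Q e T" for e e' and T :: "('a, 'l) pattern"
    proof -
      have "1 / e \<le> 1 / e'" using that by (simp add: frac_le)
      then show ?thesis using patch_mono[of "1/e" "1/e'" T 0] that(3) by auto
    qed
    fix T assume "T \<in> topspace (pattern_topology L X)"
    then have T: "T \<in> X" by simp
    then obtain t z where t: "t \<in> T" "z \<in> fst t" "closed_tile L t"
      using vertex_pattern[OF T] locally_finiteD(1)[OF locally_finite[OF T]]
      by (auto simp: vertex_pattern_def closed_tile_def) (metis all_not_in_conv)
    define e where "e = 1 / (norm z + 2)"
    have e: "0 < e" "1 / e = norm z + 2" by (auto simp: e_def intro: add_nonneg_pos)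
    have "e \<le> 1" using norm_ge_zero[of z] by (simp add: e_def del: norm_ge_zero)
    interpret Metric_space X "pattern_dist L" by (rule metric_space)
    have "?Q e S" if "S \<in> mball T e" for S
    proof -
      have S: "S \<in> X" "pattern_close L e T S" using that \<open>e \<le> 1\<close> by (auto intro!: pattern_dist_less)
      then obtain P P' f where f: "patch T 0 (1 / e) \<subseteq> P" "P \<subseteq> T" "P' \<subseteq> S"
        "bij_betw f P P'" "\<forall>t\<in>P. tile_dist L t (f t) < e"
        unfolding pattern_close_def by blast
      have "t \<in> patch T 0 (1 / e)" using t e by (auto simp: mem_patch intro!: bexI[of _ z])
      then have *: "f t \<in> S" "tile_dist L t (f t) < e" using f by (auto simp: bij_betw_def)
      have "closed_tile L (f t)" using locally_finiteD(1)[OF locally_finite[OF S(1)] *(1)] .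
      then have "f t \<in> patch S 0 (1 / e)"
        using tile_dist_meets[of L t "f t" e z 0 "norm z + 1"] t * e \<open>e \<le> 1\<close> by (force simp: mem_patch)
      then show ?thesis by auto
    qed
    then show "\<exists>e>0. \<exists>U. openin (pattern_topology L X) U \<and> T \<in> U \<and> (\<forall>S\<in>U. ?Q e S)"
      using e(1) T unfolding topology_eq
      by (intro exI[of _ e] conjI exI[of _ "mball T e"]) auto
  qed
  then obtain e where e: "0 < e" "\<forall>T\<in>X. patch T 0 (1 / e) \<noteq> {}" by auto
  have "\<exists>v\<in>vertex_set T. dist x v < 1 / e + \<bar>D\<bar>" if T: "T \<in> X" for T x
  proof -
    have "patch (pattern_minus T x) 0 (1 / e) \<noteq> {}" using e T by simp
    then have "patch T x (1 / e) \<noteq> {}" unfolding patch_pattern_minus by (auto simp: pattern_minus_def)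
    then obtain t z where t: "t \<in> T" "z \<in> fst t" "dist x z < 1 / e" by (auto simp: mem_patch)
    obtain v where v: "v extreme_point_of fst t" using vertex_pattern[OF T] t(1) by (auto simp: vertex_pattern_def)
    then have "v \<in> fst t" by (simp add: extreme_point_of_def)
    then have "dist z v \<le> \<bar>D\<bar>" using D T t by fastforce
    then have "dist x v < 1 / e + \<bar>D\<bar>" using t(3) dist_triangle[of x v z] by linarith
    then show ?thesis using v t by (auto simp: vertex_set_def)
  qed
  moreover have "0 < 1 / e + \<bar>D\<bar>" using e(1) by (intro add_pos_nonneg) auto
  ultimately show ?thesis by blast
qed

end


section \<open>Patterns that agree on a large ball up to a small translation\<close>

text \<open>Under finite local complexity this relation describes the topology (\<open>open_near\<close> and
  \<open>near_open\<close> below), and it is easier to compose than \<open>pattern_close\<close>: tiles are not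
  deformed, and all of them move by the same vector.\<close>

definition near :: "real \<Rightarrow> real \<Rightarrow> ('a::euclidean_space, 'l) pattern \<Rightarrow> ('a, 'l) pattern \<Rightarrow> bool" where
  "near R e T T' \<longleftrightarrow> (\<exists>y. norm y < e \<and> patch T' 0 R = patch (pattern_minus T y) 0 R)"

lemma nearI: "norm y < e \<Longrightarrow> patch T' 0 R = patch (pattern_minus T y) 0 R \<Longrightarrow> near R e T T'"
  unfolding near_def by blast

lemma near_mono: "near R e T T' \<Longrightarrow> R' \<le> R \<Longrightarrow> e \<le> e' \<Longrightarrow> near R' e' T T'"
  unfolding near_def by (meson less_le_trans patch_eq_mono)

lemma near_translate: "norm x < e \<Longrightarrow> near R e T (pattern_minus T x)"
  unfolding near_def by blast

lemma near_patch_eq: "0 < e \<Longrightarrow> patch T' 0 R = patch T 0 R \<Longrightarrow> near R e T T'"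
  by (rule nearI[of 0]) auto

lemma near_commute:
  assumes "near (R + e) e T T'"
  shows "near R e T' T"
proof -
  obtain y where y: "norm y < e" "patch T' 0 (R + e) = patch (pattern_minus T y) 0 (R + e)"
    using assms unfolding near_def by blast
  have "patch T 0 R = patch (pattern_minus T' (0 - y)) 0 R"
    using y by (intro patch_eq_unshift[of T y "R + e" T' 0]) auto
  then show ?thesis using y(1) by (intro nearI[of "- y"]) auto
qed

lemma near_trans:
  assumes "near (R + e2) e1 T T'" "near R e2 T' T''"
  shows "near R (e1 + e2) T T''"
proof -
  obtain y where y: "norm y < e1" "patch T' 0 (R + e2) = patch (pattern_minus T y) 0 (R + e2)"
    using assms unfolding near_def by blast
  obtain z where z: "norm z < e2" "patch T'' 0 R = patch (pattern_minus T' z) 0 R"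
    using assms unfolding near_def by blast
  have "patch (pattern_minus T' z) 0 R = patch (pattern_minus (pattern_minus T y) z) 0 R"
    using y z by (intro patch_eq_shift[OF y(2)]) auto
  then show ?thesis
    using y z norm_triangle_ineq[of y z] by (intro nearI[of "y + z"]) (auto simp: pattern_minus_minus)
qed

lemma near_imp_pattern_close:
  assumes "locally_finite L T" "near R e' T T'" "1 / e + e' \<le> R" "e' \<le> e"
  shows "pattern_close L e T T'"
proof -
  obtain y where y: "norm y < e'" "patch T' 0 R = patch (pattern_minus T y) 0 R"
    using assms(2) unfolding near_def by blast
  define P where "P = {t \<in> T. tile_minus t y \<in> patch T' 0 R}"
  have "inj_on (\<lambda>t. tile_minus t y) P"
    by (rule inj_on_inverseI[of _ "\<lambda>t. tile_minus t (- y)"]) (simp add: tile_minus_minus)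
  moreover have "(\<lambda>t. tile_minus t y) ` P = patch T' 0 R"
    using patch_subset[of "pattern_minus T y" 0 R] by (auto simp: P_def y(2) pattern_minus_def)
  moreover have "patch T 0 (1 / e) \<subseteq> P"
  proof
    fix t assume "t \<in> patch T 0 (1 / e)"
    then obtain z where z: "t \<in> T" "z \<in> fst t" "norm z < 1 / e" by (auto simp: mem_patch)
    then have "z - y \<in> fst (tile_minus t y)" "dist 0 (z - y) < R"
      using y(1) assms(3) norm_triangle_ineq4[of z y] by (auto simp: mem_fst_tile_minus)
    then show "t \<in> P" using z(1) unfolding P_def y(2) by (auto simp: mem_patch pattern_minus_def)
  qed
  moreover have "patch T' 0 (1 / e) \<subseteq> patch T' 0 R"
    using assms(3) y(1) norm_ge_zero[of y] by (intro patch_mono) linarith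
  moreover have "\<forall>t\<in>P. tile_dist L t (tile_minus t y) < e"
  proof
    fix t assume "t \<in> P"
    then have "closed_tile L t" using assms(1) by (auto simp: P_def locally_finite_def)
    then show "tile_dist L t (tile_minus t y) < e"
      using tile_dist_minus_le[of L t 0 y] y(1) assms(4) by simp
  qed
  ultimately show ?thesis
    unfolding pattern_close_def bij_betw_def
    by (intro exI[of _ P] exI[of _ "patch T' 0 R"] exI[of _ "\<lambda>t. tile_minus t y"] conjI)
      (simp_all add: P_def patch_subset)
qed

lemma open_near:
  assumes "openin (pattern_topology L X) U" "T \<in> U" "locally_finite L T"
  shows "\<exists>e>0. \<forall>T'\<in>X. near (1 / e) e T T' \<longrightarrow> T' \<in> U"
proof -
  obtain e where e: "0 < e" "\<forall>T'\<in>X. pattern_close L e T T' \<longrightarrow> T' \<in> U"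
    using assms(1,2) unfolding openin_pattern_topology by blast
  define d where "d = 1 / (1 / e + e + 1)"
  have pos: "0 < 1 / e + e + 1" using e(1) by (simp add: add_pos_pos)
  have d: "0 < d" "1 / d = 1 / e + e + 1" using pos by (auto simp: d_def)
  have "d \<le> 1" "d \<le> e"
  proof -
    show "d \<le> 1" using e(1) pos by (simp add: d_def)
    have "d \<le> 1 / (1 / e)" unfolding d_def using e(1) by (intro divide_left_mono) (auto simp: add_pos_pos)
    then show "d \<le> e" by simp
  qed
  then have "pattern_close L e T T'" if "near (1 / d) d T T'" for T'
    using that d e(1) assms(3) by (intro near_imp_pattern_close[of L T "1 / d" d]) auto
  then show ?thesis using d(1) e(2) by blast
qed

lemma finite_tile_dist_limit:
  assumes "finite F" "closed_tile L t" "\<And>u. u \<in> F \<Longrightarrow> closed_tile L u"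
    and "\<And>e. 0 < e \<Longrightarrow> \<exists>u\<in>F. tile_dist L t u < e"
  shows "t \<in> F"
proof (rule ccontr)
  assume "t \<notin> F"
  then have pos: "0 < tile_dist L t u" if "u \<in> F" for u
    using that tile_dist_eq_0[OF assms(2) assms(3)[OF that]] tile_dist_nonneg[of L t u] by force
  have "F \<noteq> {}" using assms(4)[of 1] by auto
  then have "0 < Min (tile_dist L t ` F)" using assms(1) pos by simp
  then obtain u where "u \<in> F" "tile_dist L t u < Min (tile_dist L t ` F)" using assms(4) by blast
  moreover have "Min (tile_dist L t ` F) \<le> tile_dist L t u"
    using assms(1) \<open>u \<in> F\<close> by (intro Min_le) auto
  ultimately show False by simp
qed

lemma pattern_close_partner:
  assumes "pattern_close L e T T'" "t \<in> patch T 0 (1 / e)"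
  shows "\<exists>u\<in>T'. tile_dist L t u < e"
proof -
  obtain P P' f where f: "patch T 0 (1 / e) \<subseteq> P" "P' \<subseteq> T'" "bij_betw f P P'" "\<forall>t\<in>P. tile_dist L t (f t) < e"
    using assms(1) unfolding pattern_close_def by blast
  then have "t \<in> P" using assms(2) by blast
  moreover have "f t \<in> P'" using bij_betwE[OF f(3)] \<open>t \<in> P\<close> by blast
  ultimately show ?thesis using f(2,4) by blast
qed

context flc_space
begin

text \<open>Only finitely many patches \<open>Q\<close> can occur, so among patterns tending to \<open>T\<close> infinitely many
  show translates $Q-y_n$ of the same one, and the $y_n$ may be assumed to converge, to $y^*$ say.
  Local finiteness forces $Q-y^*$ to be the patch of \<open>T\<close> itself.\<close>

lemma pattern_close_imp_near:
  assumes T: "T \<in> X" and R: "0 < R" and e: "0 < e" "e \<le> 1"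
  shows "\<exists>d>0. \<forall>T'\<in>X. pattern_close L d T T' \<longrightarrow> near R e T T'"
proof (rule ccontr)
  assume contra: "\<not> ?thesis"
  define d where "d = (\<lambda>n::nat. 1 / (real n + R + 4))"
  have dpos: "0 < d n" "d n \<le> 1" "1 / d n = real n + R + 4" for n
    using R by (auto simp: d_def)
  have dlim: "d \<longlonglongrightarrow> 0" unfolding d_def by real_asymp
  obtain S where S: "\<And>n. S n \<in> X" "\<And>n. pattern_close L (d n) T (S n)" "\<And>n. \<not> near R e T (S n)"
  proof -
    have "\<forall>n. \<exists>S\<in>X. pattern_close L (d n) T S \<and> \<not> near R e T S" using contra dpos(1) by blast
    then show thesis using that by metis
  qed
  obtain F where F: "finite F" "\<forall>Q\<in>F. finite Q \<and> (\<exists>T\<in>X. Q \<subseteq> T)"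
    "\<forall>T\<in>X. \<forall>x. \<exists>Q\<in>F. \<exists>y. patch T x (R + 2) = pattern_minus Q y"
    using finite_patches[of "R + 2"] by (elim exE conjE)
  obtain QQ yy where Qy: "\<And>n. QQ n \<in> F" "\<And>n. patch (S n) 0 (R + 2) = pattern_minus (QQ n) (yy n)"
  proof -
    have "\<forall>n. \<exists>Q y. Q \<in> F \<and> patch (S n) 0 (R + 2) = pattern_minus Q y"
      using F(3) S(1) by metis
    then show thesis using that by metis
  qed
  have cT: "closed_tile L t" if "t \<in> T" for t using locally_finiteD(1)[OF locally_finite[OF T] that] .
  have cS: "closed_tile L t" if "t \<in> S n" for t n using locally_finiteD(1)[OF locally_finite[OF S(1)] that] .
  have fwd: "\<exists>u\<in>S n. tile_dist L t u < d n" if "t \<in> T" "t \<in> patch T 0 (R + 3)" for t n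
  proof -
    have "patch T 0 (R + 3) \<subseteq> patch T 0 (1 / d n)" unfolding dpos by (rule patch_mono) simp
    then show ?thesis using pattern_close_partner[OF S(2)[of n]] that(2) by blast
  qed
  have bwd: "\<exists>u\<in>T. tile_dist L t u < d n" if "t \<in> patch (S n) 0 (R + 3)" for t n
  proof -
    have "patch (S n) 0 (R + 3) \<subseteq> patch (S n) 0 (1 / d n)" unfolding dpos by (rule patch_mono) simp
    then show ?thesis using pattern_close_partner[OF pattern_close_commute[OF S(2)[of n]]] that by blast
  qed
  have "range QQ \<subseteq> F" using Qy(1) by blast
  then have "finite (range QQ)" using F(1) by (rule finite_subset)
  then obtain n0 where "infinite {n. QQ n = QQ n0}"
    using pigeonhole_infinite[of UNIV QQ] by auto
  then obtain Q where "infinite {n. QQ n = Q}" "Q \<in> F" using Qy(1) by blast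
  then obtain r where r: "strict_mono r" "\<And>n::nat. QQ (r n) = Q"
    using infinite_enumerate[of "{n. QQ n = Q}"] by auto
  have Q: "finite Q" using F(2) \<open>Q \<in> F\<close> by blast
  have cQ: "closed_tile L q" if "q \<in> Q" for q
    using F(2) \<open>Q \<in> F\<close> that locally_finite locally_finiteD(1) by blast
  have SQ: "patch (S (r n)) 0 (R + 2) = pattern_minus Q (yy (r n))" for n using Qy(2)[of "r n"] r(2) by simp
  have Qne: "Q \<noteq> {}"
  proof
    assume "Q = {}"
    then have "patch (S (r 0)) 0 (R + 2) = {}" using SQ[of 0] by (simp add: pattern_minus_def)
    moreover have "\<exists>u. u \<in> patch (S (r 0)) 0 (R + 2)" if "t \<in> patch T 0 R" for t
    proof -
      have "t \<in> patch T 0 (R + 3)" using that patch_mono[of R "R + 3" T 0] by auto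
      then obtain u where u: "u \<in> S (r 0)" "tile_dist L t u < d (r 0)" using fwd patch_subset by blast
      from that obtain z where z: "z \<in> fst t" "dist 0 z < R" by (auto simp: mem_patch)
      have "t \<in> T" using that patch_subset by blast
      then obtain z' where z': "z' \<in> fst u" "dist 0 z' < R + d (r 0)"
        using tile_dist_meets[OF cT cS[OF u(1)] u(2) z] by blast
      then have "dist 0 z' < R + 2" using dpos(2)[of "r 0"] by linarith
      then show ?thesis using u(1) z'(1) unfolding mem_patch by blast
    qed
    ultimately have "patch T 0 R = {}" "patch (S (r 0)) 0 R = {}"
      using patch_mono[of R "R + 2" "S (r 0)" 0] by auto
    then have "near R e T (S (r 0))" using e(1) by (intro near_patch_eq) auto
    then show False using S(3) by blast
  qed
  have "bounded (range (yy \<circ> r))"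
  proof -
    obtain q where q: "q \<in> Q" using Qne by blast
    obtain B where B: "\<And>z. z \<in> fst q \<Longrightarrow> norm z \<le> B"
      using cQ[OF q] by (meson bounded_iff closed_tile_def compact_imp_bounded)
    have "norm (yy (r n)) \<le> B + (R + 2)" for n
    proof -
      have "tile_minus q (yy (r n)) \<in> patch (S (r n)) 0 (R + 2)"
        using q unfolding SQ pattern_minus_def by blast
      then obtain z where "z + yy (r n) \<in> fst q" "norm z < R + 2" 
        by (auto simp: mem_patch mem_fst_tile_minus)
      then show ?thesis using B[of "z + yy (r n)"] norm_triangle_ineq4[of "z + yy (r n)" z] by auto
    qed
    then show ?thesis unfolding bounded_iff by auto
  qed
  then obtain y k where k: "strict_mono k" "(yy \<circ> r \<circ> k) \<longlonglongrightarrow> y"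
    using bounded_imp_convergent_subsequence by blast
  define m where "m = (\<lambda>n. r (k n))"
  have ylim: "(\<lambda>n. yy (m n)) \<longlonglongrightarrow> y" using k(2) by (simp add: m_def comp_def)
  have m: "strict_mono m" using r(1) k(1) by (simp add: m_def strict_mono_def)
  have SQ: "patch (S (m n)) 0 (R + 2) = pattern_minus Q (yy (m n))" for n using SQ by (simp add: m_def)
  have small: "\<exists>n. norm (yy (m n) - y) < c \<and> d (m n) < c" if "0 < c" for c
  proof -
    have "(\<lambda>n. d (m n)) \<longlonglongrightarrow> 0" using LIMSEQ_subseq_LIMSEQ[OF dlim m] by (simp add: comp_def)
    then have "\<forall>\<^sub>F n in sequentially. d (m n) < c" using that by (rule order_tendstoD)
    moreover have "\<forall>\<^sub>F n in sequentially. norm (yy (m n) - y) < c"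
      using tendstoD[OF ylim that] by (simp add: dist_norm)
    ultimately have "\<forall>\<^sub>F n in sequentially. norm (yy (m n) - y) < c \<and> d (m n) < c"
      by (rule eventually_conj[rotated])
    then show ?thesis using eventually_happens by force
  qed
  have QT: "tile_minus q y \<in> T" if q: "q \<in> Q" for q
  proof -
    have "tile_minus q y \<in> patch T 0 (R + 4)"
    proof (rule finite_tile_dist_limit[where L = L])
      show "finite (patch T 0 (R + 4))" using locally_finite[OF T] by (simp add: locally_finite_def)
      show "closed_tile L (tile_minus q y)" using cQ q by simp
      show "closed_tile L u" if "u \<in> patch T 0 (R + 4)" for u using that cT patch_subset by blast
      fix c :: real assume "0 < c"
      then obtain n where n: "norm (yy (m n) - y) < c / 2" "d (m n) < c / 2" using small[of "c/2"] by auto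
      have *: "tile_minus q (yy (m n)) \<in> patch (S (m n)) 0 (R + 2)"
        using q unfolding SQ pattern_minus_def by blast
      then have "tile_minus q (yy (m n)) \<in> patch (S (m n)) 0 (R + 3)"
        using patch_mono[of "R + 2" "R + 3" "S (m n)" 0] by auto
      then obtain u where u: "u \<in> T" "tile_dist L (tile_minus q (yy (m n))) u < d (m n)"
        using bwd by blast
      have cl: "closed_tile L (tile_minus q (yy (m n)))" "closed_tile L (tile_minus q y)" using cQ q by auto
      obtain z where "z \<in> fst (tile_minus q (yy (m n)))" "dist 0 z < R + 2" using * by (auto simp: mem_patch)
      then obtain z' where z': "z' \<in> fst u" "dist 0 z' < R + 2 + d (m n)"
        using tile_dist_meets[OF cl(1) cT[OF u(1)] u(2)] by blast
      then have "dist 0 z' < R + 4" using dpos(2)[of "m n"] by linarith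
      then have "u \<in> patch T 0 (R + 4)" using u(1) z'(1) unfolding mem_patch by blast
      moreover have "tile_dist L (tile_minus q y) u < c"
        using tile_dist_triangle[OF cl(2,1) cT[OF u(1)]] tile_dist_minus_le[OF cQ[OF q], of y "yy (m n)"]
          n u(2) by (simp add: norm_minus_commute)
      ultimately show "\<exists>u\<in>patch T 0 (R + 4). tile_dist L (tile_minus q y) u < c" by blast
    qed
    then show ?thesis using patch_subset by blast
  qed
  have TQ: "t \<in> pattern_minus Q y" if t: "t \<in> patch T 0 (R + 1)" for t
  proof (rule finite_tile_dist_limit[where L = L])
    show "finite (pattern_minus Q y)" using Q by (simp add: pattern_minus_def)
    show ct: "closed_tile L t" using cT t patch_subset by blast
    show "closed_tile L u" if "u \<in> pattern_minus Q y" for u using that cQ by (auto simp: pattern_minus_def)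
    fix c :: real assume "0 < c"
    then obtain n where n: "norm (yy (m n) - y) < c / 2" "d (m n) < c / 2" using small[of "c/2"] by auto
    have "t \<in> patch T 0 (R + 3)" using t patch_mono[of "R + 1" "R + 3" T 0] by auto
    then obtain u where u: "u \<in> S (m n)" "tile_dist L t u < d (m n)" using fwd patch_subset by blast
    obtain z where "z \<in> fst t" "dist 0 z < R + 1" using t by (auto simp: mem_patch)
    then obtain z' where z': "z' \<in> fst u" "dist 0 z' < R + 1 + d (m n)"
      using tile_dist_meets[OF ct cS[OF u(1)] u(2)] by blast
    then have "dist 0 z' < R + 2" using dpos(2)[of "m n"] by linarith
    then have "u \<in> patch (S (m n)) 0 (R + 2)" using u(1) z'(1) unfolding mem_patch by blast
    then obtain q where q: "q \<in> Q" "u = tile_minus q (yy (m n))" unfolding SQ pattern_minus_def by blast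
    have cl: "closed_tile L (tile_minus q (yy (m n)))" "closed_tile L (tile_minus q y)" using cQ q by auto
    have "tile_dist L t (tile_minus q y) < c"
      using tile_dist_triangle[OF ct cl] tile_dist_minus_le[OF cQ[OF q(1)], of "yy (m n)" y] n u(2) q(2)
      by simp
    then show "\<exists>u\<in>pattern_minus Q y. tile_dist L t u < c" using q(1) by (auto simp: pattern_minus_def)
  qed
  obtain n where n: "norm (yy (m n) - y) < e" using small e(1) by blast
  let ?y = "yy (m n) - y"
  have "patch (S (m n)) 0 R = patch (pattern_minus T ?y) 0 R"
  proof (intro equalityI subsetI)
    fix t assume t: "t \<in> patch (S (m n)) 0 R"
    then have "t \<in> patch (S (m n)) 0 (R + 2)" using patch_mono[of R "R + 2" "S (m n)" 0] by auto
    then obtain q where "q \<in> Q" "t = tile_minus q (yy (m n))" unfolding SQ pattern_minus_def by blast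
    then have "t \<in> pattern_minus T ?y" using QT by (simp add: mem_pattern_minus tile_minus_minus)
    then show "t \<in> patch (pattern_minus T ?y) 0 R" using t by (auto simp: mem_patch)
  next
    fix t assume t: "t \<in> patch (pattern_minus T ?y) 0 R"
    then obtain z where z: "z \<in> fst t" "norm z < R" by (auto simp: mem_patch)
    have "tile_minus t (- ?y) \<in> T" using t patch_subset mem_pattern_minus by blast
    moreover have "z + ?y \<in> fst (tile_minus t (- ?y))" "dist 0 (z + ?y) < R + 1"
      using z n e(2) norm_triangle_ineq[of z ?y] by (auto simp: mem_fst_tile_minus)
    ultimately have "tile_minus t (- ?y) \<in> pattern_minus Q y" by (intro TQ) (auto simp: mem_patch)
    then have "t \<in> pattern_minus Q (yy (m n))" by (simp add: mem_pattern_minus tile_minus_minus)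
    then have "t \<in> S (m n)" unfolding SQ[symmetric] using patch_subset by blast
    then show "t \<in> patch (S (m n)) 0 R" using z by (auto simp: mem_patch)
  qed
  then have "near R e T (S (m n))" using n by (intro nearI)
  then show False using S(3) by blast
qed

lemma near_open:
  assumes "T \<in> X" "0 < e"
  shows "\<exists>U. openin (pattern_topology L X) U \<and> T \<in> U \<and> (\<forall>T'\<in>U. near R e T T')"
proof -
  obtain d where d: "0 < d" "\<forall>T'\<in>X. pattern_close L d T T' \<longrightarrow> near (max R 1) (min e 1) T T'"
    using pattern_close_imp_near[OF assms(1), of "max R 1" "min e 1"] assms(2) by (auto simp: less_max_iff_disj)
  interpret Metric_space X "pattern_dist L" by (rule metric_space)
  have "near R e T T'" if "T' \<in> mball T (min d 1)" for T'
  proof -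
    have "T' \<in> X" "pattern_close L (min d 1) T T'" using that by (auto intro!: pattern_dist_less)
    then have "near (max R 1) (min e 1) T T'"
      using d pattern_close_mono[of L "min d 1" T T' d] by auto
    then show ?thesis by (rule near_mono) auto
  qed
  then show ?thesis
    using d(1) assms(1) unfolding topology_eq by (intro exI[of _ "mball T (min d 1)"]) auto
qed

end

lemma near_pattern_minus:
  assumes "near R' e T T'" "norm (v' - v) < e'" "R + norm v' \<le> R'"
  shows "near R (e + e') (pattern_minus T v) (pattern_minus T' v')"
proof -
  obtain y where y: "norm y < e" "patch T' 0 R' = patch (pattern_minus T y) 0 R'"
    using assms(1) unfolding near_def by blast
  have "patch (pattern_minus T' v') 0 R = patch (pattern_minus (pattern_minus T y) v') 0 R"
    using assms(3) by (intro patch_eq_shift[OF y(2)]) simp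
  moreover have "norm (y + (v' - v)) < e + e'"
    using y(1) assms(2) norm_triangle_ineq[of y "v' - v"] by linarith
  ultimately show ?thesis
    by (intro nearI[of "y + (v' - v)"]) (simp_all add: pattern_minus_minus algebra_simps)
qed

lemma continuous_map_into_patterns:
  assumes "\<And>z. z \<in> topspace Z \<Longrightarrow> F z \<in> Y" "\<And>T. T \<in> Y \<Longrightarrow> locally_finite L T"
    and near: "\<And>z R e. z \<in> topspace Z \<Longrightarrow> 0 < e \<Longrightarrow>
       \<exists>U. openin Z U \<and> z \<in> U \<and> (\<forall>z'\<in>U. near R e (F z) (F z'))"
  shows "continuous_map Z (pattern_topology L Y) F"
  unfolding continuous_map_def
proof (intro conjI allI impI)
  show "F \<in> topspace Z \<rightarrow> topspace (pattern_topology L Y)" using assms(1) by auto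
  fix V assume V: "openin (pattern_topology L Y) V"
  show "openin Z {z \<in> topspace Z. F z \<in> V}"
  proof (subst openin_subopen, intro ballI)
    fix z assume z: "z \<in> {z \<in> topspace Z. F z \<in> V}"
    then obtain e where e: "0 < e" "\<forall>T'\<in>Y. near (1 / e) e (F z) T' \<longrightarrow> T' \<in> V"
      using open_near[OF V] assms(1,2) by blast
    then obtain U where "openin Z U" "z \<in> U" "\<forall>z'\<in>U. near (1 / e) e (F z) (F z')"
      using near[of z e "1 / e"] z by blast
    then show "\<exists>U. openin Z U \<and> z \<in> U \<and> U \<subseteq> {z \<in> topspace Z. F z \<in> V}"
      using e(2) assms(1) openin_subset by (intro exI[of _ U]) blast
  qed
qed

context flc_space
begin

lemma continuous_map_pattern_minus:
  assumes F: "continuous_map Z (pattern_topology L X) F" and v: "continuous_map Z euclidean v"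
  shows "continuous_map Z (pattern_topology L X) (\<lambda>z. pattern_minus (F z) (v z))"
proof (rule continuous_map_into_patterns)
  have FX: "F z \<in> X" if "z \<in> topspace Z" for z using F that by (auto simp: continuous_map_def)
  then show "pattern_minus (F z) (v z) \<in> X" if "z \<in> topspace Z" for z using that by simp
  show "locally_finite L T" if "T \<in> X" for T using locally_finite that .
  fix z R and e :: real assume z: "z \<in> topspace Z" and e: "0 < e"
  obtain U where U: "openin (pattern_topology L X) U" "F z \<in> U"
    "\<forall>T'\<in>U. near (R + norm (v z) + e / 2) (e / 2) (F z) T'"
    using near_open[OF FX[OF z], of "e / 2"] e by (auto simp: half_gt_zero_iff)
  let ?W = "{w \<in> topspace Z. F w \<in> U} \<inter> {w \<in> topspace Z. v w \<in> ball (v z) (e / 2)}"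
  have "openin Z ?W"
    using F v U(1) unfolding continuous_map_def open_openin[symmetric] by (intro openin_Int) blast+
  moreover have "near R e (pattern_minus (F z) (v z)) (pattern_minus (F w) (v w))" if w: "w \<in> ?W" for w
  proof -
    have d: "norm (v w - v z) < e / 2" using w by (simp add: dist_norm norm_minus_commute)
    then have "norm (v w) \<le> norm (v z) + e / 2" using norm_triangle_sub[of "v w" "v z"] by linarith
    then show ?thesis
      using near_pattern_minus[of "R + norm (v z) + e / 2" "e / 2" "F z" "F w" "v w" "v z" "e / 2" R] w U d
      by simp
  qed
  ultimately show "\<exists>W. openin Z W \<and> z \<in> W \<and>
      (\<forall>w\<in>W. near R e (pattern_minus (F z) (v z)) (pattern_minus (F w) (v w)))"
    using U(2) z e by (intro exI[of _ ?W]) auto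
qed

lemma continuous_map_euclideanI:
  fixes F :: "('a, 'l) pattern \<Rightarrow> 'b::metric_space"
  assumes "\<And>T e. T \<in> X \<Longrightarrow> 0 < e \<Longrightarrow> \<exists>R. \<exists>d>0. \<forall>T'\<in>X. near R d T T' \<longrightarrow> dist (F T) (F T') < e"
  shows "continuous_map (pattern_topology L X) euclidean F"
  unfolding continuous_map_def
proof (intro conjI allI impI)
  fix V :: "'b set" assume V: "openin euclidean V"
  show "openin (pattern_topology L X) {T \<in> topspace (pattern_topology L X). F T \<in> V}"
  proof (subst openin_subopen, intro ballI)
    fix T assume T: "T \<in> {T \<in> topspace (pattern_topology L X). F T \<in> V}"
    then obtain e where e: "0 < e" "ball (F T) e \<subseteq> V" using V by (auto simp: open_contains_ball)
    obtain R d where Rd: "0 < d" "\<forall>T'\<in>X. near R d T T' \<longrightarrow> dist (F T) (F T') < e"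
      using assms[of T e] T e(1) by auto
    obtain U where U: "openin (pattern_topology L X) U" "T \<in> U" "\<forall>T'\<in>U. near R d T T'"
      using near_open[of T d R] T Rd(1) by auto
    then have "U \<subseteq> X" using openin_subset by fastforce
    then show "\<exists>U. openin (pattern_topology L X) U \<and> T \<in> U \<and> U \<subseteq> {T \<in> topspace (pattern_topology L X). F T \<in> V}"
      using U Rd(2) e(2) by (intro exI[of _ U]) force
  qed
qed auto

text \<open>Uniform continuity, expressed by agreement of patches.\<close>

lemma continuous_map_uniformly_near:
  assumes Y: "flc_space L' Y" and h: "continuous_map (pattern_topology L X) (pattern_topology L' Y) h"
    and e: "0 < e"
  shows "\<exists>d>0. \<forall>T\<in>X. \<forall>T'\<in>X. near (1 / d) d T T' \<longrightarrow> near R e (h T) (h T')"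
proof -
  interpret Y: flc_space L' Y by fact
  let ?Q = "\<lambda>d T. \<forall>T'\<in>X. near (1 / d) d T T' \<longrightarrow> near R e (h T) (h T')"
  have "\<exists>d>0. \<forall>T\<in>topspace (pattern_topology L X). ?Q d T"
  proof (rule compact_space_uniform[OF compact])
    show "?Q d' T" if "0 < d'" "d' \<le> d" "?Q d T" for d d' and T :: "('a, 'l) pattern"
    proof -
      have "1 / d \<le> 1 / d'" using that by (simp add: frac_le)
      then show ?thesis using that near_mono by blast
    qed
    fix T assume "T \<in> topspace (pattern_topology L X)"
    then have T: "T \<in> X" by simp
    then have "h T \<in> Y" using h by (auto simp: continuous_map_def)
    then obtain V where V: "openin (pattern_topology L' Y) V" "h T \<in> V" "\<forall>S\<in>V. near (R + e) (e / 2) (h T) S"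
      using Y.near_open[of "h T" "e / 2" "R + e"] e by auto
    have "openin (pattern_topology L X) {T \<in> X. h T \<in> V}"
      using h V(1) by (auto simp: continuous_map_def)
    then obtain d where d: "0 < d" "\<forall>T'\<in>X. near (1 / d) d T T' \<longrightarrow> h T' \<in> V"
      using open_near[of L X "{T \<in> X. h T \<in> V}" T] T V(2) locally_finite by auto
    obtain U where U: "openin (pattern_topology L X) U" "T \<in> U" "\<forall>T'\<in>U. near (1 / d + d / 2) (d / 2) T T'"
      using near_open[OF T, of "d / 2" "1 / d + d / 2"] d(1) by auto
    have "?Q (d / 2) S" if S: "S \<in> U" for S
    proof (intro ballI impI)
      fix T' assume T': "T' \<in> X" "near (1 / (d / 2)) (d / 2) S T'"
      have "S \<in> X" using S U(1) openin_subset by fastforce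
      have TS: "near (1 / d + d / 2) (d / 2) T S" using U(3) S by blast
      have "near (1 / d) (d / 2) S T'" using T'(2) d(1) by (rule_tac near_mono) (auto simp: field_simps)
      then have "near (1 / d) d T T'" using near_trans[OF TS] by fastforce
      then have "h T' \<in> V" using d(2) T' by blast
      have "near (1 / d) d T S" using TS d(1) by (rule_tac near_mono) auto
      then have "h S \<in> V" using d(2) \<open>S \<in> X\<close> by blast
      have "near (R + e / 2 + e / 2) (e / 2) (h T) (h S)" using V(3) \<open>h S \<in> V\<close> by (simp add: add.assoc)
      then have "near (R + e / 2) (e / 2) (h S) (h T)" by (rule near_commute)
      moreover have "near R (e / 2) (h T) (h T')" using V(3) \<open>h T' \<in> V\<close> near_mono e by fastforce
      ultimately show "near R e (h S) (h T')" using near_trans by fastforce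
    qed
    then show "\<exists>d>0. \<exists>U. openin (pattern_topology L X) U \<and> T \<in> U \<and> (\<forall>S\<in>U. ?Q d S)"
      using U(1,2) d(1) by (intro exI[of _ "d / 2"] conjI exI[of _ U]) auto
  qed
  then show ?thesis by simp
qed

text \<open>Vertices are separated, and every pattern has some near the origin, so a small
  translation is determined by the patch that it produces.\<close>

lemma small_translation_unique:
  "\<exists>\<kappa>>0. \<exists>\<rho>>0. \<forall>T\<in>X. \<forall>x y. norm (x - y) < \<kappa> \<longrightarrow>
     patch (pattern_minus T x) 0 \<rho> = patch (pattern_minus T y) 0 \<rho> \<longrightarrow> x = y"
proof -
  obtain \<kappa> where \<kappa>: "0 < \<kappa>" "\<forall>T\<in>X. \<forall>v\<in>vertex_set T. \<forall>w\<in>vertex_set T. v \<noteq> w \<longrightarrow> \<kappa> \<le> dist v w"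
    using vertex_separation by blast
  obtain \<rho> where \<rho>: "0 < \<rho>" "\<forall>T\<in>X. \<forall>x. \<exists>v\<in>vertex_set T. dist x v < \<rho>"
    using vertices_relatively_dense by blast
  have "x = y" if T: "T \<in> X" and xy: "norm (x - y) < \<kappa>"
    "patch (pattern_minus T x) 0 \<rho> = patch (pattern_minus T y) 0 \<rho>" for T x y
  proof -
    obtain v where v: "v \<in> vertex_set (pattern_minus T x)" "norm v < \<rho>"
      using \<rho>(2) translate_in[OF T, of x] by (metis dist_0_norm)
    then have "v \<in> vertex_set (pattern_minus T y)" using vertex_set_patch_eq[OF xy(2)] by blast
    then have "v + x \<in> vertex_set T" "v + y \<in> vertex_set T" using v(1) by (auto simp: vertex_set_minus)
    then have "v + x = v + y" using \<kappa>(2) T xy(1) by (metis add_diff_cancel_left dist_norm leD)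
    then show ?thesis by simp
  qed
  then show ?thesis using \<kappa>(1) \<rho>(1) by blast
qed

end


section \<open>Lifting maps of tiling spaces to cocycles\<close>

text \<open>Induction along the segment from \<open>0\<close> to \<open>x\<close> in steps shorter than \<open>r\<close>. The norms do not
  decrease along the way, so that hypotheses valid on a ball around \<open>0\<close> persist.\<close>

lemma norm_chain_induct:
  fixes x :: "'a::real_normed_vector"
  assumes "0 < r" "P 0" "\<And>x u. P x \<Longrightarrow> norm u < r \<Longrightarrow> norm x \<le> norm (x + u) \<Longrightarrow> P (x + u)"
  shows "P x"
proof -
  obtain N :: nat where N: "norm x / r < real N" using reals_Archimedean2 by blast
  then have "0 < N" using divide_nonneg_pos[OF norm_ge_zero[of x] assms(1)] by (cases N) auto
  have "P ((real k / real N) *\<^sub>R x)" if "k \<le> N" for k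
    using that
  proof (induction k)
    case (Suc k)
    have eq: "(real (Suc k) / real N) *\<^sub>R x = (real k / real N) *\<^sub>R x + (1 / real N) *\<^sub>R x"
      by (simp add: add_divide_distrib algebra_simps)
    have "norm ((1 / real N) *\<^sub>R x) < r"
      using N \<open>0 < N\<close> assms(1) by (simp add: field_simps)
    moreover have "norm ((real k / real N) *\<^sub>R x) \<le> norm ((real (Suc k) / real N) *\<^sub>R x)"
      unfolding norm_scaleR by (intro mult_right_mono) (auto simp: divide_right_mono)
    ultimately show ?case using Suc assms(3) unfolding eq by simp
  qed (simp add: assms(2))
  from this[of N] show ?thesis using \<open>0 < N\<close> by simp
qed

text \<open>Subdividing the segment from \<open>0\<close> to \<open>x\<close> into \<open>N\<close> steps gives a candidate for the value at
  \<open>x\<close>. The increment from \<open>x\<close> to \<open>x + u\<close> is computed by cutting the thin triangle with vertices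
  \<open>0\<close>, \<open>x\<close>, \<open>x + u\<close> into small quadrilaterals, across each of which the local rule is additive;
  this is where simple connectedness enters.\<close>

lemma integrate_local_cocycle:
  fixes d :: "'a::real_normed_vector \<Rightarrow> 'a \<Rightarrow> 'b::ab_group_add"
  assumes r: "0 < r"
    and add: "\<And>x u v. norm u < r \<Longrightarrow> norm v < r \<Longrightarrow> norm (u + v) < r \<Longrightarrow> d x (u + v) = d x u + d (x + u) v"
  shows "\<exists>F. F 0 = 0 \<and> (\<forall>x u. norm u < r / 2 \<longrightarrow> F (x + u) = F x + d x u)"
proof -
  have d0: "d x 0 = 0" for x using add[of 0 0 x] r by simp
  define S where "S = (\<lambda>N x. \<Sum>k<N. d ((real k / real N) *\<^sub>R x) ((1 / real N) *\<^sub>R x))"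
  have step: "S N (x + u) = S N x + d x u"
    if N: "0 < N" "norm x < real N * (r / 2)" "norm (x + u) < real N * (r / 2)" and u: "norm u < r / 2" for N x u
  proof -
    define e where "e = (\<lambda>k. d ((real k / real N) *\<^sub>R x) ((real k / real N) *\<^sub>R u))"
    have "norm ((1 / real N) *\<^sub>R z) < r / 2" if "norm z < real N * (r / 2)" for z :: 'a
      using that N(1) by (simp add: field_simps)
    note small = this[OF N(2)] this[OF N(3)]
    have "d ((real k / real N) *\<^sub>R (x + u)) ((1 / real N) *\<^sub>R (x + u)) - d ((real k / real N) *\<^sub>R x) ((1 / real N) *\<^sub>R x)
        = e (Suc k) - e k" if k: "k < N" for k
    proof -
      let ?a = "(real k / real N) *\<^sub>R u" and ?b = "(1 / real N) *\<^sub>R (x + u)"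
      let ?c = "(1 / real N) *\<^sub>R x" and ?d = "(real (Suc k) / real N) *\<^sub>R u"
      have le: "norm (t *\<^sub>R u) < r / 2" if "0 \<le> t" "t \<le> 1" for t
        using that u mult_left_le_one_le[of "norm u" t] by simp
      have ab: "norm ?a < r / 2" "norm ?d < r / 2" using k by (intro le; simp)+
      have eq: "?a + ?b = ?c + ?d" by (simp add: add_divide_distrib algebra_simps)
      have n1: "norm (?a + ?b) < r" using norm_triangle_ineq[of ?a ?b] ab small(2) by linarith
      have "d ((real k / real N) *\<^sub>R x) (?a + ?b) = e k + d ((real k / real N) *\<^sub>R x + ?a) ?b"
        unfolding e_def using ab small n1 r by (intro add) linarith+
      moreover have "d ((real k / real N) *\<^sub>R x) (?c + ?d) = d ((real k / real N) *\<^sub>R x) ?c + d ((real k / real N) *\<^sub>R x + ?c) ?d"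
        using ab small n1 r unfolding eq by (intro add) linarith+
      moreover have "(real k / real N) *\<^sub>R x + ?c = (real (Suc k) / real N) *\<^sub>R x"
        "(real k / real N) *\<^sub>R x + ?a = (real k / real N) *\<^sub>R (x + u)"
        by (simp_all add: add_divide_distrib algebra_simps)
      ultimately have "d ((real k / real N) *\<^sub>R x) ?c + e (Suc k) = e k + d ((real k / real N) *\<^sub>R (x + u)) ?b"
        unfolding eq e_def by simp
      then show ?thesis by (simp add: algebra_simps)
    qed
    then have "S N (x + u) - S N x = (\<Sum>k<N. e (Suc k) - e k)"
      by (simp add: S_def sum_subtractf[symmetric])
    also have "\<dots> = e N - e 0" by (rule sum_lessThan_telescope)
    also have "\<dots> = d x u" using N(1) d0 by (simp add: e_def)
    finally show ?thesis by (simp add: algebra_simps)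
  qed
  have S0: "S N 0 = 0" for N by (simp add: S_def d0)
  have indep: "S N x = S M x" if "0 < N" "0 < M" "norm x < real N * (r / 2)" "norm x < real M * (r / 2)" for N M x
  proof -
    have "norm x < real N * (r / 2) \<and> norm x < real M * (r / 2) \<longrightarrow> S N x = S M x"
    proof (rule norm_chain_induct[of "r / 2"])
      fix x u
      assume IH: "norm x < real N * (r / 2) \<and> norm x < real M * (r / 2) \<longrightarrow> S N x = S M x"
        and u: "norm u < r / 2" and le: "norm x \<le> norm (x + u)"
      show "norm (x + u) < real N * (r / 2) \<and> norm (x + u) < real M * (r / 2) \<longrightarrow> S N (x + u) = S M (x + u)"
      proof
        assume n: "norm (x + u) < real N * (r / 2) \<and> norm (x + u) < real M * (r / 2)"
        then have "norm x < real N * (r / 2)" "norm x < real M * (r / 2)" using le by linarith+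
        then show "S N (x + u) = S M (x + u)"
          using step[OF \<open>0 < N\<close> _ _ u, of x] step[OF \<open>0 < M\<close> _ _ u, of x] IH n by simp
      qed
    qed (use r S0 in auto)
    then show ?thesis using that by blast
  qed
  have ex: "\<exists>N>0. norm x < real N * (r / 2)" for x :: 'a
  proof -
    obtain N :: nat where "norm x / (r / 2) < real N" using reals_Archimedean2 by blast
    then have "norm x < real (Suc N) * (r / 2)" using r by (simp add: field_simps)
    then show ?thesis by blast
  qed
  define n where "n = (\<lambda>x::'a. SOME N. 0 < N \<and> norm x < real N * (r / 2))"
  have n: "0 < n x" "norm x < real (n x) * (r / 2)" for x
    using someI_ex[OF ex[of x]] unfolding n_def by blast+
  have "S (n (x + u)) (x + u) = S (n x) x + d x u" if "norm u < r / 2" for x u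
  proof -
    define N where "N = max (n x) (n (x + u))"
    have "real (n x) * (r / 2) \<le> real N * (r / 2)" "real (n (x + u)) * (r / 2) \<le> real N * (r / 2)"
      using r by (intro mult_right_mono; simp add: N_def)+
    then have N: "0 < N" "norm x < real N * (r / 2)" "norm (x + u) < real N * (r / 2)"
      using n[of x] n[of "x + u"] by (auto simp: N_def less_max_iff_disj)
    show ?thesis using step[OF N that] indep[OF n(1) N(1) n(2) N(2)] indep[OF n(1) N(1) n(2) N(3)] by simp
  qed
  then show ?thesis using S0 by (intro exI[of _ "\<lambda>x. S (n x) x"]) auto
qed

locale flc_map = X: flc_space L X + Y: flc_space L' Y
  for L :: "'l metric" and X :: "('a::euclidean_space, 'l) pattern set"
    and L' :: "'m metric" and Y :: "('a, 'm) pattern set" +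
  fixes h :: "('a, 'l) pattern \<Rightarrow> ('a, 'm) pattern"
  assumes continuous: "continuous_map (pattern_topology L X) (pattern_topology L' Y) h"
begin

lemma image_in [simp]: "T \<in> X \<Longrightarrow> h T \<in> Y"
  using continuous by (auto simp: continuous_map_def)

lemma near_image:
  assumes "0 < e"
  shows "\<exists>d>0. \<forall>T\<in>X. \<forall>T'\<in>X. near (1 / d) d T T' \<longrightarrow> near R e (h T) (h T')"
  using X.continuous_map_uniformly_near[OF Y.flc_space_axioms continuous assms] .

lemma patch_image:
  assumes "0 < e"
  shows "\<exists>R'. \<forall>T\<in>X. \<forall>T'\<in>X. patch T 0 R' = patch T' 0 R' \<longrightarrow> near R e (h T) (h T')"
  using near_image[OF assms, of R] near_patch_eq by metis

lemma translate_image: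
  assumes "0 < e"
  shows "\<exists>d>0. \<forall>T\<in>X. \<forall>x. norm x < d \<longrightarrow> near R e (h T) (h (pattern_minus T x))"
  using near_image[OF assms, of R] near_translate X.translate_in by metis

text \<open>The path $t\mapsto h(T-tx)$ agrees on every bounded region with a moving translate of \<open>h T\<close>,
  and the small translation vectors are the same for all regions because they are unique. Hence
  small translations are carried to small translations.\<close>

lemma small_step:
  assumes "0 < e"
  shows "\<exists>d>0. \<forall>T\<in>X. \<forall>x. norm x < d \<longrightarrow> (\<exists>y. norm y < e \<and> h (pattern_minus T x) = pattern_minus (h T) y)"
proof -
  obtain \<kappa> \<rho> where \<kappa>: "0 < \<kappa>" "0 < \<rho>" and unique: "\<And>S x y. S \<in> Y \<Longrightarrow> norm (x - y) < \<kappa> \<Longrightarrow>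
      patch (pattern_minus S x) 0 \<rho> = patch (pattern_minus S y) 0 \<rho> \<Longrightarrow> x = y"
    using Y.small_translation_unique by metis
  define e' where "e' = min e (\<kappa> / 3)"
  have e': "0 < e'" "e' \<le> e" "3 * e' \<le> \<kappa>" using assms \<kappa>(1) by (auto simp: e'_def)
  obtain d where d: "0 < d" "\<And>T x. T \<in> X \<Longrightarrow> norm x < d \<Longrightarrow> near (\<rho> + \<kappa>) e' (h T) (h (pattern_minus T x))"
    using translate_image[OF e'(1), of "\<rho> + \<kappa>"] by metis
  have "\<exists>y. norm y < e \<and> h (pattern_minus T x) = pattern_minus (h T) y" if T: "T \<in> X" and x: "norm x < d" for T x
  proof -
    let ?T = "\<lambda>t. pattern_minus T (t *\<^sub>R x)"
    have "\<exists>y. norm y < e' \<and> patch (h (?T t)) 0 (\<rho> + \<kappa>) = patch (pattern_minus (h T) y) 0 (\<rho> + \<kappa>)"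
      if "0 \<le> t" "t \<le> 1" for t
    proof -
      have "norm (t *\<^sub>R x) < d" using that x mult_left_le_one_le[of "norm x" t] by simp
      then show ?thesis using d(2)[OF T] unfolding near_def by blast
    qed
    then obtain y where y: "\<And>t. 0 \<le> t \<Longrightarrow> t \<le> 1 \<Longrightarrow> norm (y t) < e'"
      "\<And>t. 0 \<le> t \<Longrightarrow> t \<le> 1 \<Longrightarrow> patch (h (?T t)) 0 (\<rho> + \<kappa>) = patch (pattern_minus (h T) (y t)) 0 (\<rho> + \<kappa>)"
      by metis
    have y\<rho>: "patch (h (?T t)) 0 \<rho> = patch (pattern_minus (h T) (y t)) 0 \<rho>" if "0 \<le> t" "t \<le> 1" for t
      using patch_eq_mono[OF y(2)[OF that]] \<kappa> by simp
    have "0 = y 0" 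
      using unique[of "h T" 0 "y 0"] y\<rho>[of 0] y(1)[of 0] e' T by simp
    have all: "patch (pattern_minus (h (?T 1)) (- y 1)) 0 R = patch (h T) 0 R" for R
    proof -
      obtain d' where d': "0 < d'" "\<And>T x. T \<in> X \<Longrightarrow> norm x < d' \<Longrightarrow> near (max R \<rho> + \<kappa>) e' (h T) (h (pattern_minus T x))"
        using translate_image[OF e'(1), of "max R \<rho> + \<kappa>"] by metis
      obtain N :: nat where N: "norm x / d' < real N" using reals_Archimedean2 by blast
      then have "0 < N" using divide_nonneg_pos[OF norm_ge_zero[of x] d'(1)] by (cases N) auto
      have small: "norm ((1 / real N) *\<^sub>R x) < d'" using N \<open>0 < N\<close> d'(1) by (simp add: field_simps)
      have "patch (pattern_minus (h (?T (real k / real N))) (- y (real k / real N))) 0 R = patch (h T) 0 R"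
        if "k \<le> N" for k
        using that
      proof (induction k)
        case (Suc k)
        define s t where "s = real k / real N" and "t = real (Suc k) / real N"
        have "t *\<^sub>R x = s *\<^sub>R x + (1 / real N) *\<^sub>R x"
          by (simp add: s_def t_def add_divide_distrib algebra_simps)
        then have st: "0 \<le> s" "s \<le> 1" "0 \<le> t" "t \<le> 1" "?T t = pattern_minus (?T s) ((1 / real N) *\<^sub>R x)"
          using Suc.prems by (simp_all add: s_def t_def pattern_minus_minus del: of_nat_Suc)
        obtain u where u: "norm u < e'" "patch (h (?T t)) 0 (max R \<rho> + \<kappa>) = patch (pattern_minus (h (?T s)) u) 0 (max R \<rho> + \<kappa>)"
          using d'(2)[of "?T s", OF _ small] T unfolding st(5) near_def by auto
        have "patch (pattern_minus (h (?T s)) u) 0 \<rho> = patch (pattern_minus (pattern_minus (h T) (y s)) u) 0 \<rho>"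
          using u(1) e' by (intro patch_eq_shift[OF y(2)[OF st(1,2)]]) linarith
        moreover have "patch (h (?T t)) 0 \<rho> = patch (pattern_minus (h (?T s)) u) 0 \<rho>"
          using \<kappa> by (intro patch_eq_mono[OF u(2)]) linarith
        ultimately have "patch (pattern_minus (h T) (y t)) 0 \<rho> = patch (pattern_minus (h T) (y s + u)) 0 \<rho>"
          using y\<rho>[OF st(3,4)] by (simp add: pattern_minus_minus)
        moreover have "norm (y t - (y s + u)) < \<kappa>"
          using norm_triangle_ineq4[of "y t" "y s + u"] norm_triangle_ineq[of "y s" u] y(1)[OF st(1,2)] y(1)[OF st(3,4)] u(1) e'
          by linarith
        ultimately have yt: "y t = y s + u" using unique[of "h T" "y t" "y s + u"] T by simp
        have "patch (pattern_minus (h (?T t)) (- y t)) 0 R = patch (pattern_minus (pattern_minus (h (?T s)) u) (- y t)) 0 R"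
          using y(1)[OF st(3,4)] e' by (intro patch_eq_shift[OF u(2)]) simp
        moreover have "patch (pattern_minus (h (?T s)) (- y s)) 0 R = patch (h T) 0 R"
          using Suc unfolding s_def by simp
        ultimately have "patch (pattern_minus (h (?T t)) (- y t)) 0 R = patch (h T) 0 R"
          by (simp add: pattern_minus_minus yt)
        then show ?case unfolding t_def .
      qed (use \<open>0 = y 0\<close> in simp)
      from this[of N] show ?thesis using \<open>0 < N\<close> by simp
    qed
    have "pattern_minus (h (?T 1)) (- y 1) = h T" by (rule Y.pattern_eqI) (use T all in auto)
    then have "h (pattern_minus T x) = pattern_minus (h T) (y 1)"
      by (metis add.left_inverse pattern_minus_0 pattern_minus_minus scaleR_one)
    then show ?thesis using y(1)[of 1] e' by (intro exI[of _ "y 1"]) auto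
  qed
  then show ?thesis using d(1) by blast
qed

text \<open>A vector \<open>x\<close> splits into about $|x|/d$ steps of length less than \<open>d\<close>, each of which moves the image
  by less than \<open>1\<close>.\<close>

lemma orbit_image:
  "\<exists>C>0. \<forall>T\<in>X. \<forall>x. \<exists>y. h (pattern_minus T x) = pattern_minus (h T) y \<and> norm y \<le> C * (norm x + 1)"
proof -
  obtain d where d: "0 < d"
    "\<And>T x. T \<in> X \<Longrightarrow> norm x < d \<Longrightarrow> \<exists>y. norm y < 1 \<and> h (pattern_minus T x) = pattern_minus (h T) y"
    using small_step[of 1] by (metis zero_less_one)
  have N: "\<exists>y. h (pattern_minus T x) = pattern_minus (h T) y \<and> norm y \<le> real N"
    if "T \<in> X" "norm x < real N * d" for T x N
    using that
  proof (induction N arbitrary: T x)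
    case (Suc N)
    show ?case
    proof (cases "N = 0")
      case True then show ?thesis using d(2)[of T x] Suc.prems by fastforce
    next
      case False
      let ?u = "(1 / real (Suc N)) *\<^sub>R x" and ?v = "(real N / real (Suc N)) *\<^sub>R x"
      have "norm ?u < d" using Suc.prems(2) by (simp add: field_simps)
      then obtain y where y: "norm y < 1" "h (pattern_minus T ?u) = pattern_minus (h T) y"
        using d(2) Suc.prems(1) by blast
      have "real N * norm x < real N * (real (Suc N) * d)"
        using Suc.prems(2) False by (intro mult_strict_left_mono) auto
      then have "norm ?v < real N * d" by (simp add: field_simps)
      then obtain z where z: "h (pattern_minus (pattern_minus T ?u) ?v) = pattern_minus (h (pattern_minus T ?u)) z" "norm z \<le> real N"
        using Suc.IH[of "pattern_minus T ?u" ?v] Suc.prems(1) by auto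
      have "?u + ?v = ((1 + real N) / real (Suc N)) *\<^sub>R x" by (metis add_divide_distrib scaleR_left_distrib)
      then have "?u + ?v = x" by simp
      then have "h (pattern_minus T x) = pattern_minus (h T) (y + z)"
        using z(1) y(2) by (simp add: pattern_minus_minus)
      moreover have "norm (y + z) \<le> real (Suc N)" using y(1) z(2) norm_triangle_ineq[of y z] by simp
      ultimately show ?thesis by blast
    qed
  qed (use norm_ge_zero in \<open>auto simp: not_less\<close>)
  have "\<exists>y. h (pattern_minus T x) = pattern_minus (h T) y \<and> norm y \<le> (1 / d + 1) * (norm x + 1)" if T: "T \<in> X" for T x
  proof -
    define N where "N = nat \<lfloor>norm x / d\<rfloor> + 1"
    have "0 \<le> norm x / d" using d(1) by simp
    then have Nb: "norm x / d < real N" "real N \<le> norm x / d + 1" unfolding N_def by linarith+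
    then have "norm x < real N * d" using d(1) by (simp add: field_simps)
    moreover have "norm x / d + 1 \<le> (1 / d + 1) * (norm x + 1)" using d(1) by (simp add: field_simps add_nonneg_nonneg)
    ultimately show ?thesis using N[OF T, of x N] Nb(2) by (meson order_trans)
  qed
  moreover have "0 < 1 / d + 1" using d(1) by (simp add: add_pos_pos)
  ultimately show ?thesis by blast
qed

end

text \<open>The constants \<open>\<kappa>\<close> and \<open>\<rho>\<close> are those of \<open>small_translation_unique\<close> for the target space.\<close>

locale tiling_homeo = flc_map L X L' Y h + inv: flc_map L' Y L X k
  for L :: "'l metric" and X :: "('a::euclidean_space, 'l) pattern set"
    and L' :: "'m metric" and Y :: "('a, 'm) pattern set" and h k +
  fixes \<kappa> \<rho> :: real
  assumes kh [simp]: "T \<in> X \<Longrightarrow> k (h T) = T" and hk [simp]: "S \<in> Y \<Longrightarrow> h (k S) = S"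
    and aperiodic: "T \<in> X \<Longrightarrow> pattern_minus T x = T \<Longrightarrow> x = 0"
    and \<kappa>: "0 < \<kappa>" and \<rho>: "0 < \<rho>"
    and unique: "S \<in> Y \<Longrightarrow> norm (x - y) < \<kappa> \<Longrightarrow>
      patch (pattern_minus S x) 0 \<rho> = patch (pattern_minus S y) 0 \<rho> \<Longrightarrow> x = y"
begin

text \<open>The displacements of single short steps are unique, hence additive, so they integrate to a
  function on each orbit.\<close>

lemma exists_cocycle:
  "\<exists>f. (\<forall>T\<in>X. \<forall>x. h (pattern_minus T x) = pattern_minus (h T) (f T x)) \<and>
       (\<forall>T\<in>X. \<forall>x y. f T (x + y) = f T x + f (pattern_minus T x) y) \<and>
       (\<forall>e>0. \<exists>d>0. \<forall>T\<in>X. \<forall>x. norm x < d \<longrightarrow> norm (f T x) < e)"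
proof -
  define D where "D = (\<lambda>T x. SOME y. norm y < \<kappa> / 3 \<and> h (pattern_minus T x) = pattern_minus (h T) y)"
  obtain d where d: "0 < d"
    "\<And>T x. T \<in> X \<Longrightarrow> norm x < d \<Longrightarrow> \<exists>y. norm y < \<kappa> / 3 \<and> h (pattern_minus T x) = pattern_minus (h T) y"
    using small_step[of "\<kappa> / 3"] \<kappa> by (metis divide_pos_pos zero_less_numeral)
  have D: "norm (D T x) < \<kappa> / 3" "h (pattern_minus T x) = pattern_minus (h T) (D T x)" if "T \<in> X" "norm x < d" for T x
    using someI_ex[OF d(2)[OF that]] unfolding D_def by blast+
  have eq: "y = z" if "pattern_minus (h T) y = pattern_minus (h T) z" "norm (y - z) < \<kappa>" "T \<in> X" for T y z
    using unique[of "h T" y z] that by simp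
  have D_unique: "y = D T x" if "T \<in> X" "norm x < d" "norm y < \<kappa> / 3" "h (pattern_minus T x) = pattern_minus (h T) y" for T x y
    using eq[of T y "D T x"] D[OF that(1,2)] that norm_triangle_ineq4[of y "D T x"] \<kappa> by simp
  have "\<exists>F. F 0 = 0 \<and> (\<forall>x u. norm u < d / 2 \<longrightarrow> F (x + u) = F x + D (pattern_minus T x) u)" if T: "T \<in> X" for T
  proof (rule integrate_local_cocycle[OF d(1)])
    fix x u v :: 'a assume uv: "norm u < d" "norm v < d" "norm (u + v) < d"
    let ?T = "pattern_minus T x" and ?U = "pattern_minus T (x + u)"
    have "h (pattern_minus ?T (u + v)) = pattern_minus (h ?T) (D ?T u + D ?U v)"
      using D(2)[of ?T u] D(2)[of ?U v] T uv by (simp add: pattern_minus_minus add.assoc)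
    moreover have "norm (D ?T (u + v) - (D ?T u + D ?U v)) < \<kappa>"
      using D(1)[of ?T u] D(1)[of ?U v] D(1)[of ?T "u + v"] T uv
        norm_triangle_ineq4[of "D ?T (u + v)" "D ?T u + D ?U v"] norm_triangle_ineq[of "D ?T u" "D ?U v"] by simp
    ultimately show "D ?T (u + v) = D ?T u + D ?U v"
      using eq[of ?T "D ?T (u + v)" "D ?T u + D ?U v"] D(2)[of ?T "u + v"] T uv by simp
  qed
  then obtain f where f0: "\<And>T. T \<in> X \<Longrightarrow> f T 0 = 0"
    and fD: "\<And>T x u. T \<in> X \<Longrightarrow> norm u < d / 2 \<Longrightarrow> f T (x + u) = f T x + D (pattern_minus T x) u"
    by metis
  have d2: "norm u < d" if "norm u < d / 2" for u :: 'a using that d(1) by simp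
  have 1: "h (pattern_minus T x) = pattern_minus (h T) (f T x)" if T: "T \<in> X" for T x
  proof (rule norm_chain_induct[where r = "d / 2" and x = x])
    fix x u :: 'a assume IH: "h (pattern_minus T x) = pattern_minus (h T) (f T x)" and u: "norm u < d / 2"
    show "h (pattern_minus T (x + u)) = pattern_minus (h T) (f T (x + u))"
      using D(2)[of "pattern_minus T x" u] d2[OF u] T IH fD[OF T u] by (simp add: pattern_minus_minus)
  qed (use d(1) f0 T in auto)
  have 2: "f T (x + y) = f T x + f (pattern_minus T x) y" if T: "T \<in> X" for T x y
  proof (rule norm_chain_induct[where r = "d / 2" and x = y])
    fix y u :: 'a assume IH: "f T (x + y) = f T x + f (pattern_minus T x) y" and u: "norm u < d / 2"
    show "f T (x + (y + u)) = f T x + f (pattern_minus T x) (y + u)"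
      using fD[OF T u, of "x + y"] fD[of "pattern_minus T x" u y] T u IH
      by (simp add: pattern_minus_minus algebra_simps)
  qed (use d(1) f0 T in auto)
  have 3: "\<exists>d>0. \<forall>T\<in>X. \<forall>x. norm x < d \<longrightarrow> norm (f T x) < e" if e: "0 < e" for e
  proof -
    obtain c where c: "0 < c"
      "\<And>T x. T \<in> X \<Longrightarrow> norm x < c \<Longrightarrow> \<exists>y. norm y < min e (\<kappa> / 3) \<and> h (pattern_minus T x) = pattern_minus (h T) y"
      using small_step[of "min e (\<kappa> / 3)"] \<kappa> e by auto
    have "norm (f T x) < e" if "T \<in> X" "norm x < min c (d / 2)" for T x
    proof -
      have "norm x < c" "norm x < d" using that(2) d(1) by auto
      then obtain y where y: "norm y < min e (\<kappa> / 3)" "h (pattern_minus T x) = pattern_minus (h T) y"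
        using c(2) \<open>T \<in> X\<close> by blast
      then have "y = D T x" using \<open>T \<in> X\<close> \<open>norm x < d\<close> by (intro D_unique) auto
      moreover have "f T x = D T x" using fD[of T x 0] that f0[of T] by simp
      ultimately show ?thesis using y by simp
    qed
    then show ?thesis using c(1) d(1) by (intro exI[of _ "min c (d / 2)"]) auto
  qed
  show ?thesis using 1 2 3 by (intro exI[of _ f]) blast
qed

end

text \<open>When patterns agree to radius \<open>r\<close>, their images differ by a displacement of norm less than
  $\kappa/8$. The arguments below compare sums of at most four displacements of this size, which the
  uniqueness of translations smaller than \<open>\<kappa>\<close> can tell apart.\<close>

locale tiling_cocycle = tiling_homeo L X L' Y h k \<kappa> \<rho>
  for L :: "'l metric" and X :: "('a::euclidean_space, 'l) pattern set"
    and L' :: "'m metric" and Y :: "('a, 'm) pattern set" and h k \<kappa> \<rho> +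
  fixes f :: "('a, 'l) pattern \<Rightarrow> 'a \<Rightarrow> 'a" and r :: real
  assumes h_translate: "T \<in> X \<Longrightarrow> h (pattern_minus T x) = pattern_minus (h T) (f T x)"
    and f_add: "T \<in> X \<Longrightarrow> f T (x + y) = f T x + f (pattern_minus T x) y"
    and f_small: "0 < e \<Longrightarrow> \<exists>d>0. \<forall>T\<in>X. \<forall>x. norm x < d \<longrightarrow> norm (f T x) < e"
    and r_nonneg: "0 \<le> r"
    and r: "T \<in> X \<Longrightarrow> T' \<in> X \<Longrightarrow> patch T 0 r = patch T' 0 r \<Longrightarrow> near (\<rho> + \<kappa>) (\<kappa> / 8) (h T) (h T')"
begin

lemma f_0 [simp]: "T \<in> X \<Longrightarrow> f T 0 = 0"
  using f_add[of T 0 0] by simp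

lemma translate_inj: "T \<in> X \<Longrightarrow> pattern_minus T x = pattern_minus T y \<Longrightarrow> x = y"
  using aperiodic[of T "x - y"] pattern_minus_eqD[of T x T y] by simp

text \<open>The inverse homeomorphism takes $h(T)-f_T(x)$ back to a translate of \<open>T\<close> by a vector of norm
  at most $C(|f_T(x)|+1)$; as \<open>X\<close> is aperiodic, that vector is \<open>x\<close>.\<close>

lemma f_lower_bound: "\<exists>C>0. \<forall>T\<in>X. \<forall>x. norm x \<le> C * (norm (f T x) + 1)"
proof -
  obtain C where C: "0 < C" "\<And>S y. S \<in> Y \<Longrightarrow> \<exists>x. k (pattern_minus S y) = pattern_minus (k S) x \<and> norm x \<le> C * (norm y + 1)"
    using inv.orbit_image by metis
  have "norm x \<le> C * (norm (f T x) + 1)" if T: "T \<in> X" for T x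
  proof -
    obtain x' where x': "k (pattern_minus (h T) (f T x)) = pattern_minus (k (h T)) x'" "norm x' \<le> C * (norm (f T x) + 1)"
      using C(2)[of "h T"] T by auto
    then have "pattern_minus T x = pattern_minus T x'"
      using T by (simp add: h_translate[symmetric])
    then show ?thesis using translate_inj[OF T] x'(2) by blast
  qed
  then show ?thesis using C(1) by blast
qed

text \<open>Along the segment from \<open>0\<close> to \<open>y\<close>, each short step in the orbit of \<open>h T\<close> is the image under \<open>h\<close> of
  a short step in the orbit of \<open>T\<close>, by continuity of the inverse.\<close>

lemma f_surj:
  assumes T: "T \<in> X"
  shows "\<exists>x. f T x = y"
proof -
  obtain d where d: "0 < d" "\<And>T x. T \<in> X \<Longrightarrow> norm x < d \<Longrightarrow> norm (f T x) < \<kappa> / 2"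
    using f_small[of "\<kappa> / 2"] \<kappa> by auto
  obtain c where c: "0 < c" "\<And>S u. S \<in> Y \<Longrightarrow> norm u < c \<Longrightarrow> \<exists>v. norm v < d \<and> k (pattern_minus S u) = pattern_minus (k S) v"
    using inv.small_step[OF d(1)] by metis
  show ?thesis
  proof (rule norm_chain_induct[where r = "min c (\<kappa> / 2)" and x = y])
    fix y u :: 'a assume "\<exists>x. f T x = y" and u: "norm u < min c (\<kappa> / 2)"
    then obtain x where x: "f T x = y" by blast
    let ?T = "pattern_minus T x"
    obtain v where v: "norm v < d" "k (pattern_minus (h ?T) u) = pattern_minus ?T v"
      using c(2)[of "h ?T" u] u T by auto
    then have "pattern_minus (h ?T) u = h (pattern_minus ?T v)"
      using T hk[of "pattern_minus (h ?T) u"] by simp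
    then have "pattern_minus (h ?T) u = pattern_minus (h ?T) (f ?T v)"
      using h_translate[of ?T v] T by simp
    moreover have "norm (u - f ?T v) < \<kappa>"
      using norm_triangle_ineq4[of u "f ?T v"] u d(2)[of ?T v] v(1) T by simp
    ultimately have "u = f ?T v" using unique[of "h ?T" u "f ?T v"] T by simp
    then show "\<exists>x. f T x = y + u" using f_add[OF T, of x v] x by metis
  qed (use c(1) \<kappa> T in \<open>auto intro: exI[of _ 0]\<close>)
qed

end


section \<open>Transversal displacement and adapted functions\<close>

context tiling_cocycle
begin

text \<open>When \<open>T\<close> and \<open>T'\<close> agree near the origin, \<open>h T'\<close> and \<open>h T\<close> agree there up to this small
  translation.\<close>

definition shift :: "('a, 'l) pattern \<Rightarrow> ('a, 'l) pattern \<Rightarrow> 'a" where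
  "shift T T' = (SOME z. norm z < \<kappa> / 8 \<and>
     patch (h T') 0 (\<rho> + \<kappa>) = patch (pattern_minus (h T) z) 0 (\<rho> + \<kappa>))"

lemma shift:
  assumes "T \<in> X" "T' \<in> X" "patch T 0 r = patch T' 0 r"
  shows "norm (shift T T') < \<kappa> / 8"
    "patch (h T') 0 (\<rho> + \<kappa>) = patch (pattern_minus (h T) (shift T T')) 0 (\<rho> + \<kappa>)"
  using someI_ex[OF r[OF assms, unfolded near_def]] unfolding shift_def by blast+

lemma shift_\<rho>:
  assumes "T \<in> X" "T' \<in> X" "patch T 0 r = patch T' 0 r"
  shows "patch (h T') 0 \<rho> = patch (pattern_minus (h T) (shift T T')) 0 \<rho>"
  using patch_eq_mono[OF shift(2)[OF assms]] \<kappa> by simp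

lemma shift_unique:
  assumes "T \<in> X" "T' \<in> X" "patch T 0 r = patch T' 0 r" "norm z < \<kappa> / 2"
    "patch (h T') 0 \<rho> = patch (pattern_minus (h T) z) 0 \<rho>"
  shows "z = shift T T'"
proof (rule unique[of "h T"])
  show "norm (z - shift T T') < \<kappa>"
    using norm_triangle_ineq4[of z "shift T T'"] assms(4) shift(1)[OF assms(1-3)] \<kappa> by linarith
qed (use assms shift_\<rho>[OF assms(1-3)] in auto)

lemma shift_trans:
  assumes "T \<in> X" "T' \<in> X" "T'' \<in> X" "patch T 0 r = patch T' 0 r" "patch T' 0 r = patch T'' 0 r"
  shows "shift T T'' = shift T T' + shift T' T''"
proof (rule shift_unique[symmetric])
  note n = shift(1)[OF assms(1,2,4)] shift(1)[OF assms(2,3,5)]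
  show "norm (shift T T' + shift T' T'') < \<kappa> / 2"
    using norm_triangle_ineq[of "shift T T'" "shift T' T''"] n \<kappa> by linarith
  have "patch (pattern_minus (h T') (shift T' T'')) 0 \<rho> = patch (pattern_minus (pattern_minus (h T) (shift T T')) (shift T' T'')) 0 \<rho>"
    using n \<kappa> by (intro patch_eq_shift[OF shift(2)[OF assms(1,2,4)]]) linarith
  then show "patch (h T'') 0 \<rho> = patch (pattern_minus (h T) (shift T T' + shift T' T'')) 0 \<rho>"
    using shift_\<rho>[OF assms(2,3,5)] by (simp add: pattern_minus_minus)
qed (use assms in auto)

lemma shift_refine:
  assumes "0 < e"
  shows "\<exists>R'\<ge>r. \<forall>T\<in>X. \<forall>T'\<in>X. patch T 0 R' = patch T' 0 R' \<longrightarrow>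
     norm (shift T T') < e \<and> patch (h T') 0 R = patch (pattern_minus (h T) (shift T T')) 0 R"
proof -
  obtain R' where R': "\<And>T T'. T \<in> X \<Longrightarrow> T' \<in> X \<Longrightarrow> patch T 0 R' = patch T' 0 R' \<Longrightarrow> near (max R \<rho>) (min e (\<kappa> / 8)) (h T) (h T')"
    using patch_image[of "min e (\<kappa> / 8)" "max R \<rho>"] assms \<kappa> by auto
  have "norm (shift T T') < e \<and> patch (h T') 0 R = patch (pattern_minus (h T) (shift T T')) 0 R"
    if T: "T \<in> X" "T' \<in> X" "patch T 0 (max R' r) = patch T' 0 (max R' r)" for T T'
  proof -
    have ag: "patch T 0 R' = patch T' 0 R'" "patch T 0 r = patch T' 0 r" by (rule patch_eq_mono[OF T(3)], simp)+
    obtain z where z: "norm z < min e (\<kappa> / 8)" "patch (h T') 0 (max R \<rho>) = patch (pattern_minus (h T) z) 0 (max R \<rho>)"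
      using R'[OF T(1,2) ag(1)] unfolding near_def by blast
    have "z = shift T T'"
      using z \<kappa> by (intro shift_unique T ag(2) patch_eq_mono[OF z(2)]) auto
    then show ?thesis using z patch_eq_mono[OF z(2), of R] by auto
  qed
  then show ?thesis by (intro exI[of _ "max R' r"] conjI max.cobounded2) blast
qed

text \<open>Moving along \<open>T\<close> and then across to \<open>T'\<close> amounts to the same as moving across first and then along
  \<open>T'\<close>. For a short step this holds because both ways are small translations of one pattern with the
  same patch; short steps add up.\<close>

lemma f_shift:
  assumes T: "T \<in> X" "T' \<in> X" "patch T 0 (r + B) = patch T' 0 (r + B)" and x: "norm x \<le> B"
  shows "f T' x = f T x + shift (pattern_minus T x) (pattern_minus T' x) - shift T T'"
proof -
  obtain d where d: "0 < d" "\<And>T x. T \<in> X \<Longrightarrow> norm x < d \<Longrightarrow> norm (f T x) < \<kappa> / 8"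
    using f_small[of "\<kappa> / 8"] \<kappa> by auto
  let ?P = "\<lambda>y. norm y \<le> B \<longrightarrow> f T' y - f T y = shift (pattern_minus T y) (pattern_minus T' y) - shift T T'"
  have "?P x"
  proof (rule norm_chain_induct[OF d(1), where P = ?P])
    fix y u :: 'a assume IH: "?P y" and u: "norm u < d" and le: "norm y \<le> norm (y + u)"
    show "?P (y + u)"
    proof
      assume B: "norm (y + u) \<le> B"
      define S S' where "S = pattern_minus T y" and "S' = pattern_minus T' y"
      have S: "S \<in> X" "S' \<in> X" using T by (auto simp: S_def S'_def)
      have ag: "patch S 0 r = patch S' 0 r"
        "patch (pattern_minus S u) 0 r = patch (pattern_minus S' u) 0 r"
        unfolding S_def S'_def pattern_minus_minus using B le by (auto intro!: patch_eq_shift[OF T(3)])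
      let ?D = "f S u" and ?D' = "f S' u" and ?z = "shift S S'" and ?z' = "shift (pattern_minus S u) (pattern_minus S' u)"
      have n: "norm ?D < \<kappa> / 8" "norm ?D' < \<kappa> / 8" "norm ?z < \<kappa> / 8" "norm ?z' < \<kappa> / 8"
        using d(2) S u shift(1) ag by auto
      have "patch (pattern_minus (h S') ?D') 0 \<rho> = patch (pattern_minus (pattern_minus (h S) ?z) ?D') 0 \<rho>"
        using n \<kappa> by (intro patch_eq_shift[OF shift(2)[OF S ag(1)]]) linarith
      moreover have "patch (pattern_minus (h S') ?D') 0 \<rho> = patch (pattern_minus (pattern_minus (h S) ?D) ?z') 0 \<rho>"
        using shift_\<rho>[OF _ _ ag(2)] S by (simp add: h_translate)
      ultimately have "patch (pattern_minus (h S) (?z + ?D')) 0 \<rho> = patch (pattern_minus (h S) (?D + ?z')) 0 \<rho>"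
        by (simp add: pattern_minus_minus)
      moreover have "norm (?z + ?D' - (?D + ?z')) < \<kappa>"
        using norm_triangle_ineq4[of "?z + ?D'" "?D + ?z'"] norm_triangle_ineq[of ?z ?D'] norm_triangle_ineq[of ?D ?z'] n \<kappa>
        by linarith
      ultimately have eq: "?z + ?D' = ?D + ?z'" by (intro unique[OF image_in[OF S(1)]])
      have "f T' y - f T y = ?z - shift T T'" using IH le B by (simp add: S_def S'_def)
      moreover have "f T (y + u) = f T y + ?D" "f T' (y + u) = f T' y + ?D'"
        using f_add T by (auto simp: S_def S'_def)
      ultimately have "f T' (y + u) - f T (y + u) = ?z + ?D' - ?D - shift T T'"
        by (simp add: algebra_simps)
      then show "f T' (y + u) - f T (y + u) = shift (pattern_minus T (y + u)) (pattern_minus T' (y + u)) - shift T T'"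
        unfolding eq by (simp add: S_def S'_def pattern_minus_minus)
    qed
  qed (use T in simp)
  then show ?thesis using x by (simp add: algebra_simps)
qed

text \<open>An adapted function absorbs the transversal variation of \<open>h\<close>: correcting the cocycle \<open>f\<close> by
  its coboundary leaves a cocycle that is determined by local patterns.\<close>

definition adapted :: "(('a, 'l) pattern \<Rightarrow> 'a) \<Rightarrow> real \<Rightarrow> bool" where
  "adapted s R \<longleftrightarrow> r \<le> R \<and>
     (\<forall>T\<in>X. \<forall>T'\<in>X. patch T 0 R = patch T' 0 R \<longrightarrow> s T' = s T - shift T T')"

definition corrected :: "(('a, 'l) pattern \<Rightarrow> 'a) \<Rightarrow> ('a, 'l) pattern \<Rightarrow> 'a \<Rightarrow> 'a" where
  "corrected s T x = f T x + s (pattern_minus T x) - s T"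

lemma adaptedD: "adapted s R \<Longrightarrow> T \<in> X \<Longrightarrow> T' \<in> X \<Longrightarrow> patch T 0 R = patch T' 0 R \<Longrightarrow> s T' = s T - shift T T'"
  unfolding adapted_def by blast

lemma adapted_ge: "adapted s R \<Longrightarrow> r \<le> R"
  unfolding adapted_def by blast

lemma corrected_add: "T \<in> X \<Longrightarrow> corrected s T (x + y) = corrected s T x + corrected s (pattern_minus T x) y"
  by (simp add: corrected_def f_add[of T x y] pattern_minus_minus)

lemma corrected_0 [simp]: "T \<in> X \<Longrightarrow> corrected s T 0 = 0"
  by (simp add: corrected_def)

lemma corrected_local:
  assumes s: "adapted s R" and T: "T \<in> X" "T' \<in> X" "patch T 0 (R + B) = patch T' 0 (R + B)" and x: "norm x \<le> B"
  shows "corrected s T x = corrected s T' x"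
proof -
  have rR: "r \<le> R" using s by (rule adapted_ge)
  have "0 \<le> B" using x norm_ge_zero[of x] by linarith
  have ag: "patch T 0 (r + B) = patch T' 0 (r + B)" "patch T 0 R = patch T' 0 R"
    "patch (pattern_minus T x) 0 R = patch (pattern_minus T' x) 0 R"
    using rR \<open>0 \<le> B\<close> x by (intro patch_eq_mono[OF T(3)] patch_eq_shift[OF T(3)]; simp)+
  show ?thesis
    using f_shift[OF T(1,2) ag(1) x] adaptedD[OF s T(1,2) ag(2)] adaptedD[OF s _ _ ag(3)] T
    by (simp add: corrected_def)
qed

text \<open>Measuring displacements from one representative of each patch of radius \<open>r\<close> gives an adapted
  function, but one that jumps along orbits.\<close>

definition displacement :: "('a, 'l) pattern \<Rightarrow> 'a" where
  "displacement T = - shift (SOME S. S \<in> X \<and> patch S 0 r = patch T 0 r) T"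

lemma adapted_displacement: "adapted displacement r"
  unfolding adapted_def
proof (intro conjI ballI impI order_refl)
  fix T T' assume T: "T \<in> X" "T' \<in> X" "patch T 0 r = patch T' 0 r"
  define S where "S = (SOME S. S \<in> X \<and> patch S 0 r = patch T 0 r)"
  have S: "S \<in> X" "patch S 0 r = patch T 0 r"
    using someI[of "\<lambda>S. S \<in> X \<and> patch S 0 r = patch T 0 r" T] T unfolding S_def by auto
  have "displacement T = - shift S T" "displacement T' = - shift S T'"
    using T(3) by (simp_all add: displacement_def S_def)
  then show "displacement T' = displacement T - shift T T'"
    using shift_trans[OF S(1) T(1,2) S(2) T(3)] by simp
qed

text \<open>Spreading an adapted function over the vertices near the origin with weights that depend
  only on their positions makes it as regular along orbits as the weights are.\<close>

definition spread :: "('a \<Rightarrow> real) \<Rightarrow> real \<Rightarrow> (('a, 'l) pattern \<Rightarrow> 'a) \<Rightarrow> ('a, 'l) pattern \<Rightarrow> 'a" where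
  "spread b \<rho>' s T = (\<Sum>p\<in>vertex_set T \<inter> ball 0 \<rho>'. b p *\<^sub>R (f T p + s (pattern_minus T p))) /\<^sub>R
     (\<Sum>p\<in>vertex_set T \<inter> ball 0 \<rho>'. b p)"

lemma adapted_spread:
  assumes s: "adapted s R" and pos: "\<And>T. T \<in> X \<Longrightarrow> 0 < (\<Sum>p\<in>vertex_set T \<inter> ball 0 \<rho>'. b p)" and "0 \<le> \<rho>'"
  shows "adapted (spread b \<rho>' s) (R + \<rho>')"
  unfolding adapted_def
proof (intro conjI ballI impI)
  have rR: "0 \<le> r" "r \<le> R" using adapted_ge[OF s] r_nonneg by auto
  then show "r \<le> R + \<rho>'" using assms(3) by simp
  fix T T' assume T: "T \<in> X" "T' \<in> X" and ag: "patch T 0 (R + \<rho>') = patch T' 0 (R + \<rho>')"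
  have V: "vertex_set T \<inter> ball 0 \<rho>' = vertex_set T' \<inter> ball 0 \<rho>'"
    using vertex_set_patch_eq[OF ag] rR by auto
  have "f T' p + s (pattern_minus T' p) = f T p + s (pattern_minus T p) - shift T T'" if p: "p \<in> vertex_set T \<inter> ball 0 \<rho>'" for p
  proof -
    have n: "norm p \<le> \<rho>'" using p by simp
    have "patch (pattern_minus T p) 0 R = patch (pattern_minus T' p) 0 R"
      using n by (intro patch_eq_shift[OF ag]) simp
    then have "s (pattern_minus T' p) = s (pattern_minus T p) - shift (pattern_minus T p) (pattern_minus T' p)"
      using adaptedD[OF s] T by simp
    moreover have "patch T 0 (r + \<rho>') = patch T' 0 (r + \<rho>')" using rR by (intro patch_eq_mono[OF ag]) simp
    ultimately show ?thesis using f_shift[OF T _ n] by simp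
  qed
  then have "(\<Sum>p\<in>vertex_set T \<inter> ball 0 \<rho>'. b p *\<^sub>R (f T' p + s (pattern_minus T' p)))
    = (\<Sum>p\<in>vertex_set T \<inter> ball 0 \<rho>'. b p *\<^sub>R (f T p + s (pattern_minus T p))) - (\<Sum>p\<in>vertex_set T \<inter> ball 0 \<rho>'. b p) *\<^sub>R shift T T'"
    by (simp add: scaleR_diff_right sum_subtractf scaleR_sum_left)
  then show "spread b \<rho>' s T' = spread b \<rho>' s T - shift T T'"
    using pos[OF T(1)] by (simp add: spread_def V[symmetric] scaleR_diff_right)
qed

text \<open>The mean of the translates of \<open>s\<close>, each corrected by the cocycle so that it is adapted again;
  the effect on the corrected cocycle is to take the mean of its translates.\<close>

definition averaged :: "'a list \<Rightarrow> (('a, 'l) pattern \<Rightarrow> 'a) \<Rightarrow> ('a, 'l) pattern \<Rightarrow> 'a" where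
  "averaged ys s T = (\<Sum>y\<leftarrow>ys. s (pattern_minus T y) + f T y) /\<^sub>R real (length ys)"

lemma adapted_averaged:
  assumes s: "adapted s R" and ys: "ys \<noteq> []" "\<And>y. y \<in> set ys \<Longrightarrow> norm y \<le> B" and "0 \<le> B"
  shows "adapted (averaged ys s) (R + B)"
  unfolding adapted_def
proof (intro conjI ballI impI)
  have rR: "0 \<le> r" "r \<le> R" using adapted_ge[OF s] r_nonneg by auto
  then show "r \<le> R + B" using assms(4) by simp
  fix T T' assume T: "T \<in> X" "T' \<in> X" and ag: "patch T 0 (R + B) = patch T' 0 (R + B)"
  have "s (pattern_minus T' y) + f T' y = s (pattern_minus T y) + f T y - shift T T'" if y: "y \<in> set ys" for y
  proof -
    have "patch (pattern_minus T y) 0 R = patch (pattern_minus T' y) 0 R"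
      using ys(2)[OF y] by (intro patch_eq_shift[OF ag]) simp
    then have "s (pattern_minus T' y) = s (pattern_minus T y) - shift (pattern_minus T y) (pattern_minus T' y)"
      using adaptedD[OF s] T by simp
    moreover have "patch T 0 (r + B) = patch T' 0 (r + B)" using rR by (intro patch_eq_mono[OF ag]) simp
    ultimately show ?thesis using f_shift[OF T _ ys(2)[OF y]] by simp
  qed
  then have "(\<Sum>y\<leftarrow>ys. s (pattern_minus T' y) + f T' y) = (\<Sum>y\<leftarrow>ys. s (pattern_minus T y) + f T y - shift T T')"
    by (intro arg_cong[of _ _ sum_list] map_cong) auto
  also have "\<dots> = (\<Sum>y\<leftarrow>ys. s (pattern_minus T y) + f T y) - real (length ys) *\<^sub>R shift T T'"
    by (induction ys) (auto simp: algebra_simps)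
  finally show "averaged ys s T' = averaged ys s T - shift T T'"
    using ys(1) by (simp add: averaged_def scaleR_diff_right)
qed

lemma corrected_averaged:
  assumes "T \<in> X" "ys \<noteq> []"
  shows "corrected (averaged ys s) T x = (\<Sum>y\<leftarrow>ys. corrected s (pattern_minus T y) x) /\<^sub>R real (length ys)"
proof -
  have "f T x + (s (pattern_minus T (x + y)) + f (pattern_minus T x) y) - (s (pattern_minus T y) + f T y)
      = corrected s (pattern_minus T y) x" for y
    using f_add[OF assms(1), of x y] f_add[OF assms(1), of y x]
    by (simp add: corrected_def pattern_minus_minus algebra_simps)
  then have "(\<Sum>y\<leftarrow>ys. corrected s (pattern_minus T y) x)
      = (\<Sum>y\<leftarrow>ys. f T x + (s (pattern_minus T (x + y)) + f (pattern_minus T x) y) - (s (pattern_minus T y) + f T y))"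
    by simp
  also have "\<dots> = real (length ys) *\<^sub>R f T x + (\<Sum>y\<leftarrow>ys. s (pattern_minus T (x + y)) + f (pattern_minus T x) y)
      - (\<Sum>y\<leftarrow>ys. s (pattern_minus T y) + f T y)"
    by (induction ys) (auto simp: algebra_simps)
  finally show ?thesis
    using assms(2) by (simp add: corrected_def averaged_def pattern_minus_minus scaleR_add_right scaleR_diff_right)
qed

text \<open>An adapted function varies by \<open>shift\<close> across orbits, which is small if patches of a large
  radius agree; so only its continuity along orbits is in question.\<close>

lemma continuous_adapted:
  assumes s: "adapted s R"
    and cont: "\<And>T e. T \<in> X \<Longrightarrow> 0 < e \<Longrightarrow> \<exists>d>0. \<forall>y. norm y < d \<longrightarrow> norm (corrected s T y) < e"
  shows "continuous_map (pattern_topology L X) euclidean s"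
proof (rule X.continuous_map_euclideanI)
  fix T and e :: real assume T: "T \<in> X" and e: "0 < e"
  obtain d1 where d1: "0 < d1" "\<And>y. norm y < d1 \<Longrightarrow> norm (corrected s T y) < e / 3"
    using cont[OF T, of "e / 3"] e by auto
  obtain d2 where d2: "0 < d2" "\<And>T y. T \<in> X \<Longrightarrow> norm y < d2 \<Longrightarrow> norm (f T y) < e / 3"
    using f_small[of "e / 3"] e by auto
  obtain R' where R': "\<And>T T'. T \<in> X \<Longrightarrow> T' \<in> X \<Longrightarrow> patch T 0 R' = patch T' 0 R' \<Longrightarrow> norm (shift T T') < e / 3"
    using shift_refine[of "e / 3"] e by (metis zero_less_divide_iff zero_less_numeral)
  have "dist (s T) (s T') < e" if T': "T' \<in> X" "near (max R R') (min d1 d2) T T'" for T'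
  proof -
    obtain y where y: "norm y < d1" "norm y < d2" "patch T' 0 (max R R') = patch (pattern_minus T y) 0 (max R R')"
      using T'(2) unfolding near_def by auto
    have ag: "patch (pattern_minus T y) 0 R' = patch T' 0 R'" "patch (pattern_minus T y) 0 R = patch T' 0 R"
      by (rule patch_eq_mono[OF y(3)[symmetric]], simp)+
    have "norm (shift (pattern_minus T y) T') < e / 3" "s T' = s (pattern_minus T y) - shift (pattern_minus T y) T'"
      using R'[OF X.translate_in[OF T] T'(1) ag(1)] adaptedD[OF s X.translate_in[OF T] T'(1) ag(2)] .
    moreover have "s (pattern_minus T y) = s T + corrected s T y - f T y" by (simp add: corrected_def)
    ultimately have "s T' - s T = corrected s T y - f T y - shift (pattern_minus T y) T'" by simp
    moreover have "norm (corrected s T y - f T y - shift (pattern_minus T y) T') < e"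
      using norm_triangle_ineq4[of "corrected s T y - f T y" "shift (pattern_minus T y) T'"]
        norm_triangle_ineq4[of "corrected s T y" "f T y"] d1(2)[OF y(1)] d2(2)[OF T y(2)]
        \<open>norm (shift (pattern_minus T y) T') < e / 3\<close> by linarith
    ultimately show ?thesis by (simp add: dist_norm norm_minus_commute)
  qed
  then show "\<exists>R. \<exists>d>0. \<forall>T'\<in>X. near R d T T' \<longrightarrow> dist (s T) (s T') < e"
    using d1(1) d2(1) by (intro exI[of _ "max R R'"] exI[of _ "min d1 d2"]) auto
qed

end


section \<open>Smooth functions from bump functions\<close>

text \<open>The derivatives of $e^{-1/t}$ are of this form.\<close>

definition flat_exp :: "real poly \<Rightarrow> real \<Rightarrow> real" where
  "flat_exp p t = (if 0 < t then poly p (1 / t) * exp (- (1 / t)) else 0)"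

lemma tendsto_poly_exp: "((\<lambda>u. poly p u * exp (- u)) \<longlongrightarrow> (0::real)) at_top"
proof -
  have "((\<lambda>u. \<Sum>i\<le>degree p. coeff p i * (u ^ i / exp u)) \<longlongrightarrow> (\<Sum>i\<le>degree p. coeff p i * 0)) at_top"
    by (intro tendsto_sum tendsto_mult tendsto_const tendsto_power_div_exp_0)
  then show ?thesis by (simp add: poly_altdef sum_distrib_right exp_minus divide_inverse mult.assoc)
qed

lemma DERIV_flat: "(flat_exp p has_real_derivative flat_exp ([:0, 0, 1:] * (p - pderiv p)) t) (at t)"
proof (cases t "0::real" rule: linorder_cases)
  case less
  have "(flat_exp p has_real_derivative 0) (at t) \<longleftrightarrow> ((\<lambda>_. 0) has_real_derivative 0) (at t)"
    using less by (intro DERIV_cong_ev) (auto simp: flat_exp_def eventually_at_filter intro: eventually_mono[OF eventually_nhds_in_open[of "{..<0}"]])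
  then show ?thesis using less by (simp add: flat_exp_def)
next
  case greater
  have "((\<lambda>t. poly p (1 / t) * exp (- (1 / t))) has_real_derivative
      poly ([:0, 0, 1:] * (p - pderiv p)) (1 / t) * exp (- (1 / t))) (at t)"
    using greater
    by (auto intro!: derivative_eq_intros DERIV_chain'[where g = "poly p"] simp: field_simps power2_eq_square)
  moreover have "(flat_exp p has_real_derivative D) (at t) \<longleftrightarrow> ((\<lambda>t. poly p (1 / t) * exp (- (1 / t))) has_real_derivative D) (at t)" for D
    using greater by (intro DERIV_cong_ev) (auto simp: flat_exp_def intro: eventually_mono[OF eventually_nhds_in_open[of "{0<..}"]])
  ultimately show ?thesis using greater by (simp add: flat_exp_def)
next
  case equal
  have "((\<lambda>h. (flat_exp p (0 + h) - flat_exp p 0) / h) \<longlongrightarrow> 0) (at 0)"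
  proof (rule filterlim_split_at)
    show "((\<lambda>h. (flat_exp p (0 + h) - flat_exp p 0) / h) \<longlongrightarrow> 0) (at_left 0)"
      by (rule tendsto_eventually) (auto simp: eventually_at_filter flat_exp_def)
    have "((\<lambda>h. poly ([:0, 1:] * p) (inverse h) * exp (- inverse h)) \<longlongrightarrow> 0) (at_right (0::real))"
      by (rule filterlim_compose[OF tendsto_poly_exp filterlim_inverse_at_top_right])
    then show "((\<lambda>h. (flat_exp p (0 + h) - flat_exp p 0) / h) \<longlongrightarrow> 0) (at_right 0)"
      by (rule Lim_transform_eventually) (auto simp: eventually_at_filter flat_exp_def field_simps)
  qed
  then show ?thesis using equal by (simp add: DERIV_def flat_exp_def)
qed

lemma flat_has_derivative:
  "(q has_derivative Q) (at x) \<Longrightarrow>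
    ((\<lambda>x. flat_exp p (q x)) has_derivative (\<lambda>v. Q v * flat_exp ([:0, 0, 1:] * (p - pderiv p)) (q x))) (at x)"
  using DERIV_compose_FDERIV[OF DERIV_flat] by blast

text \<open>A class of functions that contains quotients of sums of bump functions and is closed under
  differentiation. Denominators need to be nonzero only on the set \<open>U\<close>, so that the class may be
  used locally.\<close>

inductive elementary :: "'a::euclidean_space set \<Rightarrow> ('a \<Rightarrow> real) \<Rightarrow> bool" for U where
  const: "elementary U (\<lambda>x. c)"
| inner: "elementary U (\<lambda>x. x \<bullet> u)"
| add: "elementary U f \<Longrightarrow> elementary U g \<Longrightarrow> elementary U (\<lambda>x. f x + g x)"
| mult: "elementary U f \<Longrightarrow> elementary U g \<Longrightarrow> elementary U (\<lambda>x. f x * g x)"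
| inverse: "elementary U f \<Longrightarrow> (\<And>x. x \<in> U \<Longrightarrow> f x \<noteq> 0) \<Longrightarrow> elementary U (\<lambda>x. inverse (f x))"
| flat: "elementary U f \<Longrightarrow> elementary U (\<lambda>x. flat_exp p (f x))"

lemma elementary_sum: "finite I \<Longrightarrow> (\<And>i. i \<in> I \<Longrightarrow> elementary U (f i)) \<Longrightarrow> elementary U (\<lambda>x. \<Sum>i\<in>I. f i x)"
  by (induction I rule: finite_induct) (auto intro: elementary.intros)

lemma elementary_uminus: "elementary U f \<Longrightarrow> elementary U (\<lambda>x. - f x)"
  using elementary.mult[OF elementary.const[of U "-1"]] by fastforce

text \<open>The first derivative \<open>G\<close> is again elementary, so that differentiation can be iterated; the
  symmetric second derivative \<open>H\<close> is what makes differentials closed forms.\<close>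

definition second_derivative ::
  "'a::euclidean_space set \<Rightarrow> ('a \<Rightarrow> real) \<Rightarrow> ('a \<Rightarrow> 'a \<Rightarrow> real) \<Rightarrow> ('a \<Rightarrow> 'a \<Rightarrow> 'a \<Rightarrow> real) \<Rightarrow> bool" where
  "second_derivative U g G H \<longleftrightarrow> (\<forall>x\<in>U. (g has_derivative G x) (at x)) \<and> (\<forall>v. elementary U (\<lambda>x. G x v)) \<and>
    (\<forall>v. \<forall>x\<in>U. ((\<lambda>y. G y v) has_derivative H v x) (at x)) \<and> (\<forall>u v. \<forall>x\<in>U. H v x u = H u x v)"

lemma second_derivativeD:
  assumes "second_derivative U g G H"
  shows "x \<in> U \<Longrightarrow> (g has_derivative G x) (at x)" "elementary U (\<lambda>x. G x v)"
    "x \<in> U \<Longrightarrow> ((\<lambda>y. G y v) has_derivative H v x) (at x)" "x \<in> U \<Longrightarrow> H v x u = H u x v"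
  using assms unfolding second_derivative_def by blast+

lemma elementary_second_derivative:
  assumes "elementary U g"
  shows "\<exists>G H. second_derivative U g G H"
  using assms
proof induction
  case (const c)
  show ?case unfolding second_derivative_def by (intro exI[of _ "\<lambda>_ _. 0"] exI[of _ "\<lambda>_ _ _. 0"]) (auto intro: elementary.const)
next
  case (inner u)
  show ?case unfolding second_derivative_def
    by (intro exI[of _ "\<lambda>_ v. v \<bullet> u"] exI[of _ "\<lambda>_ _ _. 0"])
      (auto intro: elementary.const intro!: derivative_eq_intros)
next
  case (add f g)
  then obtain F H G K where "second_derivative U f F H" "second_derivative U g G K" by blast
  note * = this[THEN second_derivativeD(1)] this[THEN second_derivativeD(2)]
    this[THEN second_derivativeD(3)] this[THEN second_derivativeD(4)]
  then show ?case unfolding second_derivative_def using *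
    by (intro exI[of _ "\<lambda>x v. F x v + G x v"] exI[of _ "\<lambda>v x u. H v x u + K v x u"])
      (auto intro: elementary.intros has_derivative_add)
next
  case (mult f g)
  then obtain F H G K where "second_derivative U f F H" "second_derivative U g G K" by blast
  note * = this[THEN second_derivativeD(1)] this[THEN second_derivativeD(2)]
    this[THEN second_derivativeD(3)] this[THEN second_derivativeD(4)]
  have "((\<lambda>y. f y * G y v + F y v * g y) has_derivative (\<lambda>u. (f x * K v x u + F x u * G x v) + (F x v * G x u + H v x u * g x))) (at x)"
    if "x \<in> U" for x v by (intro has_derivative_add has_derivative_mult * that)
  moreover have "elementary U (\<lambda>x. f x * G x v + F x v * g x)" for v
    by (intro elementary.add elementary.mult mult.hyps *)
  ultimately show ?case unfolding second_derivative_def using *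
    by (intro exI[of _ "\<lambda>x v. f x * G x v + F x v * g x"] exI[of _ "\<lambda>v x u. (f x * K v x u + F x u * G x v) + (F x v * G x u + H v x u * g x)"])
      (auto intro: elementary.intros has_derivative_mult)
next
  case (inverse f)
  then obtain F H where "second_derivative U f F H" by blast
  note * = second_derivativeD[OF this]
  have i: "((\<lambda>x. inverse (f x)) has_derivative (\<lambda>v. - (inverse (f x) * F x v * inverse (f x)))) (at x)" if "x \<in> U" for x
    using Deriv.has_derivative_inverse[OF inverse(2)[OF that] *(1)[OF that]] .
  have "((\<lambda>y. - (inverse (f y) * F y v * inverse (f y))) has_derivative
     (\<lambda>u. - (inverse (f x) * F x v * - (inverse (f x) * F x u * inverse (f x)) +
        (inverse (f x) * H v x u + - (inverse (f x) * F x u * inverse (f x)) * F x v) * inverse (f x)))) (at x)"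
    if "x \<in> U" for x v by (intro has_derivative_minus has_derivative_mult *(3) i that)
  then show ?case unfolding second_derivative_def using * i
    by (intro exI[of _ "\<lambda>x v. - (inverse (f x) * F x v * inverse (f x))"] exI)
      (auto simp: algebra_simps intro!: elementary_uminus elementary.mult elementary.inverse inverse.hyps)
next
  case (flat f p)
  then obtain F H where "second_derivative U f F H" by blast
  note * = second_derivativeD[OF this]
  define q where "q = [:0, 0, 1:] * (p - pderiv p)"
  define q' where "q' = [:0, 0, 1:] * (q - pderiv q)"
  have "((\<lambda>y. F y v * flat_exp q (f y)) has_derivative
     (\<lambda>u. F x v * (F x u * flat_exp q' (f x)) + H v x u * flat_exp q (f x))) (at x)" if "x \<in> U" for x v
    unfolding q'_def by (intro has_derivative_mult flat_has_derivative *(1,3) that)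
  moreover have "elementary U (\<lambda>x. F x v * flat_exp q (f x))" for v
    by (intro elementary.mult elementary.flat flat.hyps *(2))
  ultimately show ?case unfolding second_derivative_def using * flat_has_derivative[of f _ _ p, folded q_def]
    by (intro exI[of _ "\<lambda>x v. F x v * flat_exp q (f x)"] exI[of _ "\<lambda>v x u. F x v * (F x u * flat_exp q' (f x)) + H v x u * flat_exp q (f x)"])
      (auto intro: elementary.mult elementary.flat flat.hyps)
qed

definition locally_elementary :: "('a::euclidean_space \<Rightarrow> real) \<Rightarrow> bool" where
  "locally_elementary f \<longleftrightarrow> (\<forall>x. \<exists>U g. open U \<and> x \<in> U \<and> elementary U g \<and> (\<forall>y\<in>U. f y = g y))"

lemma locally_elementary_derivative:
  assumes "locally_elementary f"
  shows "f differentiable (at x)" "locally_elementary (\<lambda>x. frechet_derivative f (at x) v)"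
    "frechet_derivative (\<lambda>y. frechet_derivative f (at y) v) (at x) u =
     frechet_derivative (\<lambda>y. frechet_derivative f (at y) u) (at x) v"
proof -
  have main: "\<exists>U G H. open U \<and> x \<in> U \<and> second_derivative U f G H" for x
  proof -
    obtain U g where U: "open U" "x \<in> U" "elementary U g" "\<forall>y\<in>U. f y = g y"
      using assms unfolding locally_elementary_def by blast
    obtain G H where "second_derivative U g G H"
      using elementary_second_derivative[OF U(3)] by blast
    note GH = second_derivativeD[OF this]
    have "(f has_derivative G y) (at y)" if "y \<in> U" for y
      using has_derivative_transform_within_open[OF GH(1)[OF that] U(1) that, of f] U(4) by simp
    then have "second_derivative U f G H"
      unfolding second_derivative_def by (intro conjI ballI allI GH)
    then show ?thesis using U(1,2) by blast
  qed
  show "f differentiable (at x)"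
    using main[of x] second_derivativeD(1) unfolding differentiable_def by blast
  show "locally_elementary (\<lambda>x. frechet_derivative f (at x) v)"
    unfolding locally_elementary_def
  proof
    fix x
    obtain U G H where U: "open U" "x \<in> U" and GH: "second_derivative U f G H"
      using main[of x] by blast
    have "frechet_derivative f (at y) v = G y v" if "y \<in> U" for y
      using frechet_derivative_at[OF second_derivativeD(1)[OF GH that]] by simp
    then show "\<exists>U g. open U \<and> x \<in> U \<and> elementary U g \<and> (\<forall>y\<in>U. frechet_derivative f (at y) v = g y)"
      using U second_derivativeD(2)[OF GH] by (intro exI[of _ U] exI[of _ "\<lambda>y. G y v"]) simp
  qed
  obtain U G H where U: "open U" "x \<in> U" and GH: "second_derivative U f G H"
    using main[of x] by blast
  have "G y v = frechet_derivative f (at y) v" if "y \<in> U" for y v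
    using frechet_derivative_at[OF second_derivativeD(1)[OF GH that]] by simp
  then have "((\<lambda>y. frechet_derivative f (at y) v) has_derivative H v x) (at x)" for v
    by (rule has_derivative_transform_within_open[OF second_derivativeD(3)[OF GH U(2)] U])
  then have "frechet_derivative (\<lambda>y. frechet_derivative f (at y) v) (at x) = H v x" for v
    using frechet_derivative_at by metis
  then show "frechet_derivative (\<lambda>y. frechet_derivative f (at y) v) (at x) u =
     frechet_derivative (\<lambda>y. frechet_derivative f (at y) u) (at x) v"
    using second_derivativeD(4)[OF GH U(2), of v u] by simp
qed

lemma locally_elementary_iterated: "locally_elementary f \<Longrightarrow> locally_elementary (iterated_derivative vs f)"
  by (induction vs) (auto intro: locally_elementary_derivative(2))

lemma smooth_combination:
  assumes "finite I" "\<And>i. i \<in> I \<Longrightarrow> locally_elementary (g i)"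
  shows "smooth (\<lambda>x. \<Sum>i\<in>I. g i x *\<^sub>R c i)"
proof -
  have der: "((\<lambda>x. \<Sum>i\<in>I. iterated_derivative vs (g i) x *\<^sub>R c i) has_derivative
      (\<lambda>v. \<Sum>i\<in>I. frechet_derivative (iterated_derivative vs (g i)) (at x) v *\<^sub>R c i)) (at x)" for vs x
    by (intro has_derivative_sum has_derivative_scaleR_left frechet_derivative_works[THEN iffD1]
      locally_elementary_derivative(1) locally_elementary_iterated assms)
  have "iterated_derivative vs (\<lambda>x. \<Sum>i\<in>I. g i x *\<^sub>R c i) = (\<lambda>x. \<Sum>i\<in>I. iterated_derivative vs (g i) x *\<^sub>R c i)" for vs
    by (induction vs) (simp_all add: frechet_derivative_at[OF der, symmetric])
  then show ?thesis
    unfolding smooth_def differentiable_def using der by (metis (no_types, lifting))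
qed

definition total_derivative :: "('a::euclidean_space \<Rightarrow> 'a) \<Rightarrow> 'a \<Rightarrow> ('a \<Rightarrow>\<^sub>L 'a)" where
  "total_derivative A x = Blinfun (frechet_derivative A (at x))"

text \<open>Statements about forms reduce to the components of \<open>A\<close>: the form is a finite sum of constant
  operators with locally elementary coefficients, closedness is the symmetry of second derivatives,
  and the last equation is the fundamental theorem of calculus along the segment.\<close>

lemma total_derivative:
  fixes A :: "'a::euclidean_space \<Rightarrow> 'a"
  assumes A: "\<And>i. i \<in> Basis \<Longrightarrow> locally_elementary (\<lambda>x. A x \<bullet> i)"
  shows "(A has_derivative blinfun_apply (total_derivative A x)) (at x)"
    "i \<in> Basis \<Longrightarrow> blinfun_apply (total_derivative A x) v \<bullet> i = frechet_derivative (\<lambda>x. A x \<bullet> i) (at x) v"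
    "smooth (total_derivative A)" "closed_form (total_derivative A)"
    "form_integral (total_derivative A) x = A x - A 0"
proof -
  let ?\<omega> = "total_derivative A"
  have d: "((\<lambda>x. A x \<bullet> i) has_derivative frechet_derivative (\<lambda>x. A x \<bullet> i) (at x)) (at x)" if "i \<in> Basis" for i x
    using locally_elementary_derivative(1)[OF A[OF that]] frechet_derivative_works by blast
  have "A differentiable (at x)" for x
    using differentiable_componentwise_within[of A x UNIV] d unfolding differentiable_def by blast
  then have fd: "(A has_derivative frechet_derivative A (at x)) (at x)" for x
    using frechet_derivative_works by blast
  then have app: "blinfun_apply (?\<omega> x) = frechet_derivative A (at x)" for x
    unfolding total_derivative_def by (intro bounded_linear_Blinfun_apply has_derivative_bounded_linear)
  show der: "(A has_derivative blinfun_apply (?\<omega> x)) (at x)" for x using fd app by simp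
  show comp: "blinfun_apply (?\<omega> x) v \<bullet> i = frechet_derivative (\<lambda>x. A x \<bullet> i) (at x) v" if "i \<in> Basis" for x v i
    using has_derivative_unique[OF d[OF that] has_derivative_inner_left[OF der]] by metis
  define E :: "'a \<times> 'a \<Rightarrow> 'a \<Rightarrow>\<^sub>L 'a" where "E = (\<lambda>(i, j). Blinfun (\<lambda>v. (v \<bullet> j) *\<^sub>R i))"
  have E: "blinfun_apply (E (i, j)) v = (v \<bullet> j) *\<^sub>R i" for i j v
  proof -
    have "bounded_linear (\<lambda>v::'a. (v \<bullet> j) *\<^sub>R i)" by (intro bounded_linear_intros)
    then show ?thesis by (simp add: E_def bounded_linear_Blinfun_apply)
  qed
  define W where "W = (\<lambda>(i, j) x. frechet_derivative (\<lambda>x. A x \<bullet> i) (at x) j)"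
  have "?\<omega> x = (\<Sum>ij\<in>Basis \<times> Basis. W ij x *\<^sub>R E ij)" for x
  proof (rule blinfun_eqI)
    fix v
    have "blinfun_apply (?\<omega> x) v = (\<Sum>i\<in>Basis. (\<Sum>j\<in>Basis. (v \<bullet> j) * (blinfun_apply (?\<omega> x) j \<bullet> i)) *\<^sub>R i)"
    proof -
      have "blinfun_apply (?\<omega> x) v = blinfun_apply (?\<omega> x) (\<Sum>j\<in>Basis. (v \<bullet> j) *\<^sub>R j)" by (simp add: euclidean_representation)
      also have "\<dots> = (\<Sum>j\<in>Basis. (v \<bullet> j) *\<^sub>R blinfun_apply (?\<omega> x) j)" by (simp add: blinfun.sum_right blinfun.scaleR_right)
      finally have eq: "blinfun_apply (?\<omega> x) v = (\<Sum>j\<in>Basis. (v \<bullet> j) *\<^sub>R blinfun_apply (?\<omega> x) j)" .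
      show ?thesis
        by (subst (1) euclidean_representation[symmetric], subst eq) (simp add: inner_sum_left)
    qed
    also have "\<dots> = blinfun_apply (\<Sum>ij\<in>Basis \<times> Basis. W ij x *\<^sub>R E ij) v"
      by (simp add: sum.cartesian_product' blinfun.sum_left blinfun.scaleR_left W_def E comp scaleR_sum_left mult.commute)
    finally show "blinfun_apply (?\<omega> x) v = blinfun_apply (\<Sum>ij\<in>Basis \<times> Basis. W ij x *\<^sub>R E ij) v" .
  qed
  then have eq: "?\<omega> = (\<lambda>x. \<Sum>ij\<in>Basis \<times> Basis. W ij x *\<^sub>R E ij)" by (rule ext)
  have "locally_elementary (W ij)" if "ij \<in> Basis \<times> Basis" for ij
  proof -
    from that obtain i j where ij: "ij = (i, j)" "i \<in> Basis" by blast
    show ?thesis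
      using locally_elementary_derivative(2)[OF A[OF ij(2)], of j] unfolding W_def ij(1) by simp
  qed
  then show sm: "smooth ?\<omega>"
    unfolding eq by (intro smooth_combination) auto
  have \<omega>d: "(?\<omega> has_derivative frechet_derivative ?\<omega> (at x)) (at x)" for x
    using sm[unfolded smooth_def, rule_format, of "[]" x] frechet_derivative_works by auto
  show "closed_form ?\<omega>"
    unfolding closed_form_def
  proof (intro allI, rule euclidean_eqI)
    fix x u v i :: 'a assume i: "i \<in> Basis"
    have "frechet_derivative (\<lambda>y. frechet_derivative (\<lambda>x. A x \<bullet> i) (at y) v) (at x) u
        = blinfun_apply (frechet_derivative ?\<omega> (at x) u) v \<bullet> i" for u v
    proof -
      have "((\<lambda>y. blinfun_apply (?\<omega> y) v \<bullet> i) has_derivative (\<lambda>u. blinfun_apply (frechet_derivative ?\<omega> (at x) u) v \<bullet> i)) (at x)"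
        by (intro has_derivative_inner_left bounded_linear.has_derivative[OF _ \<omega>d] bounded_linear_intros)
      then show ?thesis unfolding comp[OF i] by (simp add: frechet_derivative_at[symmetric])
    qed
    then show "blinfun_apply (frechet_derivative ?\<omega> (at x) u) v \<bullet> i = blinfun_apply (frechet_derivative ?\<omega> (at x) v) u \<bullet> i"
      using locally_elementary_derivative(3)[OF A[OF i]] by metis
  qed
  have "((\<lambda>t. blinfun_apply (?\<omega> (t *\<^sub>R x)) x) has_integral A (1 *\<^sub>R x) - A (0 *\<^sub>R x)) {0..1}"
  proof (rule fundamental_theorem_of_calculus)
    fix t :: real
    have "((\<lambda>t. A (t *\<^sub>R x)) has_derivative (\<lambda>s. blinfun_apply (?\<omega> (t *\<^sub>R x)) (s *\<^sub>R x))) (at t within {0..1})"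
      by (rule has_derivative_compose[OF _ der]) (auto intro!: derivative_eq_intros)
    then show "((\<lambda>t. A (t *\<^sub>R x)) has_vector_derivative blinfun_apply (?\<omega> (t *\<^sub>R x)) x) (at t within {0..1})"
      by (simp add: has_vector_derivative_def blinfun.scaleR_right)
  qed auto
  then show "form_integral ?\<omega> x = A x - A 0" unfolding form_integral_def by (simp add: integral_unique)
qed

definition bump :: "real \<Rightarrow> 'a::euclidean_space \<Rightarrow> real" where
  "bump \<rho> x = flat_exp 1 (\<rho>\<^sup>2 - x \<bullet> x)"

lemma bump_nonneg: "0 \<le> bump \<rho> x"
  by (simp add: bump_def flat_exp_def)

lemma bump_pos: "norm x < \<rho> \<Longrightarrow> 0 < bump \<rho> x"
  by (simp add: bump_def flat_exp_def power2_norm_eq_inner[symmetric] power_strict_mono)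

lemma bump_0: 
  assumes "\<rho> \<le> norm x" "0 \<le> \<rho>" shows "bump \<rho> x = 0"
proof -
  have "\<rho>\<^sup>2 \<le> (norm x)\<^sup>2" using assms by (intro power_mono)
  then show ?thesis by (simp add: bump_def flat_exp_def power2_norm_eq_inner)
qed

lemma elementary_bump: "elementary U (\<lambda>x. bump \<rho> (p - x))"
proof -
  have "elementary U (\<lambda>x. \<rho>\<^sup>2 + (- (\<Sum>b\<in>Basis. (p \<bullet> b + - (x \<bullet> b)) * (p \<bullet> b + - (x \<bullet> b)))))"
    by (intro elementary.add elementary_uminus elementary.const elementary_sum elementary.mult elementary.inner) auto
  moreover have "(p - x) \<bullet> (p - x) = (\<Sum>b\<in>Basis. (p \<bullet> b + - (x \<bullet> b)) * (p \<bullet> b + - (x \<bullet> b)))" for x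
    by (subst euclidean_inner) (simp add: inner_diff_left)
  ultimately have "elementary U (\<lambda>x. \<rho>\<^sup>2 - (p - x) \<bullet> (p - x))" by simp
  then show ?thesis unfolding bump_def by (rule elementary.flat)
qed


section \<open>Linear functionals below a sublinear one\<close>

definition function_space :: "('x \<Rightarrow> real) set \<Rightarrow> bool" where
  "function_space V \<longleftrightarrow> V \<noteq> {} \<and> (\<forall>f\<in>V. \<forall>g\<in>V. (\<lambda>x. f x + g x) \<in> V) \<and> (\<forall>f\<in>V. \<forall>c. (\<lambda>x. c * f x) \<in> V)"

definition sublinear_on :: "('x \<Rightarrow> real) set \<Rightarrow> (('x \<Rightarrow> real) \<Rightarrow> real) \<Rightarrow> bool" where
  "sublinear_on V q \<longleftrightarrow> (\<forall>f\<in>V. \<forall>g\<in>V. q (\<lambda>x. f x + g x) \<le> q f + q g) \<and>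
     (\<forall>f\<in>V. \<forall>c\<ge>0. q (\<lambda>x. c * f x) = c * q f)"

lemma function_spaceD:
  assumes "function_space V"
  shows "f \<in> V \<Longrightarrow> g \<in> V \<Longrightarrow> (\<lambda>x. f x + g x) \<in> V" "f \<in> V \<Longrightarrow> (\<lambda>x. c * f x) \<in> V"
    "f \<in> V \<Longrightarrow> (\<lambda>x. - f x) \<in> V" "(\<lambda>x. 0) \<in> V"
proof -
  show 1: "(\<lambda>x. c * f x) \<in> V" if "f \<in> V" for f c using assms that by (simp add: function_space_def)
  show "(\<lambda>x. - f x) \<in> V" if "f \<in> V" using 1[OF that, of "-1"] by simp
  obtain g where "g \<in> V" using assms by (auto simp: function_space_def)
  then show "(\<lambda>x. 0) \<in> V" using 1[of g 0] by simp
qed (use assms in \<open>simp add: function_space_def\<close>)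

lemma sublinear_onD:
  assumes "sublinear_on V q"
  shows "f \<in> V \<Longrightarrow> g \<in> V \<Longrightarrow> q (\<lambda>x. f x + g x) \<le> q f + q g"
    "f \<in> V \<Longrightarrow> 0 \<le> c \<Longrightarrow> q (\<lambda>x. c * f x) = c * q f"
  using assms by (auto simp: sublinear_on_def)

lemma sublinear_on_0: "sublinear_on V q \<Longrightarrow> f \<in> V \<Longrightarrow> q (\<lambda>x. 0) = 0"
  using sublinear_onD(2)[of V q f 0] by simp

lemma sublinear_on_minus: "sublinear_on V q \<Longrightarrow> function_space V \<Longrightarrow> f \<in> V \<Longrightarrow> - q (\<lambda>x. - f x) \<le> q f"
  using sublinear_onD(1)[of V q f "\<lambda>x. - f x"] sublinear_on_0[of V q f] function_spaceD(3)[of V f] by simp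

lemma sublinear_onI:
  assumes V: "function_space V" and 0: "q (\<lambda>x. 0) = 0"
    and add: "\<And>f g. f \<in> V \<Longrightarrow> g \<in> V \<Longrightarrow> q (\<lambda>x. f x + g x) \<le> q f + q g"
    and scale: "\<And>f c. f \<in> V \<Longrightarrow> 0 < c \<Longrightarrow> q (\<lambda>x. c * f x) \<le> c * q f"
  shows "sublinear_on V q"
proof -
  have "q (\<lambda>x. c * f x) = c * q f" if f: "f \<in> V" and c: "0 \<le> c" for f c
  proof (cases "c = 0")
    case False
    then have "0 < c" using c by simp
    have "q f \<le> (1 / c) * q (\<lambda>x. c * f x)"
      using scale[OF function_spaceD(2)[OF V f], of "1 / c" c] \<open>0 < c\<close> by simp
    then show ?thesis using scale[OF f \<open>0 < c\<close>] \<open>0 < c\<close> by (simp add: field_simps)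
  qed (simp add: 0)
  then show ?thesis using add by (simp add: sublinear_on_def)
qed

lemma le_cInf_add:
  fixes A B :: "real set"
  assumes "A \<noteq> {}" "B \<noteq> {}" "\<And>a b. a \<in> A \<Longrightarrow> b \<in> B \<Longrightarrow> z \<le> a + b"
  shows "z \<le> Inf A + Inf B"
proof -
  have "z - a \<le> Inf B" if "a \<in> A" for a
    using assms(2) assms(3)[OF that] by (intro cInf_greatest) (auto simp: diff_le_eq add.commute)
  then have "z - Inf B \<le> Inf A" using assms(1) by (intro cInf_greatest) (auto simp: diff_le_eq add.commute)
  then show ?thesis by simp
qed

text \<open>Tilting a sublinear functional in the direction \<open>w\<close> until it is linear along \<open>w\<close>. The tilted
  functional at \<open>f\<close> is the infimum of $q(f+tw)-tq(w)$ over $t\ge 0$.\<close>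

lemma sublinear_tilt:
  assumes V: "function_space V" and q: "sublinear_on V q" and w: "w \<in> V"
  shows "\<exists>q'. sublinear_on V q' \<and> (\<forall>f\<in>V. q' f \<le> q f) \<and> q' (\<lambda>x. - w x) \<le> - q w"
proof -
  define S where "S = (\<lambda>f. (\<lambda>t. q (\<lambda>x. f x + t * w x) - t * q w) ` {0..})"
  define q' where "q' = (\<lambda>f. Inf (S f))"
  have ne: "S f \<noteq> {}" for f by (simp add: S_def)
  have bdd: "bdd_below (S f)" if f: "f \<in> V" for f
  proof (rule bdd_belowI)
    fix a assume "a \<in> S f"
    then obtain t where t: "0 \<le> t" "a = q (\<lambda>x. f x + t * w x) - t * q w" by (auto simp: S_def)
    have "q (\<lambda>x. (f x + t * w x) + - f x) \<le> q (\<lambda>x. f x + t * w x) + q (\<lambda>x. - f x)"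
      by (intro sublinear_onD(1)[OF q] function_spaceD[OF V] f w)
    then show "- q (\<lambda>x. - f x) \<le> a" using sublinear_onD(2)[OF q w t(1)] t(2) by simp
  qed
  have le: "q' f \<le> q (\<lambda>x. f x + t * w x) - t * q w" if "f \<in> V" "0 \<le> t" for f t
    unfolding q'_def using that by (intro cInf_lower bdd) (auto simp: S_def)
  have "sublinear_on V q'"
  proof (rule sublinear_onI[OF V])
    have "q (\<lambda>x. t * w x) - t * q w = 0" if "0 \<le> t" for t using sublinear_onD(2)[OF q w that] by simp
    then have "S (\<lambda>x. 0) = (\<lambda>t::real. 0) ` {0..}" unfolding S_def by (intro image_cong) simp_all
    then show "q' (\<lambda>x. 0) = 0" by (simp add: q'_def)
    show "q' (\<lambda>x. f x + g x) \<le> q' f + q' g" if fg: "f \<in> V" "g \<in> V" for f g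
      unfolding q'_def 
    proof (rule le_cInf_add[OF ne ne])
      fix a b assume "a \<in> S f" "b \<in> S g"
      then obtain t u where tu: "0 \<le> t" "a = q (\<lambda>x. f x + t * w x) - t * q w"
        "0 \<le> u" "b = q (\<lambda>x. g x + u * w x) - u * q w" by (auto simp: S_def)
      have "q' (\<lambda>x. f x + g x) \<le> q (\<lambda>x. (f x + g x) + (t + u) * w x) - (t + u) * q w"
        using tu by (intro le function_spaceD[OF V] fg) auto
      also have "(\<lambda>x. (f x + g x) + (t + u) * w x) = (\<lambda>x. (f x + t * w x) + (g x + u * w x))"
        by (simp add: algebra_simps)
      also have "q \<dots> \<le> q (\<lambda>x. f x + t * w x) + q (\<lambda>x. g x + u * w x)"
        by (intro sublinear_onD(1)[OF q] function_spaceD[OF V] fg w)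
      finally show "Inf (S (\<lambda>x. f x + g x)) \<le> a + b" using tu by (simp add: algebra_simps q'_def)
    qed
    show "q' (\<lambda>x. c * f x) \<le> c * q' f" if f: "f \<in> V" and c: "0 < c" for f c
    proof -
      have "q' (\<lambda>x. c * f x) / c \<le> a" if a: "a \<in> S f" for a
      proof -
        obtain t where t: "0 \<le> t" "a = q (\<lambda>x. f x + t * w x) - t * q w" using a by (auto simp: S_def)
        have "q' (\<lambda>x. c * f x) \<le> q (\<lambda>x. c * f x + (c * t) * w x) - (c * t) * q w"
          using c t(1) by (intro le function_spaceD[OF V] f) auto
        also have "(\<lambda>x. c * f x + (c * t) * w x) = (\<lambda>x. c * (f x + t * w x))" by (simp add: algebra_simps)
        also have "q \<dots> = c * q (\<lambda>x. f x + t * w x)"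
          using c by (intro sublinear_onD(2)[OF q] function_spaceD[OF V] f w) simp
        finally have "q' (\<lambda>x. c * f x) \<le> a * c" unfolding t(2) by (simp add: algebra_simps)
        then show ?thesis using c by (simp add: pos_divide_le_eq)
      qed
      then have "q' (\<lambda>x. c * f x) / c \<le> q' f" unfolding q'_def by (intro cInf_greatest ne)
      then show ?thesis using c by (simp add: field_simps)
    qed
  qed
  moreover have "q' f \<le> q f" if "f \<in> V" for f using le[OF that, of 0] by simp
  moreover have "q' (\<lambda>x. - w x) \<le> - q w"
    using le[OF function_spaceD(3)[OF V w], of 1] sublinear_on_0[OF q w] by simp
  ultimately show ?thesis by blast
qed

text \<open>Zorn's lemma: a chain of sublinear functionals is bounded from below by its pointwise infimum,
  which is subadditive because two members of a chain are always dominated by one of them.\<close>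

lemma minimal_sublinear:
  assumes V: "function_space V" and p: "sublinear_on V p"
  shows "\<exists>m. sublinear_on V m \<and> (\<forall>f\<in>V. m f \<le> p f) \<and>
    (\<forall>q. sublinear_on V q \<longrightarrow> (\<forall>f\<in>V. q f \<le> m f) \<longrightarrow> (\<forall>f\<in>V. q f = m f))"
proof -
  (* values outside V are normalized to 0 so that the order on functionals is antisymmetric *)
  define A where "A = {q. sublinear_on V q \<and> (\<forall>f\<in>V. q f \<le> p f) \<and> (\<forall>f. f \<notin> V \<longrightarrow> q f = 0)}"
  define P :: "(('a \<Rightarrow> real) \<Rightarrow> real) \<Rightarrow> (('a \<Rightarrow> real) \<Rightarrow> real) \<Rightarrow> bool" where "P = (\<lambda>a b. \<forall>f. b f \<le> a f)"
  define normal where "normal = (\<lambda>q f. if f \<in> V then q f else (0::real))"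
  have normal: "sublinear_on V (normal q)" if "sublinear_on V q" for q
    using that function_spaceD[OF V] by (simp add: sublinear_on_def normal_def)
  have "\<exists>m\<in>A. \<forall>a\<in>A. P m a \<longrightarrow> a = m"
  proof (rule predicate_Zorn)
    show "partial_order_on A (relation_of P A)"
      by (rule partial_order_on_relation_ofI) (auto simp: P_def fun_eq_iff intro: order_trans antisym)
    fix C assume "C \<in> Chains (relation_of P A)"
    then have CA: "C \<subseteq> A" and chain: "\<And>a b. a \<in> C \<Longrightarrow> b \<in> C \<Longrightarrow> P a b \<or> P b a"
      unfolding Chains_def relation_of_def by auto
    show "\<exists>u\<in>A. \<forall>a\<in>C. P a u"
    proof (cases "C = {}")
      case True
      have "normal p \<in> A" using normal[OF p] by (auto simp: A_def normal_def)
      then show ?thesis using True by blast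
    next
      case False
      define u where "u = normal (\<lambda>f. Inf ((\<lambda>a. a f) ` C))"
      have bdd: "bdd_below ((\<lambda>a. a f) ` C)" if f: "f \<in> V" for f
      proof (rule bdd_belowI)
        fix r assume "r \<in> (\<lambda>a. a f) ` C"
        then obtain a where a: "a \<in> A" "r = a f" using CA by blast
        then have "- a (\<lambda>x. - f x) \<le> a f" "a (\<lambda>x. - f x) \<le> p (\<lambda>x. - f x)"
          using sublinear_on_minus[OF _ V f] function_spaceD(3)[OF V f] by (auto simp: A_def)
        then show "- p (\<lambda>x. - f x) \<le> r" using a(2) by linarith
      qed
      have le: "u f \<le> a f" if "a \<in> C" for a f
        using that CA cInf_lower[OF _ bdd, of "a f" f] by (auto simp: u_def normal_def A_def)
      have sub: "sublinear_on V a" if "a \<in> C" for a using that CA by (auto simp: A_def)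
      have "sublinear_on V u"
      proof (rule sublinear_onI[OF V])
        obtain f where "f \<in> V" using V by (auto simp: function_space_def)
        then have "(\<lambda>a. a (\<lambda>x. 0)) ` C = (\<lambda>a. 0) ` C" using sublinear_on_0[OF sub] by (intro image_cong) auto
        then show "u (\<lambda>x. 0) = 0" using False function_spaceD(4)[OF V] by (simp add: u_def normal_def)
        show "u (\<lambda>x. f x + g x) \<le> u f + u g" if fg: "f \<in> V" "g \<in> V" for f g
        proof -
          have "u (\<lambda>x. f x + g x) \<le> Inf ((\<lambda>a. a f) ` C) + Inf ((\<lambda>a. a g) ` C)"
          proof (rule le_cInf_add)
            fix r s assume "r \<in> (\<lambda>a. a f) ` C" "s \<in> (\<lambda>a. a g) ` C"
            then obtain a b where ab: "a \<in> C" "b \<in> C" "r = a f" "s = b g" by blast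
            then obtain c where c: "c \<in> C" "c f \<le> a f" "c g \<le> b g"
              using chain[OF ab(1,2)] unfolding P_def by blast
            then show "u (\<lambda>x. f x + g x) \<le> r + s"
              using le[OF c(1), of "\<lambda>x. f x + g x"] sublinear_onD(1)[OF sub[OF c(1)] fg] ab(3,4) by linarith
          qed (use False in auto)
          then show ?thesis using fg by (simp add: u_def normal_def)
        qed
        show "u (\<lambda>x. c * f x) \<le> c * u f" if f: "f \<in> V" and c: "0 < c" for f c
        proof -
          have "u (\<lambda>x. c * f x) / c \<le> a f" if "a \<in> C" for a
            using le[OF that, of "\<lambda>x. c * f x"] sublinear_onD(2)[OF sub[OF that] f, of c] c by (simp add: field_simps)
          then have "u (\<lambda>x. c * f x) / c \<le> Inf ((\<lambda>a. a f) ` C)" using False by (intro cInf_greatest) auto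
          then show ?thesis using c f by (simp add: u_def normal_def field_simps)
        qed
      qed
      moreover have "u f \<le> p f" if f: "f \<in> V" for f
      proof -
        obtain a where a: "a \<in> C" using False by blast
        then have "a f \<le> p f" using CA f unfolding A_def by blast
        then show ?thesis using le[OF a, of f] by linarith
      qed
      ultimately have "u \<in> A" by (auto simp: A_def u_def normal_def)
      then show ?thesis using le by (auto simp: P_def)
    qed
  qed
  then obtain m where m: "m \<in> A" "\<And>a. a \<in> A \<Longrightarrow> P m a \<Longrightarrow> a = m" by blast
  have "q f = m f" if q: "sublinear_on V q" "\<forall>f\<in>V. q f \<le> m f" and f: "f \<in> V" for q f
  proof -
    have "normal q \<in> A" using normal[OF q(1)] q(2) m(1) by (force simp: A_def normal_def)
    moreover have "P m (normal q)" using q(2) m(1) by (auto simp: P_def normal_def A_def)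
    ultimately have "normal q = m" by (rule m(2))
    then show ?thesis using f by (metis normal_def)
  qed
  then show ?thesis using m(1) by (auto simp: A_def)
qed

text \<open>The Hahn-Banach theorem. After a first tilt, which fixes the value at \<open>w\<close>, take a minimal
  functional: it coincides with each of its tilts and is therefore linear.\<close>

theorem linear_functional_below_sublinear:
  assumes V: "function_space V" and p: "sublinear_on V p" and w: "w \<in> V"
  obtains I where "\<And>f g. f \<in> V \<Longrightarrow> g \<in> V \<Longrightarrow> I (\<lambda>x. f x + g x) = I f + I g"
    "\<And>f c. f \<in> V \<Longrightarrow> I (\<lambda>x. c * f x) = c * I f" "\<And>f. f \<in> V \<Longrightarrow> I f \<le> p f" "I w = p w"
proof -
  obtain p' where p': "sublinear_on V p'" "\<And>f. f \<in> V \<Longrightarrow> p' f \<le> p f" "p' (\<lambda>x. - w x) \<le> - p w"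
    using sublinear_tilt[OF V p w] by blast
  obtain m where m: "sublinear_on V m" "\<And>f. f \<in> V \<Longrightarrow> m f \<le> p' f"
    and min: "\<And>q f. sublinear_on V q \<Longrightarrow> (\<And>f. f \<in> V \<Longrightarrow> q f \<le> m f) \<Longrightarrow> f \<in> V \<Longrightarrow> q f = m f"
    using minimal_sublinear[OF V p'(1)] by metis
  have neg: "m (\<lambda>x. - f x) = - m f" if f: "f \<in> V" for f
  proof -
    obtain q where q: "sublinear_on V q" "\<And>g. g \<in> V \<Longrightarrow> q g \<le> m g" "q (\<lambda>x. - f x) \<le> - m f"
      using sublinear_tilt[OF V m(1) f] by blast
    have "m (\<lambda>x. - f x) \<le> - m f" using q min[OF q(1,2)] function_spaceD(3)[OF V f] by metis
    then show ?thesis using sublinear_on_minus[OF m(1) V f] by linarith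
  qed
  show thesis
  proof (rule that)
    show "m (\<lambda>x. f x + g x) = m f + m g" if "f \<in> V" "g \<in> V" for f g
      using sublinear_onD(1)[OF m(1) that] neg[OF that(2)]
        sublinear_onD(1)[OF m(1) function_spaceD(1)[OF V that] function_spaceD(3)[OF V that(2)]] by simp
    show "m (\<lambda>x. c * f x) = c * m f" if f: "f \<in> V" for f c
    proof (cases "0 \<le> c")
      case False
      have "m (\<lambda>x. - c * - f x) = - c * m (\<lambda>x. - f x)"
        using False by (intro sublinear_onD(2)[OF m(1)] function_spaceD[OF V] f) simp
      then show ?thesis using neg[OF f] by simp
    qed (rule sublinear_onD(2)[OF m(1) f])
    show "m f \<le> p f" if "f \<in> V" for f using m(2)[OF that] p'(2)[OF that] by simp
    show "m w = p w"
      using m(2)[OF w] p'(2)[OF w] m(2)[OF function_spaceD(3)[OF V w]] p'(3) neg[OF w] by linarith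
  qed
qed


section \<open>From positive functionals to measures\<close>

locale positive_functional = Metric_space M d for M :: "'x set" and d +
  fixes I :: "('x \<Rightarrow> real) \<Rightarrow> real"
  assumes compact: "compact_space mtopology"
    and I_add: "continuous_map mtopology euclideanreal f \<Longrightarrow> continuous_map mtopology euclideanreal g \<Longrightarrow>
      I (\<lambda>x. f x + g x) = I f + I g"
    and I_scale: "continuous_map mtopology euclideanreal f \<Longrightarrow> I (\<lambda>x. c * f x) = c * I f"
    and I_mono: "continuous_map mtopology euclideanreal f \<Longrightarrow> continuous_map mtopology euclideanreal g \<Longrightarrow>
      (\<And>x. x \<in> M \<Longrightarrow> f x \<le> g x) \<Longrightarrow> I f \<le> I g"
    and I_one: "I (\<lambda>x. 1) = 1"
begin

abbreviation cts :: "('x \<Rightarrow> real) \<Rightarrow> bool" where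
  "cts f \<equiv> continuous_map mtopology euclideanreal f"

abbreviation opn :: "'x set \<Rightarrow> bool" where
  "opn U \<equiv> openin mtopology U"

lemma I_const: "I (\<lambda>x. c) = c"
  using I_scale[of "\<lambda>x. 1" c] I_one by simp

lemma I_sum: "finite F \<Longrightarrow> (\<And>i. i \<in> F \<Longrightarrow> cts (f i)) \<Longrightarrow> I (\<lambda>x. \<Sum>i\<in>F. f i x) = (\<Sum>i\<in>F. I (f i))"
  by (induction F rule: finite_induct) (auto simp: I_const I_add continuous_map_sum)

lemma openin_superlevel: 
  assumes "cts f" shows "opn {x \<in> M. c < f x}" "opn {x \<in> M. f x < c}"
proof -
  have "opn {x \<in> topspace mtopology. f x \<in> {c<..}}" "opn {x \<in> topspace mtopology. f x \<in> {..<c}}"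
    using assms by (intro openin_continuous_map_preimage[where Y = euclideanreal]; simp)+
  then show "opn {x \<in> M. c < f x}" "opn {x \<in> M. f x < c}" by simp_all
qed

definition below :: "'x set \<Rightarrow> ('x \<Rightarrow> real) set" where
  "below U = {g. cts g \<and> (\<forall>x\<in>M. 0 \<le> g x \<and> g x \<le> 1) \<and> (\<forall>x\<in>M - U. g x = 0)}"

text \<open>The value of the representing measure on an open set.\<close>

definition content :: "'x set \<Rightarrow> real" where
  "content U = Sup (I ` below U)"

lemma belowD:
  assumes "g \<in> below U"
  shows "cts g" "x \<in> M \<Longrightarrow> 0 \<le> g x" "x \<in> M \<Longrightarrow> g x \<le> 1" "x \<in> M \<Longrightarrow> x \<notin> U \<Longrightarrow> g x = 0"
  using assms by (auto simp: below_def)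

lemma zero_below: "(\<lambda>x. 0) \<in> below U"
  by (simp add: below_def)

lemma I_below: "g \<in> below U \<Longrightarrow> 0 \<le> I g \<and> I g \<le> 1"
  using I_mono[of "\<lambda>x. 0" g] I_mono[of g "\<lambda>x. 1"] belowD[of g U] I_const by auto

lemma I_le_content: "g \<in> below U \<Longrightarrow> I g \<le> content U"
  unfolding content_def using I_below by (intro cSup_upper bdd_aboveI[of _ 1]) auto

lemma content_le: "(\<And>g. g \<in> below U \<Longrightarrow> I g \<le> c) \<Longrightarrow> content U \<le> c"
  unfolding content_def using zero_below by (intro cSup_least) auto

lemma content_nonneg: "0 \<le> content U"
  using I_le_content[OF zero_below] I_const by simp

lemma content_le_1: "content U \<le> 1"
  using I_below by (intro content_le) auto

lemma content_mono: "U \<subseteq> V \<Longrightarrow> content U \<le> content V"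
  by (intro content_le I_le_content) (auto simp: below_def)

lemma content_space: "content M = 1"
proof -
  have "(\<lambda>x. 1) \<in> below M" by (simp add: below_def)
  then show ?thesis using I_le_content[of "\<lambda>x. 1" M] content_le_1[of M] by (simp add: I_one)
qed

text \<open>The distance to the complement.\<close>

lemma exists_cozero:
  assumes U: "opn U"
  shows "\<exists>h. cts h \<and> (\<forall>x\<in>M. 0 \<le> h x) \<and> (\<forall>x\<in>M. 0 < h x \<longleftrightarrow> x \<in> U)"
proof (cases "M - U = {}")
  case True
  then show ?thesis by (intro exI[of _ "\<lambda>x. 1"]) auto
next
  case False
  define h where "h = (\<lambda>x. INF y\<in>M - U. d x y)"
  have bdd: "bdd_below (d x ` (M - U))" for x by (intro bdd_belowI[of _ 0]) auto
  have lip: "h x \<le> d x y + h y" if "x \<in> M" "y \<in> M" for x y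
  proof -
    have "h x - d x y \<le> d y z" if z: "z \<in> M - U" for z
      using cINF_lower[OF bdd z, of x] triangle[of x y z] that \<open>x \<in> M\<close> \<open>y \<in> M\<close> by (simp add: h_def)
    then have "h x - d x y \<le> h y" unfolding h_def by (intro cINF_greatest False)
    then show ?thesis by simp
  qed
  have "cts h"
    unfolding mtopology_is_euclidean[symmetric]
  proof (subst metric_continuous_map)
    show "Metric_space UNIV (dist :: real \<Rightarrow> real \<Rightarrow> real)" by (rule Met_TC.Metric_space_axioms)
    show "h ` M \<subseteq> UNIV \<and> (\<forall>a\<in>M. \<forall>e>0. \<exists>\<delta>>0. \<forall>x. x \<in> M \<and> d a x < \<delta> \<longrightarrow> dist (h a) (h x) < e)"
    proof (intro conjI ballI allI impI)
      fix a and e :: real assume a: "a \<in> M" "0 < e"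
      have "dist (h a) (h x) < e" if "x \<in> M" "d a x < e" for x
        using lip[OF a(1) that(1)] lip[OF that(1) a(1)] that commute[of a x] by (simp add: dist_real_def)
      then show "\<exists>\<delta>>0. \<forall>x. x \<in> M \<and> d a x < \<delta> \<longrightarrow> dist (h a) (h x) < e" using a(2) by blast
    qed simp
  qed
  moreover have "0 \<le> h x" for x unfolding h_def by (intro cINF_greatest False) simp
  moreover have "0 < h x" if x: "x \<in> U" for x
  proof -
    obtain r where r: "0 < r" "mball x r \<subseteq> U" using U x by (auto simp: openin_mtopology)
    have "x \<in> M" using U x by (auto simp: openin_mtopology)
    have "r \<le> h x" unfolding h_def
      using r(2) \<open>x \<in> M\<close> by (intro cINF_greatest False) (auto simp: subset_iff not_less[symmetric])
    then show ?thesis using r(1) by simp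
  qed
  moreover have "h x \<le> 0" if "x \<in> M" "x \<notin> U" for x
    using cINF_lower[OF bdd, of x x] that by (simp add: h_def)
  ultimately show ?thesis by (intro exI[of _ h]) force
qed

text \<open>By compactness finitely many of the sets suffice to cover the set where \<open>g\<close> is at least
  \<open>e\<close>, even after shrinking each to a superlevel set of its cozero function.\<close>

lemma content_UN_le:
  fixes U :: "nat \<Rightarrow> 'x set"
  assumes U: "\<And>n. opn (U n)" and g: "g \<in> below (\<Union>n. U n)" and e: "0 < e"
  shows "\<exists>N. I g \<le> e + (\<Sum>n<N. content (U n))"
proof -
  obtain h where h: "\<And>n. cts (h n)" "\<And>n x. x \<in> M \<Longrightarrow> 0 \<le> h n x" "\<And>n x. x \<in> M \<Longrightarrow> 0 < h n x \<longleftrightarrow> x \<in> U n"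
    using exists_cozero[OF U] by metis
  define \<phi> where "\<phi> = (\<lambda>N n x. min 1 (real N * h n x))"
  have \<phi>c: "cts (\<phi> N n)" for N n unfolding \<phi>_def
    by (intro continuous_map_real_min continuous_map_real_mult_left h continuous_map_const[THEN iffD2]) simp
  have \<phi>: "\<phi> N n \<in> below (U n)" for N n
  proof -
    have "h n x = 0" if "x \<in> M" "x \<notin> U n" for x using h(2,3)[OF that(1), of n] that(2) by linarith
    then show ?thesis using \<phi>c h(2) by (simp add: below_def) (simp add: \<phi>_def)
  qed
  define B where "B = (\<lambda>N. {x \<in> M. g x < e} \<union> (\<Union>n<N. {x \<in> M. 1 / real N < h n x}))"
  have Bo: "opn (B N)" for N
    unfolding B_def using openin_superlevel h(1) belowD(1)[OF g] by (intro openin_Un openin_Union) auto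
  have Bmono: "B N \<subseteq> B N'" if "N \<le> N'" for N N'
  proof (cases "N = 0")
    case False
    then have "1 / real N' \<le> 1 / real N" using that by (simp add: frac_le)
    then show ?thesis using that unfolding B_def by auto (meson lessThan_iff le_less_trans less_le_trans)
  qed (auto simp: B_def)
  have "M \<subseteq> \<Union>(range B)"
  proof
    fix x assume x: "x \<in> M"
    show "x \<in> \<Union>(range B)"
    proof (cases "g x < e")
      case False
      then have "x \<in> (\<Union>n. U n)" using belowD(4)[OF g x] e by force
      then obtain n where n: "0 < h n x" using h(3)[OF x] by blast
      then obtain N where "1 / h n x < real N" using reals_Archimedean2 by blast
      then have "1 / h n x < real (max N (Suc n))" by simp
      then have "1 / real (max N (Suc n)) < h n x"
        using n by (simp add: field_simps)
      then have "x \<in> B (max N (Suc n))" using x by (auto simp: B_def)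
      then show ?thesis by blast
    qed (use x in \<open>auto simp: B_def\<close>)
  qed
  then have "\<exists>\<F>. finite \<F> \<and> \<F> \<subseteq> range B \<and> topspace mtopology \<subseteq> \<Union>\<F>"
    using Bo by (intro compact[unfolded compact_space_alt, rule_format]) auto
  then obtain \<F> where F: "finite \<F>" "\<F> \<subseteq> range B" "M \<subseteq> \<Union>\<F>" by auto
  then obtain K where K: "finite K" "\<F> = B ` K" by (meson finite_subset_image)
  define N where "N = Max (insert 1 K)"
  have cover: "x \<in> B N" if "x \<in> M" for x
  proof -
    obtain n where n: "n \<in> K" "x \<in> B n" using F(3) K(2) \<open>x \<in> M\<close> by blast
    then have "n \<le> N" using K(1) by (simp add: N_def)
    then show ?thesis using Bmono n(2) by blast
  qed
  have "1 \<le> N" using K(1) by (simp add: N_def)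
  have le: "g x \<le> e + (\<Sum>n<N. \<phi> N n x)" if x: "x \<in> M" for x
  proof -
    have nn: "0 \<le> (\<Sum>n<N. \<phi> N n x)" using belowD(2)[OF \<phi> x] by (intro sum_nonneg)
    show ?thesis
    proof (cases "g x < e")
      case False
      then obtain n where n: "n < N" "1 / real N < h n x" using cover[OF x] by (auto simp: B_def)
      then have "\<phi> N n x = 1" using \<open>1 \<le> N\<close> by (simp add: \<phi>_def field_simps)
      moreover have "\<phi> N n x \<le> (\<Sum>n<N. \<phi> N n x)"
        using n(1) belowD(2)[OF \<phi> x] by (intro member_le_sum) auto
      ultimately show ?thesis using belowD(3)[OF g x] e by linarith
    qed (use nn in linarith)
  qed
  have "I g \<le> I (\<lambda>x. e + (\<Sum>n<N. \<phi> N n x))"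
    by (intro I_mono belowD(1)[OF g] continuous_map_add continuous_map_sum \<phi>c le) auto
  also have "\<dots> = e + (\<Sum>n<N. I (\<phi> N n))"
    using \<phi>c by (subst I_add) (auto simp: I_const I_sum intro!: continuous_map_sum)
  also have "\<dots> \<le> e + (\<Sum>n<N. content (U n))" by (intro add_left_mono sum_mono I_le_content \<phi>)
  finally show ?thesis by blast
qed

definition outer :: "'x set \<Rightarrow> ennreal" where
  "outer E = (INF U\<in>{U. opn U \<and> E \<subseteq> U}. ennreal (content U))"

lemma outer_le: "opn U \<Longrightarrow> E \<subseteq> U \<Longrightarrow> outer E \<le> ennreal (content U)"
  unfolding outer_def by (rule INF_lower) simp

lemma outer_open: "opn U \<Longrightarrow> outer U = ennreal (content U)"
  unfolding outer_def by (intro antisym INF_lower INF_greatest) (auto intro!: ennreal_leI content_mono)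

lemma outer_mono: "E \<subseteq> E' \<Longrightarrow> outer E \<le> outer E'"
  unfolding outer_def by (rule INF_superset_mono) auto

lemma content_countably_subadditive:
  assumes U: "\<And>n::nat. opn (U n)"
  shows "ennreal (content (\<Union>n. U n)) \<le> (\<Sum>n. ennreal (content (U n)))"
proof (cases "(\<Sum>n. ennreal (content (U n)))" rule: ennreal_cases)
  case (real s)
  have "content (\<Union>n. U n) \<le> s"
  proof (rule content_le)
    fix g assume g: "g \<in> below (\<Union>n. U n)"
    show "I g \<le> s"
    proof (rule field_le_epsilon)
      fix e :: real assume "0 < e"
      then obtain N where N: "I g \<le> e + (\<Sum>n<N. content (U n))" using content_UN_le[OF U g] by blast
      have "ennreal (\<Sum>n<N. content (U n)) = (\<Sum>n<N. ennreal (content (U n)))"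
        by (simp add: sum_ennreal content_nonneg)
      also have "\<dots> \<le> ennreal s" unfolding real(2)[symmetric] by (intro sum_le_suminf) auto
      finally show "I g \<le> s + e" using N real(1) by (simp add: ennreal_le_iff)
    qed
  qed
  then show ?thesis by (simp add: real ennreal_leI)
qed simp

lemma outer_countably_subadditive: "outer (\<Union>n::nat. A n) \<le> (\<Sum>n. outer (A n))"
proof (rule ennreal_le_epsilon)
  fix e :: real assume e: "0 < e" and fin: "(\<Sum>n. outer (A n)) < top"
  have "\<exists>U. opn U \<and> A n \<subseteq> U \<and> ennreal (content U) \<le> outer (A n) + ennreal (e * (1/2) ^ Suc n)" for n
  proof -
    have "outer (A n) < outer (A n) + ennreal (e * (1/2) ^ Suc n)"
      using fin e by (auto simp add: less_top dest!: ennreal_suminf_lessD)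
    then obtain U where "opn U" "A n \<subseteq> U" "ennreal (content U) < outer (A n) + ennreal (e * (1/2) ^ Suc n)"
      unfolding outer_def[of "A n"] INF_less_iff by blast
    then show ?thesis by (auto intro: less_imp_le)
  qed
  then obtain U where U: "\<And>n. opn (U n)" "\<And>n. A n \<subseteq> U n"
    "\<And>n. ennreal (content (U n)) \<le> outer (A n) + ennreal (e * (1/2) ^ Suc n)" by metis
  have "outer (\<Union>n. A n) \<le> ennreal (content (\<Union>n. U n))"
    using U(1,2) by (intro outer_le openin_Union) auto
  also have "\<dots> \<le> (\<Sum>n. ennreal (content (U n)))" by (rule content_countably_subadditive[OF U(1)])
  also have "\<dots> \<le> (\<Sum>n. outer (A n) + ennreal (e * (1/2) ^ Suc n))"
    by (intro suminf_le U(3)) auto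
  also have "\<dots> = (\<Sum>n. outer (A n)) + (\<Sum>n. ennreal e * ennreal ((1/2) ^ Suc n))"
    using e by (subst suminf_add[symmetric]) (auto simp del: ennreal_suminf_cmult simp add: ennreal_mult[symmetric])
  also have "\<dots> = (\<Sum>n. outer (A n)) + ennreal e"
    unfolding ennreal_suminf_cmult by (subst suminf_ennreal_eq[OF zero_le_power power_half_series]) auto
  finally show "outer (\<Union>n. A n) \<le> (\<Sum>n. outer (A n)) + ennreal e" .
qed

text \<open>If \<open>g\<close> nearly exhausts the content of $Q\cap U$, then a function carried by the part of
  \<open>Q\<close> where \<open>g\<close> is small can be added to $(g-\varepsilon)^+$ without exceeding \<open>1\<close> anywhere.\<close>

lemma content_split:
  assumes U: "opn U" and Q: "opn Q"
  shows "ennreal (content (Q \<inter> U)) + outer (Q - U) \<le> ennreal (content Q)"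
proof (cases "outer (Q - U)" rule: ennreal_cases)
  case (real s)
  have "content (Q \<inter> U) \<le> content Q - s"
  proof (rule content_le)
    fix g assume g: "g \<in> below (Q \<inter> U)"
    show "I g \<le> content Q - s"
    proof (rule field_le_epsilon)
      fix e :: real assume e: "0 < e"
      define Q' where "Q' = Q \<inter> {x \<in> M. g x < e}"
      have QM: "Q \<subseteq> M" using openin_subset[OF Q] by simp
      have "opn Q'" unfolding Q'_def using Q openin_superlevel(2)[OF belowD(1)[OF g]] by (rule openin_Int)
      moreover have "Q - U \<subseteq> Q'" using belowD(4)[OF g] e QM by (auto simp: Q'_def)
      ultimately have "ennreal s \<le> ennreal (content Q')" using outer_le real(2) by metis
      then have "s \<le> content Q'" using content_nonneg by (simp add: ennreal_le_iff)
      have "content Q' \<le> content Q + e - I g"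
      proof (rule content_le)
        fix g' assume g': "g' \<in> below Q'"
        have c: "cts (\<lambda>x. max 0 (g x + - e))" "cts g'" "cts g"
          using belowD(1)[OF g] belowD(1)[OF g'] by (auto intro!: continuous_map_real_max continuous_map_diff)
        have "(\<lambda>x. max 0 (g x + - e) + g' x) \<in> below Q"
          unfolding below_def
        proof (intro CollectI conjI ballI)
          fix x assume x: "x \<in> M"
          show "max 0 (g x + - e) + g' x \<le> 1"
          proof (cases "g x < e")
            case False
            then have "g' x = 0" using belowD(4)[OF g' x] by (auto simp: Q'_def)
            then show ?thesis using belowD(3)[OF g x] e by simp
          qed (use belowD(3)[OF g' x] in simp)
        next
          fix x assume "x \<in> M - Q"
          then show "max 0 (g x + - e) + g' x = 0"
            using belowD(4)[OF g, of x] belowD(4)[OF g', of x] e by (auto simp: Q'_def)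
        qed (use c belowD(2)[OF g'] in \<open>auto intro!: continuous_map_add\<close>)
        then have "I (\<lambda>x. max 0 (g x + - e) + g' x) \<le> content Q" by (rule I_le_content)
        moreover have "I (\<lambda>x. g x + - e) \<le> I (\<lambda>x. max 0 (g x + - e))"
          using c by (intro I_mono continuous_map_add) auto
        moreover have "I (\<lambda>x. g x + - e) = I g + - e" using c by (subst I_add) (auto simp: I_const)
        ultimately show "I g' \<le> content Q + e - I g" using I_add[OF c(1,2)] by linarith
      qed
      then show "I g \<le> content Q - s + e" using \<open>s \<le> content Q'\<close> by linarith
    qed
  qed
  then have "ennreal (content (Q \<inter> U) + s) \<le> ennreal (content Q)" by (intro ennreal_leI) simp
  then show ?thesis using real content_nonneg by (simp add: ennreal_plus)
next
  case top
  have "outer (Q - U) \<le> ennreal (content Q)" using Q by (intro outer_le) auto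
  then show ?thesis using top by (simp add: top_unique)
qed

definition functional_measure :: "'x measure" where
  "functional_measure = measure_of M (sigma_sets M {U. opn U}) outer"

text \<open>Caratheodory's construction: open sets are measurable for the outer measure by
  \<open>content_split\<close>.\<close>

lemma functional_measure:
  "space functional_measure = M" "sets functional_measure = sigma_sets M {U. opn U}"
  "E \<in> sigma_sets M {U. opn U} \<Longrightarrow> emeasure functional_measure E = outer E"
proof -
  have sub: "{U. opn U} \<subseteq> Pow M" using openin_subset by fastforce
  then have sub': "sigma_sets M {U. opn U} \<subseteq> Pow M" using sigma_sets_into_sp[OF sub] by blast
  have out0: "outer {} = 0"
  proof -
    have "content {} \<le> 0" using I_mono[of _ "\<lambda>x. 0"] belowD I_const by (intro content_le) fastforce
    then show ?thesis using outer_open[of "{}"] content_nonneg[of "{}"] by simp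
  qed
  have oms: "outer_measure_space (Pow M) outer"
    unfolding outer_measure_space_def positive_def increasing_def countably_subadditive_def
    using out0 outer_mono outer_countably_subadditive by auto
  define S where "S = lambda_system M (Pow M) outer"
  have ms: "measure_space M S outer"
    unfolding S_def by (rule sigma_algebra.caratheodory_lemma[OF sigma_algebra_Pow oms])
  have "U \<in> S" if U: "opn U" for U
    unfolding S_def lambda_system_def
  proof (intro CollectI conjI ballI)
    show "U \<in> Pow M" using sub U by blast
    fix E assume E: "E \<in> Pow M"
    have "outer (E \<inter> U) + outer (E - U) \<le> outer E"
      unfolding outer_def[of E]
    proof (rule INF_greatest)
      fix Q assume "Q \<in> {Q. opn Q \<and> E \<subseteq> Q}"
      then have Q: "opn Q" "E \<subseteq> Q" by auto
      have "outer (E \<inter> U) + outer (E - U) \<le> ennreal (content (Q \<inter> U)) + outer (Q - U)"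
        using Q U by (intro add_mono outer_le outer_mono openin_Int) auto
      then show "outer (E \<inter> U) + outer (E - U) \<le> ennreal (content Q)"
        using content_split[OF U Q(1)] by (rule order_trans)
    qed
    moreover have "outer E \<le> outer (E \<inter> U) + outer (E - U)"
      using ring_of_sets.countably_subadditive_subadditive[OF ring_of_sets_Pow, of M outer] oms
        subadditiveD[of "Pow M" outer "E \<inter> U" "E - U"] E unfolding outer_measure_space_def
      by (auto simp: Int_Diff_Un Int_Diff_disjoint)
    moreover have "U \<inter> E = E \<inter> U" "(M - U) \<inter> E = E - U" using E by auto
    ultimately show "outer (U \<inter> E) + outer ((M - U) \<inter> E) = outer E" by (metis antisym)
  qed
  then have "sigma_sets M {U. opn U} \<subseteq> S"
    using ms by (intro sigma_algebra.sigma_sets_subset) (auto simp: measure_space_def)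
  then have "measure_space M (sigma_sets M {U. opn U}) outer"
    by (rule measure_down[OF ms sigma_algebra_sigma_sets[OF sub]])
  then show "E \<in> sigma_sets M {U. opn U} \<Longrightarrow> emeasure functional_measure E = outer E"
    unfolding functional_measure_def measure_space_def
    by (intro emeasure_measure_of_sigma) auto
  show "space functional_measure = M" "sets functional_measure = sigma_sets M {U. opn U}"
    unfolding functional_measure_def using sub'
    by (simp_all add: sigma_sets_sigma_sets_eq[OF sub])
qed

lemma outer_image:
  assumes t: "continuous_map mtopology mtopology t" "continuous_map mtopology mtopology t'"
    and inv: "\<And>x. x \<in> M \<Longrightarrow> t' (t x) = x" "\<And>x. x \<in> M \<Longrightarrow> t (t' x) = x"
    and I: "\<And>g. cts g \<Longrightarrow> I (\<lambda>x. g (t x)) = I g" "\<And>g. cts g \<Longrightarrow> I (\<lambda>x. g (t' x)) = I g"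
    and E: "E \<subseteq> M"
  shows "outer (t ` E) = outer E"
proof -
  have *: "outer (t ` E) \<le> outer E"
    if t: "continuous_map mtopology mtopology t" "continuous_map mtopology mtopology t'"
    and inv: "\<And>x. x \<in> M \<Longrightarrow> t' (t x) = x" "\<And>x. x \<in> M \<Longrightarrow> t (t' x) = x"
    and I: "\<And>g. cts g \<Longrightarrow> I (\<lambda>x. g (t x)) = I g"
    and E: "E \<subseteq> M" for t t' E
    unfolding outer_def[of E]
  proof (rule INF_greatest)
    fix U assume "U \<in> {U. opn U \<and> E \<subseteq> U}"
    then have U: "opn U" "E \<subseteq> U" by auto
    define V where "V = {x \<in> M. t' x \<in> U}"
    have "opn V" unfolding V_def using openin_continuous_map_preimage[OF t(2) U(1)] by simp
    have tM: "t x \<in> M" if "x \<in> M" for x using t(1) that by (auto simp: continuous_map_def)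
    have "t ` E \<subseteq> V" using U(2) E tM inv(1) unfolding V_def by (auto simp: subset_iff)
    have "content V \<le> content U"
    proof (rule content_le)
      fix g assume g: "g \<in> below V"
      have "(\<lambda>x. g (t x)) \<in> below U"
        unfolding below_def using belowD[OF g] tM inv(1) continuous_map_compose[OF t(1) belowD(1)[OF g]]
        by (auto simp: V_def comp_def)
      then show "I g \<le> content U" using I_le_content I[OF belowD(1)[OF g]] by metis
    qed
    then show "outer (t ` E) \<le> ennreal (content U)"
      using outer_le[OF \<open>opn V\<close> \<open>t ` E \<subseteq> V\<close>] by (meson ennreal_leI order_trans)
  qed
  have tE: "t ` E \<subseteq> M" using t(1) E by (auto simp: continuous_map_def)
  have "t' ` t ` E = E" using inv(1) E by (force simp: image_image)
  then show ?thesis using *[OF t inv I(1) E] *[OF t(2,1) inv(2,1) I(2) tE] by simp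
qed

text \<open>The slices $\min(f,(k+1)/N)-\min(f,k/N)$ show that the functional is determined by its
  content.\<close>

lemma slice_bounds:
  assumes f: "cts f" "\<And>x. x \<in> M \<Longrightarrow> 0 \<le> f x" "\<And>x. x \<in> M \<Longrightarrow> f x \<le> 1" and N: "0 < N"
  shows "(\<Sum>k<N. content {x \<in> M. real (Suc k) / real N < f x}) \<le> real N * I f"
    "real N * I f \<le> (\<Sum>k<N. content {x \<in> M. real k / real N < f x})"
proof -
  define s where "s = (\<lambda>k x. real N * min (f x) (real (Suc k) / real N) + - (real N * min (f x) (real k / real N)))"
  have sc: "cts (s k)" for k unfolding s_def
    by (intro continuous_map_add continuous_map_minus continuous_map_real_mult_left continuous_map_real_min f(1)) auto
  have step: "real (Suc k) / real N = real k / real N + 1 / real N" for k by (simp add: add_divide_distrib)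
  have "(\<Sum>k<N. s k x) = real N * f x" if "x \<in> M" for x
  proof -
    have "(\<Sum>k<N. s k x) = real N * min (f x) (real N / real N) - real N * min (f x) (real 0 / real N)"
      unfolding s_def using sum_lessThan_telescope[of "\<lambda>k. real N * min (f x) (real k / real N)" N] by simp
    then show ?thesis using f(2,3)[OF that] N by simp
  qed
  then have "I (\<lambda>x. real N * f x) = I (\<lambda>x. \<Sum>k<N. s k x)"
    using f(1) sc by (intro antisym I_mono continuous_map_real_mult_left continuous_map_sum) auto
  then have eq: "real N * I f = (\<Sum>k<N. I (s k))" using I_scale[OF f(1)] I_sum[OF finite_lessThan sc] by simp
  have s1: "s k x = 1" if "real (Suc k) / real N < f x" for k x
    using that N step[of k] by (simp add: s_def min_def field_simps)
  have s01: "0 \<le> s k x" "s k x \<le> 1" for k x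
  proof -
    have "min (f x) (real k / real N) \<le> min (f x) (real (Suc k) / real N)"
      "min (f x) (real (Suc k) / real N) \<le> min (f x) (real k / real N) + 1 / real N"
      using N divide_pos_pos[of 1 "real N"] unfolding step by linarith+
    then have "real N * min (f x) (real k / real N) \<le> real N * min (f x) (real (Suc k) / real N)"
      "real N * min (f x) (real (Suc k) / real N) \<le> real N * (min (f x) (real k / real N) + 1 / real N)"
      by (intro mult_left_mono; simp)+
    then show "0 \<le> s k x" "s k x \<le> 1" using N by (simp_all add: s_def distrib_left)
  qed
  have s0: "s k x = 0" if "\<not> real k / real N < f x" for k x
  proof -
    have "real k / real N \<le> real (Suc k) / real N" by (intro divide_right_mono) auto
    then show ?thesis using that by (simp add: s_def min_def)
  qed
  have "content {x \<in> M. real (Suc k) / real N < f x} \<le> I (s k)" for k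
  proof (rule content_le)
    fix g assume g: "g \<in> below {x \<in> M. real (Suc k) / real N < f x}"
    have "g x \<le> s k x" if x: "x \<in> M" for x
      using s1[of k x] s01(1)[of k x] belowD(3,4)[OF g x] x by (cases "real (Suc k) / real N < f x") auto
    then show "I g \<le> I (s k)" by (intro I_mono belowD(1)[OF g] sc)
  qed
  then show "(\<Sum>k<N. content {x \<in> M. real (Suc k) / real N < f x}) \<le> real N * I f"
    unfolding eq by (intro sum_mono)
  have "s k \<in> below {x \<in> M. real k / real N < f x}" for k using sc s01 s0 by (auto simp: below_def)
  then show "real N * I f \<le> (\<Sum>k<N. content {x \<in> M. real k / real N < f x})"
    unfolding eq by (intro sum_mono I_le_content)
qed

end

lemma functional_le_if_content_eq:
  assumes I: "positive_functional M d I" and J: "positive_functional M d J"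
    and eq: "\<And>U. openin (Metric_space.mtopology M d) U \<Longrightarrow>
      positive_functional.content M d I U = positive_functional.content M d J U"
    and f: "continuous_map (Metric_space.mtopology M d) euclideanreal f" "\<And>x. x \<in> M \<Longrightarrow> 0 \<le> f x" "\<And>x. x \<in> M \<Longrightarrow> f x \<le> 1"
  shows "I f \<le> J f"
proof (rule field_le_epsilon)
  interpret I: positive_functional M d I by fact
  interpret J: positive_functional M d J by fact
  fix e :: real assume "0 < e"
  obtain N :: nat where N: "1 / e < real N" using reals_Archimedean2 by blast
  then have "0 < N" using \<open>0 < e\<close> by (cases N) (auto simp: field_simps)
  let ?c = "\<lambda>k. I.content {x \<in> M. real k / real N < f x}"
  have c: "?c k = J.content {x \<in> M. real k / real N < f x}" for k by (intro eq I.openin_superlevel f)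
  have "real N * I f \<le> (\<Sum>k<N. ?c k)" by (intro I.slice_bounds f \<open>0 < N\<close>)
  also have "\<dots> \<le> (\<Sum>k<Suc N. ?c k)" using I.content_nonneg by simp
  also have "\<dots> = ?c 0 + (\<Sum>k<N. ?c (Suc k))" by (rule sum.lessThan_Suc_shift)
  also have "\<dots> \<le> 1 + real N * J f"
    using J.slice_bounds(1)[OF f \<open>0 < N\<close>] J.content_le_1 unfolding c by (intro add_mono) auto
  finally have "I f \<le> J f + 1 / real N" using \<open>0 < N\<close> by (simp add: field_simps)
  moreover have "1 / real N \<le> e" using N \<open>0 < e\<close> \<open>0 < N\<close> by (simp add: field_simps)
  ultimately show "I f \<le> J f + e" by linarith
qed

lemma functional_eq_if_content_eq:
  assumes I: "positive_functional M d I" and J: "positive_functional M d J"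
    and eq: "\<And>U. openin (Metric_space.mtopology M d) U \<Longrightarrow>
      positive_functional.content M d I U = positive_functional.content M d J U"
    and f: "continuous_map (Metric_space.mtopology M d) euclideanreal f" "\<And>x. x \<in> M \<Longrightarrow> \<bar>f x\<bar> \<le> B"
  shows "I f = J f"
proof -
  interpret I: positive_functional M d I by fact
  interpret J: positive_functional M d J by fact
  define b where "b = \<bar>B\<bar> + 1"
  have b: "0 < b" "\<And>x. x \<in> M \<Longrightarrow> \<bar>f x\<bar> \<le> b" using f(2) by (force simp: b_def)+
  define g where "g = (\<lambda>x. (1 / (2 * b)) * f x + 1 / 2)"
  have g: "I.cts g" unfolding g_def by (intro continuous_map_add continuous_map_real_mult_left f) auto
  have g01: "0 \<le> g x" "g x \<le> 1" if "x \<in> M" for x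
    using b(2)[OF that] b(1) by (auto simp: g_def field_simps abs_le_iff)
  have "I g = J g"
    using functional_le_if_content_eq[OF I J eq g g01] functional_le_if_content_eq[OF J I eq[symmetric] g g01] by simp
  moreover have K: "K g = (1 / (2 * b)) * K f + 1 / 2" if "positive_functional M d K" for K
  proof -
    interpret K: positive_functional M d K by fact
    have "K g = K (\<lambda>x. (1 / (2 * b)) * f x) + K (\<lambda>x. 1 / 2)"
      unfolding g_def by (intro K.I_add continuous_map_real_mult_left f(1)) simp
    then show ?thesis unfolding K.I_const K.I_scale[OF f(1)] .
  qed
  ultimately show ?thesis using K[OF I] K[OF J] b(1) by simp
qed


section \<open>Uniform averages in uniquely ergodic spaces\<close>

definition average :: "'a::euclidean_space list \<Rightarrow> (('a, 'l) pattern \<Rightarrow> real) \<Rightarrow> ('a, 'l) pattern \<Rightarrow> real" where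
  "average ys W T = (\<Sum>y\<leftarrow>ys. W (pattern_minus T y)) / real (length ys)"

text \<open>All pairwise sums, with multiplicity: averaging over them is averaging twice.\<close>

definition list_sums :: "'a::plus list \<Rightarrow> 'a list \<Rightarrow> 'a list" where
  "list_sums zs ys = concat (map (\<lambda>z. map (\<lambda>y. z + y) ys) zs)"

lemma length_list_sums: "length (list_sums zs ys) = length zs * length ys"
  by (induction zs) (auto simp: list_sums_def)

lemma list_sums_nonempty: "zs \<noteq> [] \<Longrightarrow> ys \<noteq> [] \<Longrightarrow> list_sums zs ys \<noteq> []"
  by (cases zs) (auto simp: list_sums_def)

lemma sum_list_sums: "(\<Sum>y\<leftarrow>list_sums zs ys. g y) = (\<Sum>z\<leftarrow>zs. \<Sum>y\<leftarrow>ys. g (z + y))"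
  by (induction zs) (auto simp: list_sums_def comp_def)

lemma average_list_sums: "average (list_sums zs ys) W T = average zs (average ys W) T"
proof -
  have "(\<Sum>y\<leftarrow>list_sums zs ys. W (pattern_minus T y)) = (\<Sum>z\<leftarrow>zs. \<Sum>y\<leftarrow>ys. W (pattern_minus (pattern_minus T z) y))"
    by (simp add: sum_list_sums pattern_minus_minus)
  moreover have "(\<Sum>z\<leftarrow>zs. F z / real (length ys)) = (\<Sum>z\<leftarrow>zs. F z) / real (length ys)" for F :: "'a \<Rightarrow> real"
    by (induction zs) (auto simp: add_divide_distrib)
  ultimately show ?thesis by (simp add: average_def length_list_sums mult.commute)
qed

lemma average_list_sums_commute: "average (list_sums zs ys) W T = average ys (average zs W) T"
proof -
  have "(\<Sum>z\<leftarrow>zs. \<Sum>y\<leftarrow>ys. F z y) = (\<Sum>y\<leftarrow>ys. \<Sum>z\<leftarrow>zs. F z y)" for F :: "'a \<Rightarrow> 'a \<Rightarrow> real"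
    by (induction zs) (auto simp: sum_list_addf)
  then have "(\<Sum>y\<leftarrow>list_sums zs ys. W (pattern_minus T y)) = (\<Sum>y\<leftarrow>list_sums ys zs. W (pattern_minus T y))"
    by (simp add: sum_list_sums add.commute)
  then show ?thesis
    unfolding average_list_sums[of ys zs W T, symmetric] by (simp add: average_def length_list_sums mult.commute)
qed

lemma average_add: "average ys (\<lambda>T. V T + W T) T = average ys V T + average ys W T"
  by (simp add: average_def sum_list_addf add_divide_distrib)

lemma average_scale: "average ys (\<lambda>T. c * W T) T = c * average ys W T"
  by (simp add: average_def sum_list_const_mult)

lemma average_le:
  assumes "ys \<noteq> []" "\<And>y. y \<in> set ys \<Longrightarrow> W (pattern_minus T y) \<le> c"
  shows "average ys W T \<le> c"
proof -
  have "(\<Sum>y\<leftarrow>ys. W (pattern_minus T y)) \<le> (\<Sum>y\<leftarrow>ys. c)" using assms(2) by (intro sum_list_mono)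
  then show ?thesis using assms(1) by (simp add: average_def sum_list_triv divide_le_eq mult.commute)
qed

lemma average_ge:
  assumes "ys \<noteq> []" "\<And>y. y \<in> set ys \<Longrightarrow> c \<le> W (pattern_minus T y)"
  shows "c \<le> average ys W T"
  using average_le[OF assms(1), of "\<lambda>T. -1 * W T" T "- c"] assms(2) unfolding average_scale by simp

context flc_space
begin

abbreviation bounded_functions :: "(('a, 'l) pattern \<Rightarrow> real) set" where
  "bounded_functions \<equiv> {W. \<exists>B. \<forall>T\<in>X. \<bar>W T\<bar> \<le> B}"

lemma function_space_bounded: "function_space bounded_functions"
proof -
  have "\<exists>B. \<forall>T\<in>X. \<bar>f T + g T\<bar> \<le> B" if "\<forall>T\<in>X. \<bar>f T\<bar> \<le> B" "\<forall>T\<in>X. \<bar>g T\<bar> \<le> B'" for f g :: "('a, 'l) pattern \<Rightarrow> real" and B B'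
  proof (intro exI[of _ "B + B'"] ballI)
    fix T assume "T \<in> X"
    then have "\<bar>f T\<bar> \<le> B" "\<bar>g T\<bar> \<le> B'" using that by auto
    then show "\<bar>f T + g T\<bar> \<le> B + B'" by linarith
  qed
  moreover have "\<exists>B. \<forall>T\<in>X. \<bar>c * f T\<bar> \<le> B" if "\<forall>T\<in>X. \<bar>f T\<bar> \<le> B" for f :: "('a, 'l) pattern \<Rightarrow> real" and B c
    using that by (intro exI[of _ "\<bar>c\<bar> * B"]) (auto simp: abs_mult intro: mult_left_mono)
  ultimately show ?thesis unfolding function_space_def by (auto intro: exI[of _ "\<lambda>_. 0"])
qed

text \<open>The least constant that averages of \<open>W\<close> over translates can be made to stay below, up to
  an arbitrarily small error.\<close>

definition upper_mean :: "(('a, 'l) pattern \<Rightarrow> real) \<Rightarrow> real" where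
  "upper_mean W = Inf {c. \<exists>ys. ys \<noteq> [] \<and> (\<forall>T\<in>X. average ys W T \<le> c)}"

lemma upper_mean_bounds:
  assumes "X \<noteq> {}" "\<And>T. T \<in> X \<Longrightarrow> b \<le> W T" 
  shows "ys \<noteq> [] \<Longrightarrow> (\<And>T. T \<in> X \<Longrightarrow> average ys W T \<le> c) \<Longrightarrow> upper_mean W \<le> c"
    "(\<And>T. T \<in> X \<Longrightarrow> W T \<le> B) \<Longrightarrow> upper_mean W < c \<Longrightarrow> \<exists>ys. ys \<noteq> [] \<and> (\<forall>T\<in>X. average ys W T \<le> c)"
    "(\<And>T. T \<in> X \<Longrightarrow> W T \<le> B) \<Longrightarrow> b \<le> upper_mean W"
proof -
  let ?S = "{c. \<exists>ys. ys \<noteq> [] \<and> (\<forall>T\<in>X. average ys W T \<le> c)}"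
  obtain T0 where T0: "T0 \<in> X" using assms(1) by blast
  have lower: "b \<le> c" if "c \<in> ?S" for c
  proof -
    obtain ys where ys: "ys \<noteq> []" "\<forall>T\<in>X. average ys W T \<le> c" using \<open>c \<in> ?S\<close> by blast
    have "b \<le> average ys W T0" using assms(2) T0 tiling_space by (intro average_ge ys(1)) simp
    then show ?thesis using ys(2) T0 by force
  qed
  then have bdd: "bdd_below ?S" by (rule bdd_belowI)
  show "upper_mean W \<le> c" if "ys \<noteq> []" "\<And>T. T \<in> X \<Longrightarrow> average ys W T \<le> c"
    unfolding upper_mean_def using that by (intro cInf_lower bdd) blast
  have ne: "?S \<noteq> {}" if "\<And>T. T \<in> X \<Longrightarrow> W T \<le> B"
  proof -
    have "B \<in> ?S" using that by (auto simp: average_def intro!: exI[of _ "[0]"])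
    then show ?thesis by blast
  qed
  show "\<exists>ys. ys \<noteq> [] \<and> (\<forall>T\<in>X. average ys W T \<le> c)" if W: "\<And>T. T \<in> X \<Longrightarrow> W T \<le> B" and c: "upper_mean W < c"
  proof -
    obtain c' where "c' \<in> ?S" "c' < c" using cInf_lessD[OF ne[OF W] c[unfolded upper_mean_def]] by blast
    then show ?thesis by force
  qed
  show "b \<le> upper_mean W" if "\<And>T. T \<in> X \<Longrightarrow> W T \<le> B"
    unfolding upper_mean_def by (intro cInf_greatest ne[OF that] lower)
qed

lemma sublinear_upper_mean:
  assumes X: "X \<noteq> {}"
  shows "sublinear_on bounded_functions upper_mean"
proof (rule sublinear_onI[OF function_space_bounded])
  show "upper_mean (\<lambda>x. 0) = 0"
    using upper_mean_bounds(1)[OF X, where b = 0 and W = "\<lambda>x. 0" and ys = "[0]" and c = 0] upper_mean_bounds(3)[OF X, where b = 0 and W = "\<lambda>x. 0" and B = 0]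
    by (simp add: average_def)
  show "upper_mean (\<lambda>T. V T + W T) \<le> upper_mean V + upper_mean W"
    if V: "V \<in> bounded_functions" and W: "W \<in> bounded_functions" for V W
  proof (rule field_le_epsilon)
    fix e :: real assume e: "0 < e"
    obtain B where B: "\<And>T. T \<in> X \<Longrightarrow> \<bar>V T\<bar> \<le> B" using V by blast
    obtain C where C: "\<And>T. T \<in> X \<Longrightarrow> \<bar>W T\<bar> \<le> C" using W by blast
    have b: "- B \<le> V T" "V T \<le> B" "- C \<le> W T" "W T \<le> C" if "T \<in> X" for T using B[OF that] C[OF that] by auto
    obtain ys where ys: "ys \<noteq> []" "\<And>T. T \<in> X \<Longrightarrow> average ys V T \<le> upper_mean V + e / 2"
      using upper_mean_bounds(2)[where W = V, OF X b(1,2), where c = "upper_mean V + e / 2"] e by auto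
    obtain zs where zs: "zs \<noteq> []" "\<And>T. T \<in> X \<Longrightarrow> average zs W T \<le> upper_mean W + e / 2"
      using upper_mean_bounds(2)[where W = W, OF X b(3,4), where c = "upper_mean W + e / 2"] e by auto
    have "average (list_sums zs ys) (\<lambda>T. V T + W T) T \<le> upper_mean V + upper_mean W + e" if T: "T \<in> X" for T
    proof -
      have "average (list_sums zs ys) V T \<le> upper_mean V + e / 2"
        unfolding average_list_sums by (rule average_le[OF zs(1)]) (use ys(2) T in simp)
      moreover have "average (list_sums zs ys) W T \<le> upper_mean W + e / 2"
        unfolding average_list_sums_commute by (rule average_le[OF ys(1)]) (use zs(2) T in simp)
      ultimately show ?thesis unfolding average_add by simp
    qed
    then show "upper_mean (\<lambda>T. V T + W T) \<le> upper_mean V + upper_mean W + e"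
    proof (intro upper_mean_bounds(1)[OF X, where b = "- B - C" and ys = "list_sums zs ys"] list_sums_nonempty zs(1) ys(1))
      show "- B - C \<le> V T + W T" if "T \<in> X" for T using b(1,3)[OF that] by linarith
    qed
  qed
  show "upper_mean (\<lambda>T. c * W T) \<le> c * upper_mean W" if W: "W \<in> bounded_functions" and c: "0 < c" for W c
  proof (rule field_le_epsilon)
    fix e :: real assume e: "0 < e"
    obtain C where C: "\<And>T. T \<in> X \<Longrightarrow> \<bar>W T\<bar> \<le> C" using W by blast
    have b: "- C \<le> W T" "W T \<le> C" if "T \<in> X" for T using C[OF that] by auto
    obtain ys where ys: "ys \<noteq> []" "\<And>T. T \<in> X \<Longrightarrow> average ys W T \<le> upper_mean W + e / c"
      using upper_mean_bounds(2)[where W = W, OF X b, where c = "upper_mean W + e / c"] e c by auto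
    have "average ys (\<lambda>T. c * W T) T \<le> c * upper_mean W + e" if "T \<in> X" for T
      using mult_left_mono[OF ys(2)[OF that], of c] c by (simp add: average_scale distrib_left)
    then show "upper_mean (\<lambda>T. c * W T) \<le> c * upper_mean W + e"
    proof (intro upper_mean_bounds(1)[OF X, where b = "c * - C" and ys = ys] ys(1))
      show "c * - C \<le> c * W T" if "T \<in> X" for T using b(1)[OF that] c by (intro mult_left_mono) auto
    qed
  qed
qed

text \<open>Averaging over long arithmetic progressions makes $W-W(\cdot-v)$ telescope.\<close>

lemma upper_mean_coboundary:
  assumes X: "X \<noteq> {}" and W: "\<And>T. T \<in> X \<Longrightarrow> \<bar>W T\<bar> \<le> B"
  shows "upper_mean (\<lambda>T. W T - W (pattern_minus T v)) \<le> 0"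
proof (rule field_le_epsilon)
  fix e :: real assume e: "0 < e"
  obtain n :: nat where n: "2 * B / e < real n" using reals_Archimedean2 by blast
  have "0 \<le> B" using X W by force
  then have "0 \<le> 2 * B / e" using e by simp
  then have n0: "0 < n" using n by (cases n) auto
  define ys where "ys = map (\<lambda>k. real k *\<^sub>R v) [0..<n]"
  have "(\<Sum>y\<leftarrow>map (\<lambda>k. real k *\<^sub>R v) [0..<n]. W (pattern_minus T y) - W (pattern_minus (pattern_minus T y) v))
      = W T - W (pattern_minus T (real n *\<^sub>R v))" for T n
    by (induction n) (auto simp: pattern_minus_minus algebra_simps)
  then have avg: "average ys (\<lambda>T. W T - W (pattern_minus T v)) T = (W T - W (pattern_minus T (real n *\<^sub>R v))) / real n" for T
    by (simp add: average_def ys_def)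
  have "average ys (\<lambda>T. W T - W (pattern_minus T v)) T \<le> e" if T: "T \<in> X" for T
  proof -
    have "W T - W (pattern_minus T (real n *\<^sub>R v)) \<le> 2 * B"
      using W[OF T] W[OF translate_in[OF T], of "real n *\<^sub>R v"] by linarith
    also have "\<dots> \<le> e * real n" using n e by (simp add: field_simps)
    finally show ?thesis unfolding avg using n0 by (simp add: pos_divide_le_eq)
  qed
  moreover have "- 2 * B \<le> W T - W (pattern_minus T v)" if "T \<in> X" for T
    using W[OF that] W[OF translate_in[OF that], of v] by linarith
  ultimately show "upper_mean (\<lambda>T. W T - W (pattern_minus T v)) \<le> 0 + e"
    using n0 by (intro upper_mean_bounds(1)[OF X, where b = "- 2 * B" and ys = ys]) (auto simp: ys_def)
qed

lemma continuous_translate: "continuous_map (pattern_topology L X) (pattern_topology L X) (\<lambda>T. pattern_minus T v)"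
  using continuous_map_pattern_minus[of "pattern_topology L X" "\<lambda>T. T" "\<lambda>T. v"] by simp

lemma continuous_bounded:
  assumes "continuous_map (pattern_topology L X) euclideanreal W"
  shows "\<exists>B. \<forall>T\<in>X. \<bar>W T\<bar> \<le> B"
proof -
  have "compactin euclideanreal (W ` X)"
    using image_compactin[OF _ assms, of X] compact by (simp add: compact_space_def)
  then show ?thesis using compact_imp_bounded by (force simp: bounded_iff)
qed

definition invariant_functional :: "((('a, 'l) pattern \<Rightarrow> real) \<Rightarrow> real) \<Rightarrow> bool" where
  "invariant_functional I \<longleftrightarrow> positive_functional X (pattern_dist L) I \<and>
     (\<forall>W v. continuous_map (pattern_topology L X) euclideanreal W \<longrightarrow> I (\<lambda>T. W (pattern_minus T v)) = I W)"

text \<open>A linear functional below \<open>upper_mean\<close> is positive and normalized because averages of \<open>W\<close> lie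
  between the bounds of \<open>W\<close>, and invariant by \<open>upper_mean_coboundary\<close>.\<close>

lemma invariant_functional_attaining_upper_mean:
  assumes X: "X \<noteq> {}" and W: "continuous_map (pattern_topology L X) euclideanreal W"
  shows "\<exists>I. invariant_functional I \<and> I W = upper_mean W"
proof -
  have bf: "V \<in> bounded_functions" if "continuous_map (pattern_topology L X) euclideanreal V" for V
    using continuous_bounded[OF that] by simp
  obtain I where I: "\<And>f g. f \<in> bounded_functions \<Longrightarrow> g \<in> bounded_functions \<Longrightarrow> I (\<lambda>x. f x + g x) = I f + I g"
    "\<And>f c. f \<in> bounded_functions \<Longrightarrow> I (\<lambda>x. c * f x) = c * I f"
    "\<And>f. f \<in> bounded_functions \<Longrightarrow> I f \<le> upper_mean f" "I W = upper_mean W"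
    by (rule linear_functional_below_sublinear[OF function_space_bounded sublinear_upper_mean[OF X] bf[OF W]]) blast
  interpret M: Metric_space X "pattern_dist L" by (rule metric_space)
  have le: "I V \<le> c" if V: "V \<in> bounded_functions" "\<And>T. T \<in> X \<Longrightarrow> V T \<le> c" for V c
  proof -
    obtain B where B: "\<And>T. T \<in> X \<Longrightarrow> \<bar>V T\<bar> \<le> B" using V(1) by blast
    have lo: "- B \<le> V T" if "T \<in> X" for T using B[OF that] by linarith
    have "upper_mean V \<le> c"
      using V(2) lo by (intro upper_mean_bounds(1)[where W = V, OF X lo, where ys = "[0]"]) (auto simp: average_def)
    then show ?thesis using I(3)[OF V(1)] by linarith
  qed
  have sub: "I (\<lambda>x. f x + -1 * g x) = I f - I g" if "f \<in> bounded_functions" "g \<in> bounded_functions" for f g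
    using I(1)[OF that(1) function_spaceD(2)[OF function_space_bounded that(2), of "-1"]] I(2)[OF that(2), of "-1"] by simp
  have "positive_functional X (pattern_dist L) I"
  proof
    show "compact_space M.mtopology" using compact by (simp add: topology_eq)
    show "I (\<lambda>x. f x + g x) = I f + I g"
      if "continuous_map M.mtopology euclideanreal f" "continuous_map M.mtopology euclideanreal g" for f g
      using that bf I(1) by (simp add: topology_eq)
    show "I (\<lambda>x. c * f x) = c * I f" if "continuous_map M.mtopology euclideanreal f" for f c
      using that bf I(2) by (simp add: topology_eq)
    show "I f \<le> I g" if fg: "continuous_map M.mtopology euclideanreal f" "continuous_map M.mtopology euclideanreal g"
      "\<And>T. T \<in> X \<Longrightarrow> f T \<le> g T" for f g
    proof -
      have b: "f \<in> bounded_functions" "g \<in> bounded_functions" using fg(1,2) bf unfolding topology_eq by blast+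
      have "I (\<lambda>x. f x + -1 * g x) \<le> 0" using fg(3) by (intro le function_spaceD[OF function_space_bounded] b) simp
      then show ?thesis using sub[OF b] by simp
    qed
    have one: "(\<lambda>x. c) \<in> bounded_functions" for c by auto
    have "I (\<lambda>x. 1) \<le> 1" "I (\<lambda>x. -1) \<le> -1" by (rule le[OF one]; simp)+
    then show "I (\<lambda>x. 1) = 1" using I(2)[OF one, of "-1" 1] by simp
  qed
  moreover have "I (\<lambda>T. V (pattern_minus T v)) = I V" if V: "continuous_map (pattern_topology L X) euclideanreal V" for V v
  proof -
    have b: "V \<in> bounded_functions" "(\<lambda>T. V (pattern_minus T v)) \<in> bounded_functions"
      using bf[OF V] bf[OF continuous_map_compose[OF continuous_translate V]] by (simp_all add: comp_def)
    obtain B where B: "\<And>T. T \<in> X \<Longrightarrow> \<bar>V T\<bar> \<le> B" using b(1) by blast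
    have "I (\<lambda>T. V T + -1 * V (pattern_minus T v)) \<le> 0"
      using I(3)[OF function_spaceD(1)[OF function_space_bounded b(1) function_spaceD(2)[OF function_space_bounded b(2), of "-1"]]]
        upper_mean_coboundary[where W = V and v = v, OF X B] by simp
    moreover have "I (\<lambda>T. V (pattern_minus T v) + -1 * V T) \<le> 0"
      using I(3)[OF function_spaceD(1)[OF function_space_bounded b(2) function_spaceD(2)[OF function_space_bounded b(1), of "-1"]]]
        upper_mean_coboundary[where W = "\<lambda>T. -1 * V T" and v = v and B = B, OF X] B by simp
    ultimately show ?thesis using sub[OF b] sub[OF b(2,1)] by simp
  qed
  ultimately show ?thesis using I(4) unfolding invariant_functional_def by blast
qed

lemma invariant_functional_measure:
  assumes I: "invariant_functional I"
  shows "invariant_prob_measure L X (positive_functional.functional_measure X (pattern_dist L) I)"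
proof -
  interpret I: positive_functional X "pattern_dist L" I using I by (simp add: invariant_functional_def)
  let ?\<mu> = "I.functional_measure"
  have sets: "sets ?\<mu> = sigma_sets X {U. openin (pattern_topology L X) U}"
    using I.functional_measure(2) by (simp add: topology_eq)
  have em: "emeasure ?\<mu> E = I.outer E" if "E \<in> sets ?\<mu>" for E
    using I.functional_measure(2,3) that by simp
  have "emeasure ?\<mu> X = 1"
  proof -
    have "I.opn X" using openin_topspace[of I.mtopology] by simp
    then show ?thesis using em[of X] I.functional_measure(2) I.outer_open I.content_space by (auto intro: sigma_sets.Basic)
  qed
  then have "prob_space ?\<mu>" by (intro prob_spaceI) (simp add: I.functional_measure(1))
  moreover have "emeasure ?\<mu> ((\<lambda>T. pattern_minus T x) ` E) = emeasure ?\<mu> E" if E: "E \<in> sets ?\<mu>" for x E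
  proof -
    have cont: "continuous_map I.mtopology I.mtopology (\<lambda>T. pattern_minus T v)" for v
      using continuous_translate by (simp add: topology_eq)
    have EX: "E \<subseteq> X" using sets.sets_into_space[OF E] I.functional_measure(1) by simp
    have eq: "I.outer ((\<lambda>T. pattern_minus T x) ` E) = I.outer E"
      using I EX by (intro I.outer_image[where t' = "\<lambda>T. pattern_minus T (- x)"] cont)
        (auto simp: pattern_minus_minus invariant_functional_def topology_eq)
    have "(\<lambda>T. pattern_minus T (- x)) \<in> measurable ?\<mu> ?\<mu>"
    proof (rule measurable_sigma_sets[OF I.functional_measure(2)])
      show "{U. I.opn U} \<subseteq> Pow X" using openin_subset by fastforce
      show "(\<lambda>T. pattern_minus T (- x)) \<in> space ?\<mu> \<rightarrow> X" by (simp add: I.functional_measure(1))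
      fix U assume "U \<in> {U. I.opn U}"
      then have "I.opn {T \<in> X. pattern_minus T (- x) \<in> U}"
        using openin_continuous_map_preimage[OF cont[of "- x"]] by simp
      moreover have "(\<lambda>T. pattern_minus T (- x)) -` U \<inter> space ?\<mu> = {T \<in> X. pattern_minus T (- x) \<in> U}"
        by (auto simp: I.functional_measure(1))
      ultimately show "(\<lambda>T. pattern_minus T (- x)) -` U \<inter> space ?\<mu> \<in> sets ?\<mu>"
        unfolding I.functional_measure(2) by (auto intro: sigma_sets.Basic)
    qed
    then have "(\<lambda>T. pattern_minus T (- x)) -` E \<inter> space ?\<mu> \<in> sets ?\<mu>" using E by (rule measurable_sets)
    moreover have "(\<lambda>T. pattern_minus T (- x)) -` E \<inter> space ?\<mu> = (\<lambda>T. pattern_minus T x) ` E"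
      using EX by (force simp: I.functional_measure(1) pattern_minus_minus image_iff)
    ultimately show ?thesis using em eq E by metis
  qed
  ultimately show ?thesis
    unfolding invariant_prob_measure_def using sets I.functional_measure(1) by blast
qed

text \<open>The means $p(W)$ and $-p(-W)$, where \<open>p\<close> is \<open>upper_mean\<close>, are values at \<open>W\<close> of invariant
  functionals. Unique ergodicity leaves only one such functional, so the two agree, and averaging
  over both sets of translates keeps the function between them.\<close>

lemma uniform_average:
  assumes ue: "uniquely_ergodic L X" and X: "X \<noteq> {}"
    and W: "continuous_map (pattern_topology L X) euclideanreal W" and e: "0 < e"
  shows "\<exists>c ys. ys \<noteq> [] \<and> (\<forall>T\<in>X. \<bar>average ys W T - c\<bar> \<le> e)"
proof -
  have W': "continuous_map (pattern_topology L X) euclideanreal (\<lambda>T. -1 * W T)"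
    using W by (rule continuous_map_real_mult_left)
  obtain I where I: "invariant_functional I" "I W = upper_mean W"
    using invariant_functional_attaining_upper_mean[OF X W] by blast
  obtain J where J: "invariant_functional J" "J (\<lambda>T. -1 * W T) = upper_mean (\<lambda>T. -1 * W T)"
    using invariant_functional_attaining_upper_mean[OF X W'] by blast
  interpret I: positive_functional X "pattern_dist L" I using I(1) by (simp add: invariant_functional_def)
  interpret J: positive_functional X "pattern_dist L" J using J(1) by (simp add: invariant_functional_def)
  obtain B where B: "\<And>T. T \<in> X \<Longrightarrow> \<bar>W T\<bar> \<le> B" using continuous_bounded[OF W] by blast
  have \<mu>: "I.functional_measure = J.functional_measure"
    using ue invariant_functional_measure[OF I(1)] invariant_functional_measure[OF J(1)]
    unfolding uniquely_ergodic_def by blast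
  have "I.content U = J.content U" if U: "I.opn U" for U
  proof -
    have "ennreal (I.content U) = ennreal (J.content U)"
      using I.functional_measure(3)[of U] J.functional_measure(3)[of U] \<mu> U I.outer_open J.outer_open
      by (simp add: sigma_sets.Basic)
    then show ?thesis using I.content_nonneg J.content_nonneg by simp
  qed
  then have IJ: "I W = J W"
    using W B by (intro functional_eq_if_content_eq[OF I.positive_functional_axioms J.positive_functional_axioms])
      (auto simp: topology_eq)
  have "J (\<lambda>T. -1 * W T) = - J W" using J.I_scale[of W "-1"] W by (simp add: topology_eq)
  then have neg: "upper_mean (\<lambda>T. -1 * W T) = - upper_mean W" using IJ I(2) J(2) by simp
  have b: "- B \<le> W T" "W T \<le> B" "- B \<le> -1 * W T" "-1 * W T \<le> B" if "T \<in> X" for T using B[OF that] by auto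
  obtain ys where ys: "ys \<noteq> []" "\<And>T. T \<in> X \<Longrightarrow> average ys W T \<le> upper_mean W + e"
    using upper_mean_bounds(2)[where W = W, OF X b(1,2), where c = "upper_mean W + e"] e by auto
  obtain zs where zs: "zs \<noteq> []" "\<And>T. T \<in> X \<Longrightarrow> average zs (\<lambda>T. -1 * W T) T \<le> - upper_mean W + e"
    using upper_mean_bounds(2)[where W = "\<lambda>T. -1 * W T", OF X b(3,4), where c = "- upper_mean W + e"] e neg by auto
  have "\<bar>average (list_sums zs ys) W T - upper_mean W\<bar> \<le> e" if T: "T \<in> X" for T
  proof -
    have "average (list_sums zs ys) W T \<le> upper_mean W + e"
      unfolding average_list_sums by (rule average_le[OF zs(1)]) (use ys(2) T in simp)
    moreover have "average (list_sums zs ys) (\<lambda>T. -1 * W T) T \<le> - upper_mean W + e"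
      unfolding average_list_sums_commute by (rule average_le[OF ys(1)]) (use zs(2) T in simp)
    ultimately show ?thesis unfolding average_scale by linarith
  qed
  then show ?thesis using list_sums_nonempty[OF zs(1) ys(1)] by blast
qed

text \<open>One function at a time; further averaging does not spoil what has been achieved.\<close>

lemma uniform_averages:
  assumes ue: "uniquely_ergodic L X" and X: "X \<noteq> {}" and "finite F"
    and W: "\<And>W. W \<in> F \<Longrightarrow> continuous_map (pattern_topology L X) euclideanreal W" and e: "0 < e"
  shows "\<exists>ys. ys \<noteq> [] \<and> (\<forall>W\<in>F. \<exists>c. \<forall>T\<in>X. \<bar>average ys W T - c\<bar> \<le> e)"
  using assms(3) W
proof (induction F rule: finite_induct)
  case empty
  show ?case by (intro exI[of _ "[0]"]) simp
next
  case (insert V F)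
  have stable: "\<bar>average zs V T - c\<bar> \<le> e"
    if "zs \<noteq> []" "\<forall>T\<in>X. \<bar>V T - c\<bar> \<le> e" "T \<in> X" for zs and V :: "('a, 'l) pattern \<Rightarrow> real" and c T
  proof -
    have "V (pattern_minus T y) \<le> c + e" "c - e \<le> V (pattern_minus T y)" for y
      using that(2) translate_in[OF that(3), of y] by (force simp: abs_le_iff)+
    then show ?thesis using average_le[OF that(1), of V T "c + e"] average_ge[OF that(1), of "c - e" V T] by force
  qed
  obtain ys where ys: "ys \<noteq> []" "\<forall>W\<in>F. \<exists>c. \<forall>T\<in>X. \<bar>average ys W T - c\<bar> \<le> e"
    using insert by blast
  obtain c zs where zs: "zs \<noteq> []" "\<forall>T\<in>X. \<bar>average zs V T - c\<bar> \<le> e"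
    using uniform_average[OF ue X _ e] insert.prems by blast
  have "\<exists>c. \<forall>T\<in>X. \<bar>average (list_sums zs ys) W T - c\<bar> \<le> e" if "W \<in> insert V F" for W
  proof (cases "W = V")
    case True
    then show ?thesis unfolding average_list_sums_commute using stable[OF ys(1) zs(2)] by blast
  next
    case False
    then obtain c where "\<forall>T\<in>X. \<bar>average ys W T - c\<bar> \<le> e" using ys(2) \<open>W \<in> insert V F\<close> by blast
    then show ?thesis unfolding average_list_sums using stable[OF zs(1)] by blast
  qed
  then show ?case using list_sums_nonempty[OF zs(1) ys(1)] by blast
qed

end


section \<open>A smooth bi-Lipschitz representative of the cocycle\<close>

lemma elementary_subset: "elementary U g \<Longrightarrow> V \<subseteq> U \<Longrightarrow> elementary V g"
  by (induction rule: elementary.induct) (auto intro: elementary.intros)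

lemma locally_elementary_const: "locally_elementary (\<lambda>x. c)"
  unfolding locally_elementary_def by (auto intro: elementary.const)

lemma locally_elementary_add:
  assumes "locally_elementary f" "locally_elementary g"
  shows "locally_elementary (\<lambda>x. f x + g x)"
  unfolding locally_elementary_def
proof
  fix x
  obtain U f' where U: "open U" "x \<in> U" "elementary U f'" "\<forall>y\<in>U. f y = f' y"
    using assms(1) unfolding locally_elementary_def by blast
  obtain V g' where V: "open V" "x \<in> V" "elementary V g'" "\<forall>y\<in>V. g y = g' y"
    using assms(2) unfolding locally_elementary_def by blast
  have "elementary (U \<inter> V) (\<lambda>x. f' x + g' x)"
    using elementary_subset[OF U(3)] elementary_subset[OF V(3)] by (intro elementary.add) auto
  then show "\<exists>U h. open U \<and> x \<in> U \<and> elementary U h \<and> (\<forall>y\<in>U. f y + g y = h y)"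
    using U V by (intro exI[of _ "U \<inter> V"] exI[of _ "\<lambda>x. f' x + g' x"]) auto
qed

lemma locally_elementary_scale:
  assumes "locally_elementary f" shows "locally_elementary (\<lambda>x. c * f x)"
  unfolding locally_elementary_def
proof
  fix x
  obtain U f' where "open U" "x \<in> U" "elementary U f'" "\<forall>y\<in>U. f y = f' y"
    using assms unfolding locally_elementary_def by blast
  then show "\<exists>U h. open U \<and> x \<in> U \<and> elementary U h \<and> (\<forall>y\<in>U. c * f y = h y)"
    by (intro exI[of _ U] exI[of _ "\<lambda>x. c * f' x"]) (auto intro: elementary.mult elementary.const)
qed

lemma locally_elementary_sum_list:
  "(\<And>y. y \<in> set ys \<Longrightarrow> locally_elementary (g y)) \<Longrightarrow> locally_elementary (\<lambda>x. \<Sum>y\<leftarrow>ys. g y x)"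
  by (induction ys) (auto intro: locally_elementary_const locally_elementary_add)

lemma has_derivative_sum_list:
  "(\<And>y. y \<in> set ys \<Longrightarrow> (g y has_derivative g' y) F) \<Longrightarrow>
    ((\<lambda>x. \<Sum>y\<leftarrow>ys. g y x) has_derivative (\<lambda>v. \<Sum>y\<leftarrow>ys. g' y v)) F"
  by (induction ys) (auto intro: has_derivative_add)

lemma homeomorphic_map_bilipschitz:
  fixes A :: "'a::euclidean_space \<Rightarrow> 'a"
  assumes c: "0 < c" "\<And>x y. c * norm (x - y) \<le> norm (A x - A y)" and A: "continuous_on UNIV A" "surj A"
  shows "homeomorphic_map euclidean euclidean A"
proof -
  have "inj A"
  proof (rule injI)
    fix x y assume "A x = A y"
    then have "c * norm (x - y) \<le> 0" using c(2)[of x y] by simp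
    then show "x = y" using c(1) by (simp add: mult_le_0_iff)
  qed
  define B where "B = inv A"
  have BA: "B (A x) = x" "A (B x) = x" for x
    using \<open>inj A\<close> A(2) by (simp_all add: B_def surj_f_inv_f)
  have lip: "dist (B x) (B y) \<le> (1 / c) * dist x y" for x y
    using c(2)[of "B x" "B y"] c(1) by (simp add: BA dist_norm field_simps)
  have "continuous_on UNIV B"
    unfolding continuous_on_iff
  proof (intro ballI allI impI)
    fix x and e :: real assume e: "0 < e"
    have "dist (B y) (B x) < e" if "dist y x < c * e" for y
    proof -
      have "c * dist (B y) (B x) \<le> dist y x" using lip[of y x] c(1) by (simp add: field_simps)
      then have "c * dist (B y) (B x) < c * e" using that by simp
      then show ?thesis using c(1) by simp
    qed
    then show "\<exists>d>0. \<forall>y\<in>UNIV. dist y x < d \<longrightarrow> dist (B y) (B x) < e"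
      using c(1) e by (intro exI[of _ "c * e"]) auto
  qed
  then have "homeomorphic_maps euclidean euclidean A B"
    using A(1) BA by (simp add: homeomorphic_maps_def)
  then show ?thesis using homeomorphic_map_maps by blast
qed

text \<open>If $A-l$ has a small Lipschitz constant compared with the lower bound of the linear map \<open>l\<close>,
  then solving $A(x)=z$ is a fixed point problem for a contraction.\<close>

lemma surj_near_linear:
  fixes A l :: "'a::euclidean_space \<Rightarrow> 'a"
  assumes l: "linear l" "\<And>v. 3 * \<eta> * norm v \<le> norm (l v)" and \<eta>: "0 < \<eta>"
    and A: "\<And>x y. norm ((A x - l x) - (A y - l y)) \<le> \<eta> * norm (x - y)"
  shows "surj A"
proof -
  have "inj l"
  proof (rule linear_injective_0[THEN iffD2, OF l(1)], intro allI impI)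
    fix v assume "l v = 0"
    then show "v = 0" using l(2)[of v] \<eta> by (simp add: mult_le_0_iff)
  qed
  then have "surj l" using linear_injective_imp_surjective[OF l(1)] by blast
  define m where "m = inv l"
  have lm: "l (m z) = z" for z using \<open>surj l\<close> by (simp add: m_def surj_f_inv_f)
  have mnorm: "norm (m z - m w) \<le> norm (z - w) / (3 * \<eta>)" for z w
    using l(2)[of "m z - m w"] \<eta> linear_diff[OF l(1)] by (simp add: lm field_simps)
  have "\<exists>x. A x = z" for z
  proof -
    let ?\<phi> = "\<lambda>x. m (z - (A x - l x))"
    have "\<exists>!x. ?\<phi> x = x"
    proof (rule banach_fix_type[of "1 / 3"])
      show "\<forall>x y. dist (?\<phi> x) (?\<phi> y) \<le> 1 / 3 * dist x y"
      proof (intro allI)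
        fix x y
        have "norm (?\<phi> x - ?\<phi> y) \<le> norm ((A y - l y) - (A x - l x)) / (3 * \<eta>)"
          using mnorm[of "z - (A x - l x)" "z - (A y - l y)"] by (simp add: algebra_simps)
        also have "\<dots> \<le> (\<eta> * norm (y - x)) / (3 * \<eta>)" using A \<eta> by (intro divide_right_mono) auto
        finally show "dist (?\<phi> x) (?\<phi> y) \<le> 1 / 3 * dist x y"
          using \<eta> by (simp add: dist_norm norm_minus_commute)
      qed
    qed auto
    then obtain x where "m (z - (A x - l x)) = x" by blast
    then have "z - (A x - l x) = l x" using lm by metis
    then show ?thesis by (intro exI[of _ x]) (simp add: algebra_simps)
  qed
  then show ?thesis by (metis surjI)
qed

context tiling_cocycle
begin

text \<open>In terms of the vertices \<open>q\<close> of \<open>T\<close> itself the corrected cocycle is, up to a constant, the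
  weighted mean of fixed vectors with weights \<open>bump (q - x)\<close>.\<close>

lemma locally_elementary_spread:
  assumes T: "T \<in> X" and \<rho>': "0 \<le> \<rho>'"
    and pos: "\<And>T. T \<in> X \<Longrightarrow> 0 < (\<Sum>p\<in>vertex_set T \<inter> ball 0 \<rho>'. bump \<rho>' p)"
  shows "locally_elementary (\<lambda>x. corrected (spread (bump \<rho>') \<rho>' s) T x \<bullet> i)"
  unfolding locally_elementary_def
proof
  fix x0
  define V where "V = vertex_set T \<inter> ball x0 (\<rho>' + 1)"
  have V: "finite V" unfolding V_def by (rule finite_vertices_in_ball[OF X.vertex_pattern[OF T]])
  define c where "c = (\<lambda>q. f T q + s (pattern_minus T q))"
  have sums: "(\<Sum>p\<in>vertex_set (pattern_minus T x) \<inter> ball 0 \<rho>'. bump \<rho>' p *\<^sub>R F p) = (\<Sum>q\<in>V. bump \<rho>' (q - x) *\<^sub>R F (q - x))"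
    if x: "x \<in> ball x0 1" for x and F :: "'a \<Rightarrow> 'c::real_vector"
  proof -
    have "(\<Sum>p\<in>vertex_set (pattern_minus T x) \<inter> ball 0 \<rho>'. bump \<rho>' p *\<^sub>R F p)
        = (\<Sum>q\<in>vertex_set T \<inter> ball x \<rho>'. bump \<rho>' (q - x) *\<^sub>R F (q - x))"
      by (rule sum.reindex_bij_witness[of _ "\<lambda>q. q - x" "\<lambda>p. p + x"])
        (auto simp: vertex_set_minus dist_norm norm_minus_commute)
    also have "\<dots> = (\<Sum>q\<in>V. bump \<rho>' (q - x) *\<^sub>R F (q - x))"
    proof (rule sum.mono_neutral_left[OF V])
      show "vertex_set T \<inter> ball x \<rho>' \<subseteq> V"
      proof
        fix q assume q: "q \<in> vertex_set T \<inter> ball x \<rho>'"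
        then have "dist x0 q < \<rho>' + 1" using x dist_triangle[of x0 q x] by simp
        then show "q \<in> V" using q by (simp add: V_def)
      qed
      show "\<forall>q\<in>V - vertex_set T \<inter> ball x \<rho>'. bump \<rho>' (q - x) *\<^sub>R F (q - x) = 0"
      proof
        fix q assume "q \<in> V - vertex_set T \<inter> ball x \<rho>'"
        then have "\<rho>' \<le> norm (q - x)" by (auto simp: V_def dist_norm norm_minus_commute)
        then show "bump \<rho>' (q - x) *\<^sub>R F (q - x) = 0" using bump_0[of \<rho>' "q - x"] \<rho>' by simp
      qed
    qed
    finally show ?thesis .
  qed
  define den where "den = (\<lambda>x. \<Sum>q\<in>V. bump \<rho>' (q - x))"
  have den: "(\<Sum>p\<in>vertex_set (pattern_minus T x) \<inter> ball 0 \<rho>'. bump \<rho>' p) = den x" if "x \<in> ball x0 1" for x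
    using sums[OF that, of "\<lambda>_. 1::real"] by (simp add: den_def)
  have den0: "den x \<noteq> 0" if "x \<in> ball x0 1" for x
    using pos[OF X.translate_in[OF T, of x]] unfolding den[OF that] by simp
  have eq: "corrected (spread (bump \<rho>') \<rho>' s) T x \<bullet> i
      = (\<Sum>q\<in>V. bump \<rho>' (q - x) * (c q \<bullet> i)) * inverse (den x) + - (spread (bump \<rho>') \<rho>' s T \<bullet> i)"
    if x: "x \<in> ball x0 1" for x
  proof -
    have fq: "f (pattern_minus T x) (q - x) + s (pattern_minus (pattern_minus T x) (q - x)) = c q - f T x" for q
      using f_add[OF T, of x "q - x"] by (simp add: c_def pattern_minus_minus)
    have "(\<Sum>p\<in>vertex_set (pattern_minus T x) \<inter> ball 0 \<rho>'. bump \<rho>' p *\<^sub>R (f (pattern_minus T x) p + s (pattern_minus (pattern_minus T x) p)))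
        = (\<Sum>q\<in>V. bump \<rho>' (q - x) *\<^sub>R c q) - den x *\<^sub>R f T x"
      unfolding sums[OF x] fq by (simp add: scaleR_diff_right sum_subtractf den_def scaleR_sum_left)
    then have "spread (bump \<rho>') \<rho>' s (pattern_minus T x) = (\<Sum>q\<in>V. bump \<rho>' (q - x) *\<^sub>R c q) /\<^sub>R den x - f T x"
      unfolding spread_def den[OF x] using den0[OF x] by (simp add: scaleR_diff_right)
    then show ?thesis
      by (simp add: corrected_def inner_diff_left inner_sum_left mult.commute)
  qed
  have "elementary (ball x0 1) (\<lambda>x. (\<Sum>q\<in>V. bump \<rho>' (q - x) * (c q \<bullet> i)) * inverse (den x) + - (spread (bump \<rho>') \<rho>' s T \<bullet> i))"
    unfolding den_def using V den0 unfolding den_def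
    by (intro elementary.add elementary.mult elementary_sum elementary.inverse elementary_bump elementary.const)
  then show "\<exists>U g. open U \<and> x0 \<in> U \<and> elementary U g \<and> (\<forall>y\<in>U. corrected (spread (bump \<rho>') \<rho>' s) T y \<bullet> i = g y)"
    using eq by (intro exI[of _ "ball x0 1"] exI conjI) auto
qed

text \<open>The partial derivatives of the corrected cocycle at \<open>0\<close>, as functions on the tiling space;
  the cocycle equation turns their values along an orbit into the derivatives at other points.\<close>

definition slope :: "(('a, 'l) pattern \<Rightarrow> 'a) \<Rightarrow> 'a \<Rightarrow> 'a \<Rightarrow> ('a, 'l) pattern \<Rightarrow> real" where
  "slope s i j T = frechet_derivative (\<lambda>x. corrected s T x \<bullet> i) (at 0) j"

lemma slope_translate:
  assumes T: "T \<in> X" and el: "locally_elementary (\<lambda>x. corrected s T x \<bullet> i)"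
  shows "frechet_derivative (\<lambda>x. corrected s T x \<bullet> i) (at x) j = slope s i j (pattern_minus T x)"
proof -
  let ?D = "frechet_derivative (\<lambda>x. corrected s T x \<bullet> i) (at x)"
  have "((\<lambda>x. corrected s T x \<bullet> i) has_derivative ?D) (at (x + 0))"
    using frechet_derivative_works[THEN iffD1, OF locally_elementary_derivative(1)[OF el, of x]] by simp
  moreover have "((\<lambda>u. x + u) has_derivative (\<lambda>u. u)) (at 0)" by (auto intro!: derivative_eq_intros)
  ultimately have "((\<lambda>u. corrected s T (x + u) \<bullet> i) has_derivative ?D) (at 0)"
    using has_derivative_compose[of "\<lambda>u. x + u" "\<lambda>u. u" 0 UNIV "\<lambda>x. corrected s T x \<bullet> i" ?D] by simp
  then have "((\<lambda>u. corrected s T (x + u) \<bullet> i - corrected s T x \<bullet> i) has_derivative ?D) (at 0)"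
    using has_derivative_diff[OF _ has_derivative_const] by fastforce
  moreover have "(\<lambda>u. corrected s T (x + u) \<bullet> i - corrected s T x \<bullet> i) = (\<lambda>u. corrected s (pattern_minus T x) u \<bullet> i)"
    using corrected_add[OF T] by (simp add: inner_add_left)
  ultimately show ?thesis unfolding slope_def using frechet_derivative_at by metis
qed

lemma continuous_slope:
  assumes s: "adapted s R" and el: "\<And>T. T \<in> X \<Longrightarrow> locally_elementary (\<lambda>x. corrected s T x \<bullet> i)"
  shows "continuous_map (pattern_topology L X) euclideanreal (slope s i j)"
proof (rule X.continuous_map_euclideanI)
  fix T and e :: real assume T: "T \<in> X" and e: "0 < e"
  let ?D = "\<lambda>y. frechet_derivative (\<lambda>x. corrected s T x \<bullet> i) (at y) j"
  have "isCont ?D 0"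
    by (intro differentiable_imp_continuous_within locally_elementary_derivative el T)
  then obtain d where d: "0 < d" "\<And>y. norm y < d \<Longrightarrow> dist (?D y) (?D 0) < e"
    using e unfolding continuous_at_eps_delta by (auto simp: dist_norm)
  have "dist (slope s i j T) (slope s i j T') < e" if T': "T' \<in> X" "near (R + 1) d T T'" for T'
  proof -
    obtain y where y: "norm y < d" "patch T' 0 (R + 1) = patch (pattern_minus T y) 0 (R + 1)"
      using T'(2) unfolding near_def by blast
    have "corrected s T' x \<bullet> i = corrected s (pattern_minus T y) x \<bullet> i" if "x \<in> ball 0 1" for x
      using corrected_local[OF s T'(1) X.translate_in[OF T] y(2), of x] that by simp
    moreover have "((\<lambda>x. corrected s (pattern_minus T y) x \<bullet> i) has_derivative
        frechet_derivative (\<lambda>x. corrected s (pattern_minus T y) x \<bullet> i) (at 0)) (at 0)"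
      using T by (intro frechet_derivative_works[THEN iffD1] locally_elementary_derivative(1) el) simp
    ultimately have "((\<lambda>x. corrected s T' x \<bullet> i) has_derivative
        frechet_derivative (\<lambda>x. corrected s (pattern_minus T y) x \<bullet> i) (at 0)) (at 0)"
      using has_derivative_transform_within_open[of _ _ 0 UNIV "ball 0 1" "\<lambda>x. corrected s T' x \<bullet> i"] by simp
    then have "slope s i j T' = slope s i j (pattern_minus T y)"
      unfolding slope_def using frechet_derivative_at by metis
    then have "slope s i j T' = ?D y" "slope s i j T = ?D 0"
      using slope_translate[OF T el[OF T]] by simp_all
    then show ?thesis using d(2)[OF y(1)] by (simp add: dist_commute)
  qed
  then show "\<exists>R. \<exists>d>0. \<forall>T'\<in>X. near R d T T' \<longrightarrow> dist (slope s i j T) (slope s i j T') < e"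
    using d(1) by blast
qed

text \<open>Unique ergodicity makes the derivative of the averaged cocycle uniformly close to one
  linear map \<open>l\<close>. As the corrected cocycle stays within bounded distance of \<open>f\<close>, which grows at
  least linearly because it has an inverse of the same kind, \<open>l\<close> is invertible.\<close>

lemma exists_adapted_bilipschitz:
  assumes ue: "uniquely_ergodic L X" and X: "X \<noteq> {}"
  shows "\<exists>s R c K. adapted s R \<and> 0 < c \<and> 0 < K \<and> continuous_map (pattern_topology L X) euclidean s \<and>
    (\<forall>T\<in>X. (\<forall>i. locally_elementary (\<lambda>x. corrected s T x \<bullet> i)) \<and>
      (\<forall>x y. c * norm (x - y) \<le> norm (corrected s T x - corrected s T y)) \<and>
      (\<forall>x y. norm (corrected s T x - corrected s T y) \<le> K * norm (x - y)) \<and>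
      homeomorphic_map euclidean euclidean (corrected s T))"
proof -
  obtain \<rho>' where \<rho>': "0 < \<rho>'" "\<forall>T\<in>X. \<forall>x. \<exists>v\<in>vertex_set T. dist x v < \<rho>'"
    using X.vertices_relatively_dense by blast
  have pos: "0 < (\<Sum>p\<in>vertex_set T \<inter> ball 0 \<rho>'. bump \<rho>' p)" if T: "T \<in> X" for T
  proof -
    obtain v where "v \<in> vertex_set T" "dist 0 v < \<rho>'" using \<rho>'(2) T by blast
    then have v: "v \<in> vertex_set T \<inter> ball 0 \<rho>'" "0 < bump \<rho>' v" using bump_pos by auto
    show ?thesis
      by (rule sum_pos2[where f = "bump \<rho>'", OF finite_vertices_in_ball[OF X.vertex_pattern[OF T]] v])
        (rule bump_nonneg)
  qed
  define s1 where "s1 = spread (bump \<rho>') \<rho>' displacement"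
  define R1 where "R1 = r + \<rho>'"
  have s1: "adapted s1 R1"
    unfolding s1_def R1_def using \<rho>'(1) pos by (intro adapted_spread adapted_displacement) auto
  have el1: "locally_elementary (\<lambda>x. corrected s1 T x \<bullet> i)" if "T \<in> X" for T i
    unfolding s1_def using that \<rho>'(1) pos by (intro locally_elementary_spread) auto
  obtain C where C: "0 < C" "\<And>T x. T \<in> X \<Longrightarrow> norm x \<le> C * (norm (f T x) + 1)"
    using f_lower_bound by blast
  \<comment> \<open>chosen so that $|v|\le C(|l(v)|+\eta|v|)$, which the growth of \<open>f\<close> will yield for the mean
    derivative \<open>l\<close>, implies $3\eta|v|\le|l(v)|$\<close>
  define \<eta> where "\<eta> = 1 / (4 * C)"
  have \<eta>: "0 < \<eta>" using C(1) by (simp add: \<eta>_def)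
  define n where "n = real DIM('a)"
  have n: "0 < n" by (simp add: n_def)
  define \<F> where "\<F> = (\<lambda>(i, j). slope s1 i j) ` (Basis \<times> Basis)"
  have "finite \<F>" by (simp add: \<F>_def)
  moreover have "continuous_map (pattern_topology L X) euclideanreal W" if "W \<in> \<F>" for W
    using that continuous_slope[OF s1 el1] by (auto simp: \<F>_def)
  ultimately obtain ys where ys: "ys \<noteq> []" "\<forall>W\<in>\<F>. \<exists>c. \<forall>T\<in>X. \<bar>average ys W T - c\<bar> \<le> \<eta> / n\<^sup>2"
    using X.uniform_averages[OF ue X, of \<F> "\<eta> / n\<^sup>2"] \<eta> n by (auto simp del: split_paired_All)
  have "\<exists>c. \<forall>T\<in>X. \<bar>average ys (slope s1 i j) T - c\<bar> \<le> \<eta> / n\<^sup>2" if "i \<in> Basis" "j \<in> Basis" for i j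
    using that by (intro ys(2)[rule_format]) (force simp: \<F>_def)
  then obtain m where m: "\<And>i j T. i \<in> Basis \<Longrightarrow> j \<in> Basis \<Longrightarrow> T \<in> X \<Longrightarrow> \<bar>average ys (slope s1 i j) T - m i j\<bar> \<le> \<eta> / n\<^sup>2"
    by metis
  define s where "s = averaged ys s1"
  obtain B where B: "0 \<le> B" "\<And>y. y \<in> set ys \<Longrightarrow> norm y \<le> B"
    using bounded_pos[of "set ys"] finite_imp_bounded[of "set ys"] by (metis finite_set less_imp_le)
  have s: "adapted s (R1 + B)" unfolding s_def by (rule adapted_averaged[OF s1 ys(1) B(2,1)])
  have comp: "corrected s T x \<bullet> i = inverse (real (length ys)) * (\<Sum>y\<leftarrow>ys. corrected s1 (pattern_minus T y) x \<bullet> i)" if "T \<in> X" for T x i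
  proof -
    have "(\<Sum>y\<leftarrow>ys. F y) \<bullet> i = (\<Sum>y\<leftarrow>ys. F y \<bullet> i)" for F :: "'a \<Rightarrow> 'a"
      by (induction ys) (auto simp: inner_add_left)
    then show ?thesis using corrected_averaged[OF that ys(1)] by (simp add: s_def)
  qed
  have el: "locally_elementary (\<lambda>x. corrected s T x \<bullet> i)" if "T \<in> X" for T i
    unfolding comp[OF that] using that el1 by (intro locally_elementary_scale locally_elementary_sum_list) simp
  have slope: "frechet_derivative (\<lambda>x. corrected s T x \<bullet> i) (at x) j = average ys (slope s1 i j) (pattern_minus T x)" if T: "T \<in> X" for T x i j
  proof -
    have hd: "((\<lambda>x. corrected s T x \<bullet> i) has_derivative
      (\<lambda>v. inverse (real (length ys)) * (\<Sum>y\<leftarrow>ys. frechet_derivative (\<lambda>x. corrected s1 (pattern_minus T y) x \<bullet> i) (at x) v))) (at x)"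
      unfolding comp[OF T]
      by (intro has_derivative_mult_right has_derivative_sum_list frechet_derivative_works[THEN iffD1]
        locally_elementary_derivative(1) el1 X.translate_in T)
    have "frechet_derivative (\<lambda>x. corrected s T x \<bullet> i) (at x) j
      = inverse (real (length ys)) * (\<Sum>y\<leftarrow>ys. frechet_derivative (\<lambda>x. corrected s1 (pattern_minus T y) x \<bullet> i) (at x) j)"
      by (rule fun_cong[OF frechet_derivative_at[OF hd], symmetric])
    then show ?thesis
      using T el1 by (simp add: slope_translate average_def pattern_minus_minus add.commute divide_inverse mult.commute)
  qed
  define l where "l = (\<lambda>v::'a. \<Sum>i\<in>Basis. (\<Sum>j\<in>Basis. (v \<bullet> j) * m i j) *\<^sub>R i)"
  have "linear l"
    unfolding l_def by (intro linear_compose_sum ballI linearI)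
      (auto simp: inner_add_left algebra_simps sum.distrib sum_distrib_left)
  have lip: "norm ((corrected s T x - l x) - (corrected s T y - l y)) \<le> \<eta> * norm (x - y)" if T: "T \<in> X" for T x y
  proof -
    let ?\<omega> = "\<lambda>x. blinfun_apply (total_derivative (corrected s T) x)"
    note td = total_derivative(1,2)[of "corrected s T", OF el[OF T]]
    have "norm (?\<omega> x v - l v) \<le> \<eta> * norm v" for x v
    proof -
      have ci: "\<bar>(?\<omega> x v - l v) \<bullet> i\<bar> \<le> \<eta> / n * norm v" if i: "i \<in> Basis" for i
      proof -
        have "?\<omega> x v \<bullet> i = (\<Sum>j\<in>Basis. (v \<bullet> j) * (?\<omega> x j \<bullet> i))"
        proof -
          have "?\<omega> x v = ?\<omega> x (\<Sum>j\<in>Basis. (v \<bullet> j) *\<^sub>R j)" by (simp add: euclidean_representation)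
          then show ?thesis by (simp add: blinfun.sum_right blinfun.scaleR_right inner_sum_left)
        qed
        moreover have "l v \<bullet> i = (\<Sum>j\<in>Basis. (v \<bullet> j) * m i j)"
          using i by (simp add: l_def)
        ultimately have "(?\<omega> x v - l v) \<bullet> i = (\<Sum>j\<in>Basis. (v \<bullet> j) * (average ys (slope s1 i j) (pattern_minus T x) - m i j))"
          using i by (simp add: inner_diff_left td(2) slope[OF T] sum_subtractf right_diff_distrib)
        also have "\<bar>\<dots>\<bar> \<le> (\<Sum>j\<in>(Basis::'a set). norm v * (\<eta> / n\<^sup>2))"
        proof (rule order_trans[OF sum_abs], rule sum_mono)
          fix j :: 'a assume j: "j \<in> Basis"
          show "\<bar>(v \<bullet> j) * (average ys (slope s1 i j) (pattern_minus T x) - m i j)\<bar> \<le> norm v * (\<eta> / n\<^sup>2)"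
            unfolding abs_mult using m[OF i j X.translate_in[OF T]] Basis_le_norm[OF j] by (intro mult_mono) auto
        qed
        also have "\<dots> = \<eta> / n * norm v" using n by (simp add: n_def power2_eq_square)
        finally show ?thesis .
      qed
      have "norm (?\<omega> x v - l v) \<le> (\<Sum>i\<in>Basis. \<bar>(?\<omega> x v - l v) \<bullet> i\<bar>)" by (rule norm_le_l1)
      also have "\<dots> \<le> (\<Sum>i\<in>(Basis::'a set). \<eta> / n * norm v)" by (intro sum_mono ci)
      also have "\<dots> = \<eta> * norm v" using n by (simp add: n_def)
      finally show ?thesis .
    qed
    then have "onorm (\<lambda>v. ?\<omega> x v - l v) \<le> \<eta>" for x using \<eta> by (intro onorm_bound) auto
    moreover have "((\<lambda>x. corrected s T x - l x) has_derivative (\<lambda>v. ?\<omega> x v - l v)) (at x)" for x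
      using td(1) linear_imp_has_derivative[OF \<open>linear l\<close>] by (intro has_derivative_diff)
    ultimately show ?thesis by (intro differentiable_bound[OF convex_UNIV]) auto
  qed
  have cont: "continuous_on UNIV (corrected s T)" if "T \<in> X" for T
    using total_derivative(1)[of "corrected s T", OF el[OF that]]
    by (intro continuous_at_imp_continuous_on ballI has_derivative_continuous) blast
  have s_cont: "continuous_map (pattern_topology L X) euclidean s"
  proof (rule continuous_adapted[OF s])
    fix T and e :: real assume T: "T \<in> X" and e: "0 < e"
    have "isCont (corrected s T) 0" using cont[OF T] by (simp add: continuous_on_eq_continuous_at)
    then show "\<exists>d>0. \<forall>y. norm y < d \<longrightarrow> norm (corrected s T y) < e"
      using e T unfolding continuous_at_eps_delta by simp
  qed
  obtain K where K: "\<And>T. T \<in> X \<Longrightarrow> norm (s T) \<le> K"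
    using X.continuous_bounded[of "\<lambda>T. norm (s T)"] continuous_map_norm[OF s_cont] by auto
  \<comment> \<open>compare \<open>l\<close> with \<open>f T\<close> at the far point \<open>t *\<^sub>R v\<close>, where bounded errors are negligible\<close>
  have l: "3 * \<eta> * norm v \<le> norm (l v)" for v
  proof -
    obtain T where T: "T \<in> X" using X by blast
    have "0 \<le> K" using K[OF T] norm_ge_zero order_trans by blast
    have "norm v \<le> C * (norm (l v) + \<eta> * norm v) + e" if e: "0 < e" for e
    proof -
      define t where "t = C * (2 * K + 1) / e"
      have t: "0 < t" "e * t = C * (2 * K + 1)" using C(1) \<open>0 \<le> K\<close> e by (auto simp: t_def)
      have "norm (f T (t *\<^sub>R v)) \<le> norm (corrected s T (t *\<^sub>R v)) + 2 * K"
      proof -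
        have "f T (t *\<^sub>R v) = corrected s T (t *\<^sub>R v) + (s T - s (pattern_minus T (t *\<^sub>R v)))" by (simp add: corrected_def)
        then show ?thesis
          using norm_triangle_ineq[of "corrected s T (t *\<^sub>R v)" "s T - s (pattern_minus T (t *\<^sub>R v))"]
            norm_triangle_ineq4[of "s T" "s (pattern_minus T (t *\<^sub>R v))"] K[OF T] K[OF X.translate_in[OF T], of "t *\<^sub>R v"]
          by simp
      qed
      moreover have "norm (corrected s T (t *\<^sub>R v)) \<le> norm (l (t *\<^sub>R v)) + \<eta> * norm (t *\<^sub>R v)"
        using lip[OF T, of "t *\<^sub>R v" 0] norm_triangle_sub[of "corrected s T (t *\<^sub>R v)" "l (t *\<^sub>R v)"] T
          linear_0[OF \<open>linear l\<close>] by simp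
      ultimately have "norm (f T (t *\<^sub>R v)) + 1 \<le> t * (norm (l v) + \<eta> * norm v) + (2 * K + 1)"
        using t(1) by (simp add: linear_scale[OF \<open>linear l\<close>] algebra_simps)
      then have "C * (norm (f T (t *\<^sub>R v)) + 1) \<le> C * (t * (norm (l v) + \<eta> * norm v) + (2 * K + 1))"
        using C(1) by (intro mult_left_mono) auto
      then have "t * norm v \<le> C * (t * (norm (l v) + \<eta> * norm v)) + e * t"
        using C(2)[OF T, of "t *\<^sub>R v"] t by (simp add: distrib_left)
      then have "t * norm v \<le> t * (C * (norm (l v) + \<eta> * norm v) + e)" by (simp add: algebra_simps)
      then show ?thesis using t(1) by simp
    qed
    then have "norm v \<le> C * (norm (l v) + \<eta> * norm v)" by (rule field_le_epsilon)
    then show ?thesis using C(1) by (simp add: \<eta>_def field_simps)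
  qed
  have lower: "2 * \<eta> * norm (x - y) \<le> norm (corrected s T x - corrected s T y)" if T: "T \<in> X" for T x y
  proof -
    have "l (x - y) - (corrected s T x - corrected s T y) = - ((corrected s T x - l x) - (corrected s T y - l y))"
      by (simp add: linear_diff[OF \<open>linear l\<close>])
    then have "norm (l (x - y) - (corrected s T x - corrected s T y)) \<le> \<eta> * norm (x - y)"
      using lip[OF T, of x y] by (metis norm_minus_cancel)
    then show ?thesis
      using l[of "x - y"] norm_triangle_ineq2[of "l (x - y)" "corrected s T x - corrected s T y"] by linarith
  qed
  have homeo: "homeomorphic_map euclidean euclidean (corrected s T)" if T: "T \<in> X" for T
    using \<eta> lower[OF T] cont[OF T] surj_near_linear[OF \<open>linear l\<close> l \<eta> lip[OF T]]
    by (intro homeomorphic_map_bilipschitz[of "2 * \<eta>"]) auto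
  obtain M where M: "0 < M" "\<And>v. norm (l v) \<le> M * norm v" using linear_bounded_pos[OF \<open>linear l\<close>] by blast
  have upper: "norm (corrected s T x - corrected s T y) \<le> (M + \<eta>) * norm (x - y)" if T: "T \<in> X" for T x y
  proof -
    have eq: "corrected s T x - corrected s T y = l (x - y) + ((corrected s T x - l x) - (corrected s T y - l y))"
      by (simp add: linear_diff[OF \<open>linear l\<close>])
    show ?thesis
      unfolding eq using norm_triangle_ineq[of "l (x - y)" "(corrected s T x - l x) - (corrected s T y - l y)"] M(2)[of "x - y"] lip[OF T, of x y]
      by (simp add: distrib_right)
  qed
  show ?thesis
    using s \<eta> s_cont el lower upper homeo M(1)
    by (intro exI[of _ s] exI[of _ "R1 + B"] exI[of _ "2 * \<eta>"] exI[of _ "M + \<eta>"]) auto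
qed

end


section \<open>The shape change defined by the corrected cocycle\<close>

lemma finite_image_factor:
  assumes "finite (g ` A)" "\<And>x y. x \<in> A \<Longrightarrow> y \<in> A \<Longrightarrow> g x = g y \<Longrightarrow> f x = f y"
  shows "finite (f ` A)"
proof -
  define u where "u = (\<lambda>z. f (SOME x. x \<in> A \<and> g x = z))"
  have "f x = u (g x)" if "x \<in> A" for x
  proof -
    have "(SOME y. y \<in> A \<and> g y = g x) \<in> A \<and> g (SOME y. y \<in> A \<and> g y = g x) = g x"
      by (rule someI_ex) (use that in blast)
    then show ?thesis unfolding u_def using assms(2)[OF that] by metis
  qed
  then have "f ` A = u ` g ` A" unfolding image_image by (rule image_cong[OF refl])
  then show ?thesis using assms(1) by simp
qed

text \<open>A patch is determined by its translation class together with the position of the origin among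
  the finitely many vertices of a representative.\<close>

lemma (in flc_space) finite_vertex_patches:
  assumes "0 < R"
  shows "finite ((\<lambda>T. patch T 0 R) ` {T \<in> X. 0 \<in> vertex_set T})"
proof -
  obtain F where F: "finite F" "\<forall>Q\<in>F. finite Q \<and> (\<exists>T\<in>X. Q \<subseteq> T)"
    "\<forall>T\<in>X. \<forall>x. \<exists>Q\<in>F. \<exists>y. patch T x R = pattern_minus Q y"
    using finite_patches[of R] by (elim exE conjE)
  define E where "E = (\<lambda>Q::('a, 'l) pattern. \<Union>t\<in>Q. {v. v extreme_point_of fst t})"
  have "finite (E Q)" if "Q \<in> F" for Q
    unfolding E_def using F(2) that vertex_pattern by (intro finite_UN_I) (auto simp: vertex_pattern_def)
  then have fin: "finite (\<Union>Q\<in>F. pattern_minus Q ` E Q)" using F(1) by blast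
  have "patch T 0 R \<in> (\<Union>Q\<in>F. pattern_minus Q ` E Q)" if T: "T \<in> X" "0 \<in> vertex_set T" for T
  proof -
    obtain Q y where Q: "Q \<in> F" "patch T 0 R = pattern_minus Q y" using F(3) T(1) by metis
    have "0 \<in> vertex_set (patch T 0 R)" using vertex_set_patch[of 0 R T] assms T(2) by simp
    then have "0 + y \<in> vertex_set Q" unfolding Q(2) vertex_set_minus .
    then have "y \<in> E Q" by (auto simp: E_def vertex_set_def)
    then show ?thesis using Q by blast
  qed
  then show ?thesis using fin by (intro finite_subset[OF _ fin]) blast
qed

lemma vertex_label_minus: "vertex_label (pattern_minus T x) R p = vertex_label T R (x + p)"
  by (simp add: vertex_label_def pattern_minus_minus)

lemma mem_deformed_pattern: "t \<in> deformed_pattern T R A \<longleftrightarrow> (\<exists>p\<in>vertex_set T. t = ({A p}, vertex_label T R p))"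
  by (auto simp: deformed_pattern_def)

lemma vertex_label_metric:
  "mspace (vertex_label_metric T R) = vertex_label T R ` vertex_set T"
  "mtopology_of (vertex_label_metric T R) = discrete_topology (vertex_label T R ` vertex_set T)"
proof -
  let ?M = "vertex_label T R ` vertex_set T"
  interpret Metric_space ?M discrete_metric.dd by (rule metric_M_dd)
  show "mspace (vertex_label_metric T R) = ?M" by (simp add: vertex_label_metric_def)
  show "mtopology_of (vertex_label_metric T R) = discrete_topology ?M"
    unfolding vertex_label_metric_def mtopology_of using discrete_metric.mtopology_discrete_metric .
qed

text \<open>The patch of radius $R+(2\delta+1)$ determines the corrected cocycle at points of norm at most
  $2\delta+1$, so a label, which has at least this radius, tells where the vertices at this distance
  are moved.\<close>

locale deformation = tiling_cocycle L X L' Y h k \<kappa> \<rho> f r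
  for L :: "'l metric" and X :: "('a::euclidean_space, 'l) pattern set"
    and L' :: "'m metric" and Y :: "('a, 'm) pattern set" and h k \<kappa> \<rho> f r +
  fixes s :: "('a, 'l) pattern \<Rightarrow> 'a" and R c K :: real and T0 :: "('a, 'l) pattern" and R0 \<delta> :: real
  assumes s_adapted: "adapted s R" and s_continuous: "continuous_map (pattern_topology L X) euclidean s"
    and c: "0 < c" and K: "0 < K"
    and lower: "T \<in> X \<Longrightarrow> c * norm (x - y) \<le> norm (corrected s T x - corrected s T y)"
    and upper: "T \<in> X \<Longrightarrow> norm (corrected s T x - corrected s T y) \<le> K * norm (x - y)"
    and surj: "T \<in> X \<Longrightarrow> \<exists>x. corrected s T x = z"
    and minimal: "minimal_space L X" and T0: "T0 \<in> X" "0 \<in> vertex_set T0"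
    and \<delta>: "0 < \<delta>" "T \<in> X \<Longrightarrow> \<exists>v\<in>vertex_set T. dist x v < \<delta>"
    and R0: "R + (2 * \<delta> + 1) \<le> R0"
begin

abbreviation A :: "('a, 'l) pattern \<Rightarrow> 'a \<Rightarrow> 'a" where
  "A \<equiv> corrected s"

abbreviation L'' :: "('a, 'l) pattern metric" where
  "L'' \<equiv> vertex_label_metric T0 R0"

definition deform :: "('a, 'l) pattern \<Rightarrow> ('a, ('a, 'l) pattern) pattern" where
  "deform T = deformed_pattern T R0 (A T)"

definition Z :: "('a, ('a, 'l) pattern) pattern set" where
  "Z = deform ` X"

lemma R_nonneg: "0 \<le> R"
  using adapted_ge[OF s_adapted] r_nonneg by simp

lemma R0_pos: "0 < R0"
  using R0 R_nonneg \<delta>(1) by simp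

lemma A_inj: "T \<in> X \<Longrightarrow> A T x = A T y \<Longrightarrow> x = y"
  using lower[of T x y] c by (simp add: mult_le_0_iff)

lemma A_translate: "T \<in> X \<Longrightarrow> A (pattern_minus T x) y = A T (x + y) - A T x"
  using corrected_add[of T s x y] by simp

lemma norm_A_ge: "T \<in> X \<Longrightarrow> c * norm x \<le> norm (A T x)"
  using lower[of T x 0] by simp

lemma norm_A_le: "T \<in> X \<Longrightarrow> norm (A T x) \<le> K * norm x"
  using upper[of T x 0] by simp

lemma A_local: "T \<in> X \<Longrightarrow> T' \<in> X \<Longrightarrow> patch T 0 (R + B) = patch T' 0 (R + B) \<Longrightarrow> norm x \<le> B \<Longrightarrow> A T x = A T' x"
  by (rule corrected_local[OF s_adapted])

lemma mem_deform: "t \<in> deform T \<longleftrightarrow> (\<exists>p\<in>vertex_set T. t = ({A T p}, vertex_label T R0 p))"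
  by (simp add: deform_def mem_deformed_pattern)

lemma deform_translate:
  assumes T: "T \<in> X"
  shows "deform (pattern_minus T x) = pattern_minus (deform T) (A T x)"
proof -
  have "tile_minus ({z}, l) w = ({z - w}, l)" for z w :: 'a and l :: "('a, 'l) pattern"
    by (simp add: tile_minus_def)
  then have "pattern_minus (deform T) (A T x) = (\<lambda>q. ({A T q - A T x}, vertex_label T R0 q)) ` vertex_set T"
    by (simp add: deform_def deformed_pattern_def pattern_minus_def image_image)
  also have "\<dots> = (\<lambda>p. ({A T (x + p) - A T x}, vertex_label T R0 (x + p))) ` vertex_set (pattern_minus T x)"
  proof -
    have "vertex_set T = (\<lambda>p. x + p) ` vertex_set (pattern_minus T x)"
      by (auto simp: vertex_set_minus image_iff intro!: bexI[of _ "_ - x"] simp: add.commute)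
    then show ?thesis by (simp add: image_image)
  qed
  also have "\<dots> = deform (pattern_minus T x)"
    by (simp add: deform_def deformed_pattern_def A_translate[OF T] vertex_label_minus)
  finally show ?thesis by simp
qed

lemma deform_local: "\<exists>R'. \<forall>T\<in>X. \<forall>T'\<in>X. patch T 0 R' = patch T' 0 R' \<longrightarrow> patch (deform T) 0 r' = patch (deform T') 0 r'"
proof -
  define B where "B = \<bar>r'\<bar> / c"
  have B: "0 \<le> B" using c by (simp add: B_def)
  define R' where "R' = R + R0 + B"
  have sub: "patch (deform T) 0 r' \<subseteq> patch (deform T') 0 r'"
    if T: "T \<in> X" "T' \<in> X" and ag: "patch T 0 R' = patch T' 0 R'" for T T'
  proof
    fix t assume t: "t \<in> patch (deform T) 0 r'"
    then obtain p where p: "p \<in> vertex_set T" "t = ({A T p}, vertex_label T R0 p)" "norm (A T p) < r'"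
      by (auto simp: mem_patch mem_deform)
    have "c * norm p \<le> c * B" using norm_A_ge[OF T(1), of p] p(3) c by (simp add: B_def)
    then have pB: "norm p \<le> B" using c by simp
    have "A T p = A T' p"
      using R0_pos by (intro A_local[OF T _ pB] patch_eq_mono[OF ag]) (simp add: R'_def)
    moreover have "vertex_label T R0 p = vertex_label T' R0 p"
      unfolding vertex_label_def using pB R_nonneg by (intro patch_eq_shift[OF ag]) (simp add: R'_def)
    moreover have "p \<in> vertex_set T'"
      using vertex_set_patch_eq[OF ag, of p] p(1) pB R_nonneg R0_pos by (simp add: R'_def)
    ultimately have "t \<in> deform T'" using p(2) by (auto simp: mem_deform)
    then show "t \<in> patch (deform T') 0 r'" using t by (simp add: mem_patch)
  qed
  show ?thesis
    by (intro exI[of _ R'] ballI impI equalityI sub) auto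
qed

text \<open>By minimality the patterns of \<open>X\<close> have the same patches around vertices, so the labels of \<open>T0\<close>
  serve for all of them.\<close>

lemma vertex_label_in: 
  assumes T: "T \<in> X" "p \<in> vertex_set T"
  shows "vertex_label T R0 p \<in> mspace L''"
proof -
  let ?T = "pattern_minus T p"
  obtain U where U: "openin (pattern_topology L X) U" "?T \<in> U" "\<forall>T'\<in>U. near (R0 + 1) 1 ?T T'"
    using X.near_open[OF X.translate_in[OF T(1)] zero_less_one] by blast
  have "?T \<in> pattern_topology L X closure_of orbit T0"
    using minimal T0(1) T(1) by (simp add: minimal_space_def)
  then obtain x where "pattern_minus T0 x \<in> U"
    using U(1,2) unfolding in_closure_of orbit_def by blast
  then obtain y where y: "norm y < 1" "patch (pattern_minus T0 x) 0 (R0 + 1) = patch (pattern_minus ?T y) 0 (R0 + 1)"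
    using U(3) unfolding near_def by blast
  have "patch (pattern_minus (pattern_minus T0 x) (- y)) 0 R0 = patch (pattern_minus (pattern_minus ?T y) (- y)) 0 R0"
    using y(1) by (intro patch_eq_shift[OF y(2)]) simp
  then have eq: "patch (pattern_minus T0 (x - y)) 0 R0 = patch ?T 0 R0" by (simp add: pattern_minus_minus)
  then have "0 \<in> vertex_set (pattern_minus T0 (x - y))"
    using vertex_set_patch_eq[OF eq, of 0] R0_pos T(2) by (simp add: vertex_set_minus)
  then have "x - y \<in> vertex_set T0" by (simp add: vertex_set_minus)
  then show ?thesis
    using eq unfolding vertex_label_metric(1) vertex_label_def by (metis (no_types, lifting) imageI)
qed

lemma labelled_delone_deform:
  assumes T: "T \<in> X"
  shows "labelled_delone L'' (deform T)"
proof -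
  obtain \<kappa>' where \<kappa>': "0 < \<kappa>'" "\<forall>v\<in>vertex_set T. \<forall>w\<in>vertex_set T. v \<noteq> w \<longrightarrow> \<kappa>' \<le> dist v w"
    using X.vertex_separation T by blast
  define \<Lambda> where "\<Lambda> = A T ` vertex_set T"
  define lab where "lab = (\<lambda>z. vertex_label T R0 (the_inv_into UNIV (A T) z))"
  have inj: "inj (A T)" using A_inj[OF T] by (rule injI)
  have "delone \<Lambda>"
    unfolding delone_def
  proof (rule conjI[OF exI[of _ "c * \<kappa>'"] exI[of _ "K * \<delta>"]]; intro conjI ballI impI allI)
    show "0 < c * \<kappa>'" using c \<kappa>'(1) by simp
  next
    fix p q assume "p \<in> \<Lambda>" "q \<in> \<Lambda>" "p \<noteq> q"
    then obtain v w where vw: "v \<in> vertex_set T" "w \<in> vertex_set T" "v \<noteq> w" "p = A T v" "q = A T w"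
      by (auto simp: \<Lambda>_def)
    have "c * \<kappa>' \<le> c * norm (v - w)"
      using \<kappa>'(2) vw c by (intro mult_left_mono) (auto simp: dist_norm)
    then show "c * \<kappa>' \<le> dist p q" using lower[OF T, of v w] vw by (simp add: dist_norm)
  next
    fix z
    obtain x where x: "A T x = z" using surj[OF T] by blast
    obtain v where v: "v \<in> vertex_set T" "dist x v < \<delta>" using \<delta>(2)[OF T] by blast
    have "K * norm (x - v) \<le> K * \<delta>" using v(2) K by (intro mult_left_mono) (auto simp: dist_norm)
    then have "dist z (A T v) \<le> K * \<delta>" using upper[OF T, of x v] x by (simp add: dist_norm)
    then show "\<exists>p\<in>\<Lambda>. dist z p \<le> K * \<delta>" using v(1) by (auto simp: \<Lambda>_def)
  qed
  moreover have lab: "lab (A T p) = vertex_label T R0 p" for p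
    by (simp add: lab_def the_inv_into_f_f[OF inj])
  moreover have "lab ` \<Lambda> \<subseteq> mspace L''" using vertex_label_in[OF T] by (auto simp: \<Lambda>_def lab)
  moreover have "deform T = labelled_points \<Lambda> lab"
    by (auto simp: deform_def deformed_pattern_def labelled_points_def \<Lambda>_def image_image lab)
  ultimately show ?thesis unfolding labelled_delone_def by blast
qed

lemma locally_finite_deform: "T \<in> X \<Longrightarrow> locally_finite L'' (deform T)"
  using vertex_pattern_labelled_delone[OF labelled_delone_deform] by (simp add: vertex_pattern_def)

text \<open>The target space is either the image \<open>Z\<close> or the space of all labelled Delone sets, in which
  orbit closures are taken.\<close>

lemma continuous_deform:
  assumes D: "Z \<subseteq> D" "\<And>S. S \<in> D \<Longrightarrow> locally_finite L'' S"
  shows "continuous_map (pattern_topology L X) (pattern_topology L'' D) deform"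
proof (rule continuous_map_into_patterns)
  show "deform T \<in> D" if "T \<in> topspace (pattern_topology L X)" for T
    using that D(1) by (auto simp: Z_def)
  fix T and r' e :: real assume "T \<in> topspace (pattern_topology L X)" and e: "0 < e"
  then have T: "T \<in> X" by simp
  obtain R' where R': "\<And>T T'. T \<in> X \<Longrightarrow> T' \<in> X \<Longrightarrow> patch T 0 R' = patch T' 0 R' \<Longrightarrow> patch (deform T) 0 r' = patch (deform T') 0 r'"
    using deform_local[of r'] by metis
  obtain U where U: "openin (pattern_topology L X) U" "T \<in> U" "\<forall>T'\<in>U. near R' (e / K) T T'"
    using X.near_open[OF T, of "e / K"] e K by auto
  have "near r' e (deform T) (deform T')" if T': "T' \<in> U" for T'
  proof -
    have "T' \<in> X" using T' openin_subset[OF U(1)] by auto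
    obtain y where y: "norm y < e / K" "patch T' 0 R' = patch (pattern_minus T y) 0 R'"
      using U(3) T' unfolding near_def by blast
    have "patch (deform T') 0 r' = patch (pattern_minus (deform T) (A T y)) 0 r'"
      using R'[OF \<open>T' \<in> X\<close> X.translate_in[OF T] y(2)] deform_translate[OF T] by simp
    moreover have "norm (A T y) < e"
      using norm_A_le[OF T, of y] y(1) K by (simp add: field_simps)
    ultimately show ?thesis by (intro nearI[of "A T y"])
  qed
  then show "\<exists>U. openin (pattern_topology L X) U \<and> T \<in> U \<and> (\<forall>T'\<in>U. near r' e (deform T) (deform T'))"
    using U(1,2) by blast
qed (rule D(2))

text \<open>From a vertex with its label one reads off the neighbouring vertices and their images; since
  the images carry labels as well, one can continue from vertex to vertex.\<close>

lemma deform_neighbour: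
  assumes U: "U \<in> X" "U' \<in> X" "deform U = deform U'" "patch U 0 R0 = patch U' 0 R0"
    and p: "p \<in> vertex_set U" "norm p \<le> 2 * \<delta> + 1"
  shows "deform (pattern_minus U p) = deform (pattern_minus U' p)"
    "patch (pattern_minus U p) 0 R0 = patch (pattern_minus U' p) 0 R0"
proof -
  have "A U p = A U' p" using R0 by (intro A_local[OF U(1,2) _ p(2)] patch_eq_mono[OF U(4)])
  then show "deform (pattern_minus U p) = deform (pattern_minus U' p)"
    using U deform_translate by simp
  have "({A U p}, vertex_label U R0 p) \<in> deform U'"
    using p(1) unfolding U(3)[symmetric] mem_deform by blast
  then obtain q where q: "q \<in> vertex_set U'" "A U p = A U' q" "vertex_label U R0 p = vertex_label U' R0 q"
    by (auto simp: mem_deform)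
  then have "q = p" using A_inj[OF U(2)] \<open>A U p = A U' p\<close> by metis
  then show "patch (pattern_minus U p) 0 R0 = patch (pattern_minus U' p) 0 R0"
    using q(3) by (simp add: vertex_label_def)
qed

lemma deform_eq_imp_eq:
  assumes "U \<in> X" "U' \<in> X" "deform U = deform U'" "patch U 0 R0 = patch U' 0 R0"
  shows "U = U'"
proof -
  have labels: "patch (pattern_minus U p) 0 R0 = patch (pattern_minus U' p) 0 R0"
    if "U \<in> X" "U' \<in> X" "deform U = deform U'" "patch U 0 R0 = patch U' 0 R0" "p \<in> vertex_set U" "norm p \<le> real n"
    for n U U' p
    using that
  proof (induction n arbitrary: U U' p)
    case 0
    then show ?case by simp
  next
    case (Suc n)
    show ?case
    proof (cases "norm p \<le> 2 * \<delta> + 1")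
      case True
      then show ?thesis using deform_neighbour(2)[OF Suc.prems(1-5)] by simp
    next
      case False
      \<comment> \<open>a vertex \<open>v\<close> of norm at most $2\delta+1$ that is closer to \<open>p\<close> than the origin by at least \<open>1\<close>\<close>
      define x where "x = ((\<delta> + 1) / norm p) *\<^sub>R p"
      have np: "0 < norm p" "\<delta> + 1 \<le> norm p" using False \<delta>(1) by linarith+
      obtain v where v: "v \<in> vertex_set U" "dist x v < \<delta>" using \<delta>(2)[OF Suc.prems(1)] by blast
      have nx: "norm x = \<delta> + 1" using np(1) \<delta>(1) unfolding x_def by simp
      have "p - x = (1 - (\<delta> + 1) / norm p) *\<^sub>R p" by (simp add: x_def algebra_simps)
      moreover have "0 \<le> 1 - (\<delta> + 1) / norm p" using np by simp
      ultimately have "norm (p - x) = (1 - (\<delta> + 1) / norm p) * norm p" by simp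
      then have "norm (p - x) = norm p - (\<delta> + 1)" using np(1) by (simp add: left_diff_distrib)
      then have n: "norm v \<le> 2 * \<delta> + 1" "norm (p - v) \<le> real n"
        using nx v(2) norm_triangle_ineq2[of v x] norm_triangle_ineq[of "p - x" "x - v"] Suc.prems(6)
        by (auto simp: dist_norm norm_minus_commute)
      note step = deform_neighbour[OF Suc.prems(1-4) v(1) n(1)]
      have "p - v \<in> vertex_set (pattern_minus U v)" using Suc.prems(5) by (simp add: vertex_set_minus)
      then show ?thesis
        using Suc.IH[OF _ _ step _ n(2)] Suc.prems(1,2) by (simp add: pattern_minus_minus)
    qed
  qed
  have sub: "U \<subseteq> U'" if U: "U \<in> X" "U' \<in> X" "deform U = deform U'" "patch U 0 R0 = patch U' 0 R0" for U U'
  proof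
    fix t assume t: "t \<in> U"
    then obtain p where p: "p extreme_point_of fst t"
      using X.vertex_pattern[OF U(1)] by (auto simp: vertex_pattern_def)
    then have pV: "p \<in> vertex_set U" "p \<in> fst t" using t by (auto simp: vertex_set_def extreme_point_of_def)
    obtain n where "norm p \<le> real n" using real_arch_simple by blast
    then have eq: "patch (pattern_minus U p) 0 R0 = patch (pattern_minus U' p) 0 R0" by (rule labels[OF U pV(1)])
    have "tile_minus t p \<in> patch (pattern_minus U p) 0 R0"
      using t pV(2) R0_pos by (auto simp: mem_patch tile_minus_mem_pattern_minus mem_fst_tile_minus intro!: bexI[of _ 0])
    then show "t \<in> U'" unfolding eq by (simp add: mem_patch tile_minus_mem_pattern_minus)
  qed
  show ?thesis by (rule equalityI[OF sub[OF assms] sub[OF assms(2,1) sym[OF assms(3)] sym[OF assms(4)]]])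
qed

text \<open>Equal deformed patterns have a common labelled point, that is, vertices \<open>p\<close> of \<open>T\<close> and \<open>q\<close> of
  \<open>T'\<close> with equal labels. So \<open>T'\<close> is the translate of \<open>T\<close> by \<open>p - q\<close>, and the position of the common
  point forces \<open>p = q\<close>.\<close>

lemma deform_inj:
  assumes T: "T \<in> X" "T' \<in> X" "deform T = deform T'"
  shows "T = T'"
proof -
  obtain p where p: "p \<in> vertex_set T" using \<delta>(2)[OF T(1)] by blast
  then have "({A T p}, vertex_label T R0 p) \<in> deform T'" unfolding T(3)[symmetric] mem_deform by blast
  then obtain q where q: "q \<in> vertex_set T'" "A T p = A T' q" "vertex_label T R0 p = vertex_label T' R0 q"
    unfolding mem_deform by (elim bexE) (simp only: prod.inject singleton_inject simp_thms)
  have "pattern_minus T p = pattern_minus T' q"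
  proof (rule deform_eq_imp_eq)
    show "deform (pattern_minus T p) = deform (pattern_minus T' q)"
      unfolding deform_translate[OF T(1)] deform_translate[OF T(2)] T(3) q(2) ..
    show "patch (pattern_minus T p) 0 R0 = patch (pattern_minus T' q) 0 R0"
      using q(3) unfolding vertex_label_def .
  qed (use T(1,2) in simp_all)
  then have T': "T' = pattern_minus T (p - q)" by (rule pattern_minus_eqD)
  have "A T' q = A T p - A T (p - q)" unfolding T' A_translate[OF T(1)] by simp
  then have "A T (p - q) = A T 0" using q(2) T(1) by simp
  then have "p - q = 0" by (rule A_inj[OF T(1)])
  then show ?thesis using T' by simp
qed

lemma Z_translate:
  assumes "S \<in> Z"
  shows "pattern_minus S y \<in> Z"
proof -
  obtain T where T: "T \<in> X" "S = deform T" using assms by (auto simp: Z_def)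
  obtain x where "A T x = y" using surj[OF T(1)] by blast
  then have "pattern_minus S y = deform (pattern_minus T x)" using T deform_translate by simp
  then show ?thesis using T(1) by (auto simp: Z_def)
qed

lemma locally_finite_Z: "S \<in> Z \<Longrightarrow> locally_finite L'' S"
  by (auto simp: Z_def locally_finite_deform)

lemma tiling_space_Z: "tiling_space L'' Z"
proof -
  have "finite ((\<lambda>T. patch T 0 R0) ` {T \<in> X. 0 \<in> vertex_set T})"
    by (rule X.finite_vertex_patches[OF R0_pos])
  moreover have "vertex_label T0 R0 ` vertex_set T0 \<subseteq> (\<lambda>T. patch T 0 R0) ` {T \<in> X. 0 \<in> vertex_set T}"
    using T0(1) by (auto simp: vertex_label_def vertex_set_minus)
  ultimately have "finite (vertex_label T0 R0 ` vertex_set T0)" using finite_subset by blast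
  then have "compact_space (mtopology_of L'')"
    unfolding vertex_label_metric(2) by (simp add: compact_space_discrete_topology)
  moreover have "compact_space (pattern_topology L'' Z)"
    using image_compactin[OF _ continuous_deform[OF order_refl locally_finite_Z], of X] X.compact
    by (simp add: compact_space_def Z_def)
  ultimately show ?thesis
    unfolding tiling_space_def using Z_translate labelled_delone_deform by (auto simp: Z_def)
qed

text \<open>Up to translation every patch of an element of \<open>Z\<close> lies close to the origin in \<open>deform T\<close> for
  some \<open>T\<close> with a vertex at the origin, and is part of one of finitely many patches there.\<close>

lemma FLC_Z: "FLC Z"
  unfolding FLC_def
proof
  fix R'
  let ?V = "{T \<in> X. 0 \<in> vertex_set T}" and ?G = "\<lambda>T. patch (deform T) 0 (R' + K * \<delta>)"
  obtain R1 where R1: "\<And>T T'. T \<in> X \<Longrightarrow> T' \<in> X \<Longrightarrow> patch T 0 R1 = patch T' 0 R1 \<Longrightarrow> ?G T = ?G T'"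
    using deform_local[of "R' + K * \<delta>"] by metis
  have "finite (?G ` ?V)"
  proof (rule finite_image_factor)
    show "finite ((\<lambda>T. patch T 0 (max R1 1)) ` ?V)" by (rule X.finite_vertex_patches) simp
    show "?G T = ?G T'" if "T \<in> ?V" "T' \<in> ?V" "patch T 0 (max R1 1) = patch T' 0 (max R1 1)" for T T'
      using that by (intro R1 patch_eq_mono[OF that(3)]) auto
  qed
  then have "finite (\<Union>P\<in>?G ` ?V. Pow P)"
    by (rule finite_UN_I) (use locally_finiteD(2)[OF locally_finite_deform] in auto)
  moreover have "\<exists>Q\<in>(\<Union>P\<in>?G ` ?V. Pow P). \<exists>y. patch S x R' = pattern_minus Q y" if S: "S \<in> Z" for S x
  proof -
    obtain T where T: "T \<in> X" "S = deform T" using S by (auto simp: Z_def)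
    obtain q where q: "A T q = x" using surj[OF T(1)] by blast
    obtain p where p: "p \<in> vertex_set T" "dist q p < \<delta>" using \<delta>(2)[OF T(1)] by blast
    define Q where "Q = patch (deform (pattern_minus T p)) (x - A T p) R'"
    have "Q = pattern_minus (patch S x R') (A T p)"
      unfolding Q_def deform_translate[OF T(1)] patch_pattern_minus T(2) by simp
    then have "patch S x R' = pattern_minus Q (- A T p)" by (simp add: pattern_minus_minus)
    moreover have "norm (x - A T p) \<le> K * \<delta>"
    proof -
      have "K * norm (q - p) \<le> K * \<delta>" using p(2) K by (intro mult_left_mono) (auto simp: dist_norm)
      then show ?thesis using upper[OF T(1), of q p] q by simp
    qed
    then have "Q \<subseteq> ?G (pattern_minus T p)"
    proof (intro subsetI)
      fix t assume "t \<in> Q"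
      then obtain z where z: "t \<in> deform (pattern_minus T p)" "z \<in> fst t" "dist (x - A T p) z < R'"
        by (auto simp: Q_def mem_patch)
      then have "dist 0 z < R' + K * \<delta>"
        using \<open>norm (x - A T p) \<le> K * \<delta>\<close> dist_triangle[of 0 z "x - A T p"] by simp
      then show "t \<in> ?G (pattern_minus T p)" using z unfolding mem_patch by blast
    qed
    moreover have "pattern_minus T p \<in> ?V" using T(1) p(1) by (simp add: vertex_set_minus)
    ultimately show ?thesis by blast
  qed
  ultimately show "\<exists>F. finite F \<and> (\<forall>S\<in>Z. \<forall>x. \<exists>Q\<in>F. \<exists>y. patch S x R' = pattern_minus Q y)" by blast
qed

sublocale Z: flc_space L'' Z
  using tiling_space_Z FLC_Z by unfold_locales

lemma Hausdorff_Z: "Hausdorff_space (pattern_topology L'' Z)"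
  unfolding Z.topology_eq by (rule Metric_space.Hausdorff_space_mtopology[OF Z.metric_space])

lemma homeomorphic_deform: "homeomorphic_map (pattern_topology L X) (pattern_topology L'' Z) deform"
  using deform_inj
  by (intro continuous_imp_homeomorphic_map X.compact Hausdorff_Z continuous_deform locally_finite_Z)
    (auto simp: Z_def inj_on_def)

text \<open>The continuous image \<open>Z\<close> of the compact space \<open>X\<close> is closed in the space of all labelled
  Delone sets, and the orbit of \<open>T0\<close> is dense in \<open>X\<close>.\<close>

lemma Z_eq_orbit_closure: "delone_orbit_closure L'' (deform T0) = Z"
proof -
  let ?D = "{S. labelled_delone L'' S}" 
  let ?\<tau> = "pattern_topology L'' ?D"
  have lf: "locally_finite L'' S" if "S \<in> ?D" for S
    using that vertex_pattern_labelled_delone by (auto simp: vertex_pattern_def)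
  have ZD: "Z \<subseteq> ?D" using labelled_delone_deform by (auto simp: Z_def)
  have cont: "continuous_map (pattern_topology L X) ?\<tau> deform" by (rule continuous_deform[OF ZD lf])
  have "compactin ?\<tau> Z"
    using image_compactin[OF _ cont, of X] X.compact by (simp add: compact_space_def Z_def)
  moreover have "Hausdorff_space ?\<tau>"
    by (subst pattern_topology_eq_mtopology[OF lf], assumption)
      (rule Metric_space.Hausdorff_space_mtopology[OF Metric_space_pattern_dist[OF lf]])
  ultimately have "closedin ?\<tau> Z" by (rule compactin_imp_closedin[rotated])
  moreover have "orbit (deform T0) \<subseteq> Z"
    using Z_translate T0(1) by (auto simp: orbit_def Z_def)
  ultimately have "?\<tau> closure_of orbit (deform T0) \<subseteq> Z" by (rule closure_of_minimal[rotated])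
  moreover have "Z \<subseteq> ?\<tau> closure_of orbit (deform T0)"
  proof -
    have "deform ` orbit T0 \<subseteq> orbit (deform T0)"
      using deform_translate[OF T0(1)] by (auto simp: orbit_def)
    then have "?\<tau> closure_of (deform ` orbit T0) \<subseteq> ?\<tau> closure_of orbit (deform T0)" by (rule closure_of_mono)
    moreover have "deform ` (pattern_topology L X closure_of orbit T0) \<subseteq> ?\<tau> closure_of (deform ` orbit T0)"
      by (rule continuous_map_image_closure_subset[OF cont])
    ultimately show ?thesis using minimal T0(1) by (simp add: minimal_space_def Z_def)
  qed
  ultimately show ?thesis unfolding delone_orbit_closure_def by blast
qed

text \<open>The derivative at \<open>x\<close> is that of \<open>A (pattern_minus T0 x)\<close> at \<open>0\<close>, by the cocycle equation, and on
  the unit ball the latter function is determined by the patch of radius \<open>R + 1\<close>.\<close>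

lemma strongly_PE_deform:
  assumes el: "\<And>T i. T \<in> X \<Longrightarrow> locally_elementary (\<lambda>x. A T x \<bullet> i)"
  shows "strongly_PE T0 (R + 1) (total_derivative (A T0))"
  unfolding strongly_PE_def
proof (intro allI impI)
  fix x y assume ag: "patch (pattern_minus T0 x) 0 (R + 1) = patch (pattern_minus T0 y) 0 (R + 1)"
  have der: "((\<lambda>u. A (pattern_minus T0 x) u) has_derivative blinfun_apply (total_derivative (A T0) x)) (at 0)" for x
  proof -
    have "(A T0 has_derivative blinfun_apply (total_derivative (A T0) x)) (at (x + 0))"
      using total_derivative(1)[of "A T0", OF el[OF T0(1)]] by simp
    moreover have "((\<lambda>u. x + u) has_derivative (\<lambda>u. u)) (at 0)" by (auto intro!: derivative_eq_intros)
    ultimately have "((\<lambda>u. A T0 (x + u)) has_derivative blinfun_apply (total_derivative (A T0) x)) (at 0)"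
      using has_derivative_compose[of "\<lambda>u. x + u" "\<lambda>u. u" 0 UNIV "A T0"] by simp
    then show ?thesis
      unfolding A_translate[OF T0(1)] using has_derivative_diff[OF _ has_derivative_const] by fastforce
  qed
  have "A (pattern_minus T0 x) u = A (pattern_minus T0 y) u" if "u \<in> ball 0 1" for u
    using that T0(1) by (intro A_local[OF _ _ ag]) auto
  then have "((\<lambda>u. A (pattern_minus T0 y) u) has_derivative blinfun_apply (total_derivative (A T0) x)) (at 0)"
    by (intro has_derivative_transform_within_open[OF der[of x] open_ball[of 0 1]]) auto
  then have "blinfun_apply (total_derivative (A T0) x) = blinfun_apply (total_derivative (A T0) y)"
    using has_derivative_unique der by blast
  then show "total_derivative (A T0) x = total_derivative (A T0) y" by (simp add: blinfun_apply_inject)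
qed

lemma shape_change_deform:
  assumes el: "\<And>T i. T \<in> X \<Longrightarrow> locally_elementary (\<lambda>x. A T x \<bullet> i)"
    and D: "\<And>t u v. t \<in> T0 \<Longrightarrow> u \<in> fst t \<Longrightarrow> v \<in> fst t \<Longrightarrow> dist u v \<le> D"
    and R0': "R + 1 + max D (2 * \<delta>) < R0"
    and homeo: "homeomorphic_map euclidean euclidean (A T0)"
  shows "shape_change L X L'' Z deform"
proof -
  define \<omega> where "\<omega> = total_derivative (A T0)"
  note td = total_derivative[of "A T0", OF el[OF T0(1)], folded \<omega>_def]
  have int: "form_integral \<omega> = A T0" using td(5) T0(1) by (simp add: fun_eq_iff)
  have neighbours: "dist p q \<le> max D (2 * \<delta>)" if "neighbouring T0 p q" for p q
    using that unfolding neighbouring_def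
  proof (elim conjE disjE bexE exE)
    fix t assume "t \<in> T0" "p extreme_point_of fst t" "q extreme_point_of fst t"
    then have "dist p q \<le> D" by (intro D) (auto simp: extreme_point_of_def)
    then show ?thesis by simp
  next
    fix z assume z: "dist z p = dist z q" "\<forall>r\<in>vertex_set T0. dist z p \<le> dist z r"
    obtain v where "v \<in> vertex_set T0" "dist z v < \<delta>" using \<delta>(2)[OF T0(1)] by blast
    then have "dist z p < \<delta>" using z(2) by force
    then have "dist p q \<le> 2 * \<delta>" using z(1) dist_triangle3[of p q z] by linarith
    then show ?thesis by simp
  qed
  show ?thesis
    unfolding shape_change_def Let_def
    by (rule bexI[OF _ T0(1)], rule exI[of _ \<omega>], rule exI[of _ "R + 1"], rule exI[of _ "max D (2 * \<delta>)"], rule exI[of _ R0])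
      (use T0 R_nonneg td(3,4) strongly_PE_deform[OF el] homeo neighbours R0' Z_eq_orbit_closure homeomorphic_deform
        deform_translate[OF T0(1)] in \<open>simp add: int \<omega>_def[symmetric] deform_def[symmetric]\<close>)
qed

section \<open>The conjugacy and the quasi-translation\<close>

text \<open>Correcting the position of \<open>deform T\<close> by \<open>s T\<close> turns the orbit equivalence \<open>deform \<circ> k\<close> into a
  translation-equivariant map.\<close>

definition conjugacy :: "('a, 'm) pattern \<Rightarrow> ('a, ('a, 'l) pattern) pattern" where
  "conjugacy S = pattern_minus (deform (k S)) (- s (k S))"

lemma conjugacy_h: "T \<in> X \<Longrightarrow> conjugacy (h T) = pattern_minus (deform T) (- s T)"
  by (simp add: conjugacy_def)

lemma conjugacy_translate:
  assumes S: "S \<in> Y"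
  shows "conjugacy (pattern_minus S y) = pattern_minus (conjugacy S) y"
proof -
  define T where "T = k S"
  have T: "T \<in> X" "S = h T" using S by (auto simp: T_def)
  obtain x where x: "f T x = y" using f_surj[OF T(1)] by blast
  have "pattern_minus S y = h (pattern_minus T x)" using T x by (simp add: h_translate)
  then have "conjugacy (pattern_minus S y) = pattern_minus (deform T) (A T x - s (pattern_minus T x))"
    using T(1) by (simp add: conjugacy_h deform_translate pattern_minus_minus)
  also have "A T x - s (pattern_minus T x) = - s T + y" using x by (simp add: corrected_def)
  finally show ?thesis using T by (simp add: conjugacy_h pattern_minus_minus)
qed

lemma continuous_conjugacy: "continuous_map (pattern_topology L' Y) (pattern_topology L'' Z) conjugacy"
proof -
  have "continuous_map (pattern_topology L' Y) (pattern_topology L'' Z) (\<lambda>S. deform (k S))"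
    using continuous_map_compose[OF inv.continuous continuous_deform[OF order_refl locally_finite_Z]]
    by (simp add: comp_def)
  moreover have "continuous_map (pattern_topology L' Y) euclidean (\<lambda>S. s (k S))"
    using continuous_map_compose[OF inv.continuous s_continuous] by (simp add: comp_def)
  then have "continuous_map (pattern_topology L' Y) euclidean (\<lambda>S. - s (k S))"
    by (simp add: continuous_map_minus)
  ultimately show ?thesis unfolding conjugacy_def[abs_def] by (rule Z.continuous_map_pattern_minus)
qed

lemma conjugacy_image: "conjugacy ` Y = Z"
proof
  show "conjugacy ` Y \<subseteq> Z" using Z_translate by (auto simp: conjugacy_def Z_def)
  show "Z \<subseteq> conjugacy ` Y"
  proof
    fix S assume "S \<in> Z"
    then obtain T where T: "T \<in> X" "S = deform T" by (auto simp: Z_def)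
    then have "S = conjugacy (pattern_minus (h T) (s T))"
      by (simp add: conjugacy_translate conjugacy_h pattern_minus_minus)
    then show "S \<in> conjugacy ` Y" using T(1) by simp
  qed
qed

text \<open>Equality gives \<open>T' = pattern_minus T x\<close> for some \<open>x\<close>, and then \<open>conjugacy (h T)\<close> is invariant under
  translation by \<open>f T x\<close>; as \<open>deform\<close> is injective and \<open>X\<close> aperiodic, \<open>f T x = 0\<close>.\<close>

lemma conjugacy_inj:
  assumes T: "T \<in> X" "T' \<in> X" and eq: "conjugacy (h T) = conjugacy (h T')"
  shows "T = T'"
proof -
  have "deform T' = pattern_minus (deform T) (- s T - - s T')"
    using eq T by (intro pattern_minus_eqD) (simp add: conjugacy_h)
  moreover obtain x where x: "A T x = - s T - - s T'" using surj[OF T(1)] by blast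
  ultimately have "deform T' = deform (pattern_minus T x)" using T(1) by (simp add: deform_translate)
  then have T': "T' = pattern_minus T x" using T by (intro deform_inj) auto
  have "conjugacy (h T) = pattern_minus (conjugacy (h T)) (f T x)"
    using eq T unfolding T' by (simp add: h_translate conjugacy_translate)
  then have "pattern_minus (deform T) (- s T + f T x) = pattern_minus (deform T) (- s T)"
    using T(1) by (simp add: conjugacy_h pattern_minus_minus)
  then have "deform T = pattern_minus (deform T) ((- s T + f T x) - (- s T))" by (rule pattern_minus_eqD)
  then have "deform T = pattern_minus (deform T) (f T x)" by simp
  moreover obtain y where y: "A T y = f T x" using surj[OF T(1)] by blast
  ultimately have "deform (pattern_minus T y) = deform T" using T(1) by (simp add: deform_translate)
  then have "pattern_minus T y = T" using T(1) by (intro deform_inj) auto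
  then have "y = 0" using aperiodic T(1) by blast
  then have "f T x = 0" using y T(1) by simp
  then have "h (pattern_minus T x) = h T" using T(1) by (simp add: h_translate)
  then show ?thesis using T unfolding T' by (metis kh)
qed

lemma homeomorphic_conjugacy: "homeomorphic_map (pattern_topology L' Y) (pattern_topology L'' Z) conjugacy"
proof (rule continuous_imp_homeomorphic_map[OF continuous_conjugacy Y.compact Hausdorff_Z])
  have "S = S'" if "S \<in> Y" "S' \<in> Y" "conjugacy S = conjugacy S'" for S S'
    using conjugacy_inj[of "k S" "k S'"] that by (metis hk inv.image_in)
  then show "inj_on conjugacy (topspace (pattern_topology L' Y))" by (simp add: inj_on_def)
qed (simp add: conjugacy_image)

definition drift :: "('a, 'l) pattern \<Rightarrow> 'a" where
  "drift T = (SOME x. A T x = - s T)"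

lemma drift: "T \<in> X \<Longrightarrow> A T (drift T) = - s T"
  unfolding drift_def by (rule someI_ex) (rule surj)

lemma deform_drift: "T \<in> X \<Longrightarrow> deform (pattern_minus T (drift T)) = conjugacy (h T)"
  by (simp add: deform_translate drift conjugacy_h)

lemma continuous_drift: "continuous_map (pattern_topology L X) euclidean drift"
proof (rule X.continuous_map_euclideanI)
  fix T and e :: real assume T: "T \<in> X" and e: "0 < e"
  define x where "x = drift T"
  have ce: "0 < c * e / 2" using c e by simp
  let ?U = "{T' \<in> X. s T' \<in> ball (s T) (c * e / 2)}"
  have "openin (pattern_topology L X) ?U"
    using openin_continuous_map_preimage[OF s_continuous, of "ball (s T) (c * e / 2)"] by simp
  moreover have "T \<in> ?U" using T ce by simp
  ultimately have "\<exists>d>0. \<forall>T'\<in>X. near (1 / d) d T T' \<longrightarrow> T' \<in> ?U"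
    by (rule open_near) (rule X.locally_finite[OF T])
  then obtain d where d: "0 < d" "\<And>T'. T' \<in> X \<Longrightarrow> near (1 / d) d T T' \<Longrightarrow> dist (s T) (s T') < c * e / 2"
    unfolding mem_Collect_eq mem_ball by blast
  have "dist (drift T) (drift T') < e"
    if T': "T' \<in> X" "near (max (1 / d) (R + norm x)) (min d (c * e / (4 * K))) T T'" for T'
  proof -
    obtain y where y: "norm y < min d (c * e / (4 * K))"
      "patch T' 0 (max (1 / d) (R + norm x)) = patch (pattern_minus T y) 0 (max (1 / d) (R + norm x))"
      using T'(2) unfolding near_def by blast
    have "near (1 / d) d T T'" using T'(2) by (rule near_mono) auto
    then have ds: "dist (s T) (s T') < c * e / 2" using d(2) T'(1) by blast
    have "A T' x = A (pattern_minus T y) x"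
      using T T' by (intro A_local patch_eq_mono[OF y(2)]) auto
    also have "\<dots> = A T (y + x) - A T y" using A_translate[OF T] by simp
    finally have diff: "A T' x - A T x = (A T (y + x) - A T x) - A T y" by simp
    have "norm (A T' x - A T x) \<le> K * norm y + K * norm y"
      using norm_triangle_ineq4[of "A T (y + x) - A T x" "A T y"] upper[OF T, of "y + x" x] norm_A_le[OF T, of y]
      unfolding diff by simp
    also have "\<dots> \<le> c * e / 2"
    proof -
      have "K * norm y \<le> K * (c * e / (4 * K))" using y(1) K by (intro mult_left_mono) auto
      also have "\<dots> = c * e / 4" using K by simp
      finally show ?thesis by simp
    qed
    finally have Ax: "norm (A T' x - A T x) \<le> c * e / 2" .
    have "A T' (drift T') - A T' x = (s T - s T') - (A T' x - A T x)"
      using drift[OF T] drift[OF T'(1)] by (simp add: x_def)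
    then have "norm (A T' (drift T') - A T' x) \<le> dist (s T) (s T') + norm (A T' x - A T x)"
      using norm_triangle_ineq4[of "s T - s T'" "A T' x - A T x"] by (simp only: dist_norm)
    then have "norm (A T' (drift T') - A T' x) < c * e" using ds Ax by linarith
    then have "c * norm (drift T' - x) < c * e" using lower[OF T'(1), of "drift T'" x] by linarith
    then show ?thesis using c by (simp add: x_def dist_norm norm_minus_commute)
  qed
  then show "\<exists>R. \<exists>d>0. \<forall>T'\<in>X. near R d T T' \<longrightarrow> dist (drift T) (drift T') < e"
    using d(1) c e K by (intro exI[of _ "max (1 / d) (R + norm x)"] exI[of _ "min d (c * e / (4 * K))"]) auto
qed

lemma quasi_translation_drift: "quasi_translation L X drift (\<lambda>T. pattern_minus T (drift T))"
proof -
  let ?I = "prod_topology (top_of_set {0..1::real}) (pattern_topology L X)"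
  have "continuous_map ?I (prod_topology euclideanreal euclidean) (\<lambda>z. (fst z, drift (snd z)))"
  proof (rule continuous_map_pairedI)
    show "continuous_map ?I euclideanreal fst"
      using continuous_map_into_fulltopology[OF continuous_map_fst] by blast
    show "continuous_map ?I euclidean (\<lambda>z. drift (snd z))"
      using continuous_map_compose[OF continuous_map_snd continuous_drift] by (simp add: comp_def)
  qed
  moreover have "continuous_map (prod_topology euclideanreal euclidean) euclidean (\<lambda>z. fst z *\<^sub>R (snd z :: 'a))"
    by (simp add: continuous_on_scaleR continuous_on_fst continuous_on_snd)
  ultimately have "continuous_map ?I euclidean ((\<lambda>z. fst z *\<^sub>R snd z) \<circ> (\<lambda>z. (fst z, drift (snd z))))"
    by (rule continuous_map_compose)
  then have v: "continuous_map ?I euclidean (\<lambda>z. fst z *\<^sub>R drift (snd z))" by (simp add: comp_def)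
  have "continuous_map ?I (pattern_topology L X) (\<lambda>z. pattern_minus (snd z) (fst z *\<^sub>R drift (snd z)))"
    by (rule X.continuous_map_pattern_minus[OF continuous_map_snd v])
  then have "homotopic_with (\<lambda>_. True) (pattern_topology L X) (pattern_topology L X) id (\<lambda>T. pattern_minus T (drift T))"
    unfolding homotopic_with_def by (intro exI[of _ "\<lambda>z. pattern_minus (snd z) (fst z *\<^sub>R drift (snd z))"]) auto
  then show ?thesis unfolding quasi_translation_def using continuous_drift by simp
qed

text \<open>Composed with the bijection \<open>deform\<close>, the map is \<open>conjugacy \<circ> h\<close>, which is a bijection onto the
  same space.\<close>

lemma homeomorphic_drift:
  "homeomorphic_map (pattern_topology L X) (pattern_topology L X) (\<lambda>T. pattern_minus T (drift T))"
proof (rule continuous_imp_homeomorphic_map)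
  show "continuous_map (pattern_topology L X) (pattern_topology L X) (\<lambda>T. pattern_minus T (drift T))"
    by (intro X.continuous_map_pattern_minus continuous_drift) simp
  show "Hausdorff_space (pattern_topology L X)"
    unfolding X.topology_eq by (rule Metric_space.Hausdorff_space_mtopology[OF X.metric_space])
  have "T \<in> (\<lambda>T. pattern_minus T (drift T)) ` X" if T: "T \<in> X" for T
  proof -
    have "deform T \<in> conjugacy ` Y" using T by (simp add: conjugacy_image Z_def)
    then obtain S where S: "S \<in> Y" "deform T = conjugacy S" by blast
    then have "deform (pattern_minus (k S) (drift (k S))) = deform T" by (simp add: deform_drift)
    then have "pattern_minus (k S) (drift (k S)) = T" using S(1) T by (intro deform_inj) auto
    then show ?thesis by (rule image_eqI[OF sym]) (use S(1) in simp)
  qed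
  then show "(\<lambda>T. pattern_minus T (drift T)) ` topspace (pattern_topology L X) = topspace (pattern_topology L X)" by auto
  show "inj_on (\<lambda>T. pattern_minus T (drift T)) (topspace (pattern_topology L X))"
  proof (rule inj_onI)
    fix T T' assume T: "T \<in> topspace (pattern_topology L X)" "T' \<in> topspace (pattern_topology L X)"
      and eq: "pattern_minus T (drift T) = pattern_minus T' (drift T')"
    have "conjugacy (h T) = conjugacy (h T')" using T eq deform_drift[of T] deform_drift[of T'] by simp
    then show "T = T'" using T conjugacy_inj by simp
  qed
qed (rule X.compact)

text \<open>A patch of \<open>h T\<close> fixes \<open>T\<close> near the origin only up to a small translation, so a priori it
  fixes the patch of \<open>conjugacy (h T)\<close> only up to a small translation; but both patterns move by the
  same vector \<open>w\<close>, and uniqueness of small translations makes \<open>w\<close> vanish.\<close>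

lemma common_displacement:
  assumes e: "0 < e"
  shows "\<exists>d>0. \<forall>T\<in>X. \<forall>T'\<in>X. near (1 / d) d T T' \<longrightarrow>
    (\<exists>w. norm w < e \<and> patch (h T') 0 r' = patch (pattern_minus (h T) w) 0 r' \<and>
      patch (conjugacy (h T')) 0 r' = patch (pattern_minus (conjugacy (h T)) w) 0 r')"
proof -
  obtain M where M: "\<And>T. T \<in> X \<Longrightarrow> norm (s T) \<le> M"
    using X.continuous_bounded[of "\<lambda>T. norm (s T)"] continuous_map_norm[OF s_continuous] by auto
  obtain R1 where R1: "r \<le> R1" "\<And>T T'. T \<in> X \<Longrightarrow> T' \<in> X \<Longrightarrow> patch T 0 R1 = patch T' 0 R1 \<Longrightarrow>
      norm (shift T T') < e / 2 \<and> patch (h T') 0 r' = patch (pattern_minus (h T) (shift T T')) 0 r'"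
    using shift_refine[of "e / 2" r'] e by (metis half_gt_zero)
  obtain R2 where R2: "\<And>T T'. T \<in> X \<Longrightarrow> T' \<in> X \<Longrightarrow> patch T 0 R2 = patch T' 0 R2 \<Longrightarrow>
      patch (deform T) 0 (r' + M) = patch (deform T') 0 (r' + M)"
    using deform_local[of "r' + M"] by metis
  obtain d' where d': "0 < d'" "\<And>T x. T \<in> X \<Longrightarrow> norm x < d' \<Longrightarrow> norm (f T x) < e / 2"
    using f_small[of "e / 2"] e by auto
  define Q where "Q = max R (max R1 (max R2 1))"
  have Q: "R \<le> Q" "R1 \<le> Q" "R2 \<le> Q" "0 < Q" by (auto simp: Q_def)
  define d where "d = min d' (1 / Q)"
  have d: "0 < d" "d \<le> d'" "Q \<le> 1 / d"
  proof -
    show "0 < d" "d \<le> d'" using d'(1) Q(4) by (auto simp: d_def)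
    then have "1 / (1 / Q) \<le> 1 / d" by (intro divide_left_mono) (auto simp: d_def Q(4))
    then show "Q \<le> 1 / d" by simp
  qed
  have "\<exists>w. norm w < e \<and> patch (h T') 0 r' = patch (pattern_minus (h T) w) 0 r' \<and>
      patch (conjugacy (h T')) 0 r' = patch (pattern_minus (conjugacy (h T)) w) 0 r'"
    if T: "T \<in> X" "T' \<in> X" "near (1 / d) d T T'" for T T'
  proof -
    obtain x where x: "norm x < d" "patch T' 0 (1 / d) = patch (pattern_minus T x) 0 (1 / d)"
      using T(3) unfolding near_def by blast
    let ?U = "pattern_minus T x"
    have U: "?U \<in> X" using T(1) by simp
    have ag: "patch ?U 0 R = patch T' 0 R" "patch ?U 0 R1 = patch T' 0 R1" "patch ?U 0 R2 = patch T' 0 R2"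
      using Q d(3) by (intro patch_eq_mono[OF x(2)[symmetric]]; linarith)+
    define z where "z = shift ?U T'"
    have z: "norm z < e / 2" "patch (h T') 0 r' = patch (pattern_minus (h ?U) z) 0 r'"
      using R1(2)[OF U T(2) ag(2)] by (auto simp: z_def)
    have sT': "s T' = s ?U - z" unfolding z_def by (rule adaptedD[OF s_adapted U T(2) ag(1)])
    have "patch (pattern_minus (deform ?U) (- s T')) 0 r' = patch (pattern_minus (deform T') (- s T')) 0 r'"
      using M[OF T(2)] by (intro patch_eq_shift[OF R2[OF U T(2) ag(3)]]) simp
    moreover have "pattern_minus (deform ?U) (- s T') = pattern_minus (conjugacy (h T)) (f T x + z)"
      using T(1) unfolding sT' by (simp add: deform_translate conjugacy_h pattern_minus_minus corrected_def algebra_simps)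
    ultimately have "patch (conjugacy (h T')) 0 r' = patch (pattern_minus (conjugacy (h T)) (f T x + z)) 0 r'"
      using T(2) by (simp add: conjugacy_h)
    moreover have "patch (h T') 0 r' = patch (pattern_minus (h T) (f T x + z)) 0 r'"
      using z(2) T(1) by (simp add: h_translate pattern_minus_minus)
    moreover have "norm (f T x + z) < e"
      using d'(2)[OF T(1), of x] x(1) d(2) z(1) norm_triangle_ineq[of "f T x" z] by linarith
    ultimately show ?thesis by blast
  qed
  then show ?thesis using d(1) by blast
qed

text \<open>Equal patches of \<open>S\<close> and \<open>S'\<close> make the preimages in \<open>X\<close> close, and then the vector of
  \<open>common_displacement\<close> vanishes by uniqueness of small translations of \<open>S\<close>. For the inverse map the
  same argument applies with uniqueness in \<open>Z\<close>.\<close>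

lemma MLD_conjugacy: "MLD_equivalence L' Y L'' Z conjugacy"
proof -
  obtain \<psi> where \<psi>: "homeomorphic_maps (pattern_topology L' Y) (pattern_topology L'' Z) conjugacy \<psi>"
    using homeomorphic_conjugacy homeomorphic_map_maps by blast
  have \<psi>Y: "\<psi> Q \<in> Y" "conjugacy (\<psi> Q) = Q" if "Q \<in> Z" for Q
    using \<psi> that by (auto simp: homeomorphic_maps_def continuous_map_def)
  have \<psi>c: "\<psi> (conjugacy S) = S" if "S \<in> Y" for S using \<psi> that by (simp add: homeomorphic_maps_def)
  have cY: "conjugacy S \<in> Z" if "S \<in> Y" for S using that conjugacy_image by blast
  have \<psi>cont: "continuous_map (pattern_topology L'' Z) (pattern_topology L' Y) \<psi>"
    using \<psi> by (simp add: homeomorphic_maps_def)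
  have "factor_map L' Y L'' Z conjugacy"
    unfolding factor_map_def using continuous_conjugacy conjugacy_image conjugacy_translate by blast
  moreover have "\<exists>R>0. \<forall>S\<in>Y. \<forall>S'\<in>Y. patch S 0 R = patch S' 0 R \<longrightarrow> patch (conjugacy S) 0 r' = patch (conjugacy S') 0 r'"
    for r'
  proof -
    obtain d where d: "0 < d" "\<And>T T'. T \<in> X \<Longrightarrow> T' \<in> X \<Longrightarrow> near (1 / d) d T T' \<Longrightarrow>
      \<exists>w. norm w < \<kappa> \<and> patch (h T') 0 (max r' \<rho>) = patch (pattern_minus (h T) w) 0 (max r' \<rho>) \<and>
        patch (conjugacy (h T')) 0 (max r' \<rho>) = patch (pattern_minus (conjugacy (h T)) w) 0 (max r' \<rho>)"
      using common_displacement[OF \<kappa>, of "max r' \<rho>"] by metis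
    obtain R1 where R1: "\<And>S S'. S \<in> Y \<Longrightarrow> S' \<in> Y \<Longrightarrow> patch S 0 R1 = patch S' 0 R1 \<Longrightarrow> near (1 / d) d (k S) (k S')"
      using inv.patch_image[OF d(1), of "1 / d"] by metis
    have "patch (conjugacy S) 0 r' = patch (conjugacy S') 0 r'"
      if S: "S \<in> Y" "S' \<in> Y" "patch S 0 (max R1 \<rho>) = patch S' 0 (max R1 \<rho>)" for S S'
    proof -
      have "patch S 0 R1 = patch S' 0 R1" by (rule patch_eq_mono[OF S(3)]) simp
      then obtain w where w: "norm w < \<kappa>" "patch S' 0 (max r' \<rho>) = patch (pattern_minus S w) 0 (max r' \<rho>)"
        "patch (conjugacy S') 0 (max r' \<rho>) = patch (pattern_minus (conjugacy S) w) 0 (max r' \<rho>)"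
        using d(2)[of "k S" "k S'"] R1 S by auto
      have "patch S 0 \<rho> = patch S' 0 \<rho>" by (rule patch_eq_mono[OF S(3)]) simp
      also have "\<dots> = patch (pattern_minus S w) 0 \<rho>" by (rule patch_eq_mono[OF w(2)]) simp
      finally have "0 = w" using unique[OF S(1), of 0 w] w(1) by simp
      then have "patch (conjugacy S') 0 (max r' \<rho>) = patch (conjugacy S) 0 (max r' \<rho>)" using w(3) by simp
      from patch_eq_mono[OF this, of r'] show ?thesis by simp
    qed
    moreover have "0 < max R1 \<rho>" using \<rho> by simp
    ultimately show ?thesis by (intro exI[of _ "max R1 \<rho>"] conjI ballI impI)
  qed
  ultimately have fwd: "local_derivation L' Y L'' Z conjugacy" unfolding local_derivation_def by blast
  have "\<psi> (pattern_minus Q x) = pattern_minus (\<psi> Q) x" if "Q \<in> Z" for Q x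
    using conjugacy_translate[OF \<psi>Y(1)[OF that], of x] \<psi>Y[OF that] \<psi>c[OF Y.translate_in[OF \<psi>Y(1)[OF that]], of x] by simp
  moreover have "\<psi> ` Z = Y"
    unfolding conjugacy_image[symmetric] image_image using \<psi>c by (simp cong: image_cong)
  ultimately have "factor_map L'' Z L' Y \<psi>" unfolding factor_map_def using \<psi>cont by blast
  moreover have "\<exists>R>0. \<forall>Q\<in>Z. \<forall>Q'\<in>Z. patch Q 0 R = patch Q' 0 R \<longrightarrow> patch (\<psi> Q) 0 r' = patch (\<psi> Q') 0 r'"
    for r'
  proof -
    obtain \<kappa>' \<rho>' where \<kappa>': "0 < \<kappa>'" "0 < \<rho>'" and unique': "\<And>Q x y. Q \<in> Z \<Longrightarrow> norm (x - y) < \<kappa>' \<Longrightarrow>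
        patch (pattern_minus Q x) 0 \<rho>' = patch (pattern_minus Q y) 0 \<rho>' \<Longrightarrow> x = y"
      using Z.small_translation_unique by metis
    obtain d where d: "0 < d" "\<And>T T'. T \<in> X \<Longrightarrow> T' \<in> X \<Longrightarrow> near (1 / d) d T T' \<Longrightarrow>
      \<exists>w. norm w < \<kappa>' \<and> patch (h T') 0 (max r' \<rho>') = patch (pattern_minus (h T) w) 0 (max r' \<rho>') \<and>
        patch (conjugacy (h T')) 0 (max r' \<rho>') = patch (pattern_minus (conjugacy (h T)) w) 0 (max r' \<rho>')"
      using common_displacement[OF \<kappa>'(1), of "max r' \<rho>'"] by metis
    interpret k\<psi>: flc_map L'' Z L X "\<lambda>Q. k (\<psi> Q)"
      using continuous_map_compose[OF \<psi>cont inv.continuous] by unfold_locales (simp add: comp_def)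
    obtain R1 where R1: "\<And>Q Q'. Q \<in> Z \<Longrightarrow> Q' \<in> Z \<Longrightarrow> patch Q 0 R1 = patch Q' 0 R1 \<Longrightarrow> near (1 / d) d (k (\<psi> Q)) (k (\<psi> Q'))"
      using k\<psi>.patch_image[OF d(1), of "1 / d"] by metis
    have "patch (\<psi> Q) 0 r' = patch (\<psi> Q') 0 r'"
      if Q: "Q \<in> Z" "Q' \<in> Z" "patch Q 0 (max R1 \<rho>') = patch Q' 0 (max R1 \<rho>')" for Q Q'
    proof -
      have "patch Q 0 R1 = patch Q' 0 R1" by (rule patch_eq_mono[OF Q(3)]) simp
      then obtain w where w: "norm w < \<kappa>'" "patch (\<psi> Q') 0 (max r' \<rho>') = patch (pattern_minus (\<psi> Q) w) 0 (max r' \<rho>')"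
        "patch Q' 0 (max r' \<rho>') = patch (pattern_minus Q w) 0 (max r' \<rho>')"
        using d(2)[of "k (\<psi> Q)" "k (\<psi> Q')"] R1 Q \<psi>Y by auto
      have "patch Q 0 \<rho>' = patch Q' 0 \<rho>'" by (rule patch_eq_mono[OF Q(3)]) simp
      also have "\<dots> = patch (pattern_minus Q w) 0 \<rho>'" by (rule patch_eq_mono[OF w(3)]) simp
      finally have "0 = w" using unique'[OF Q(1), of 0 w] w(1) by simp
      then have "patch (\<psi> Q') 0 (max r' \<rho>') = patch (\<psi> Q) 0 (max r' \<rho>')" using w(2) by simp
      from patch_eq_mono[OF this, of r'] show ?thesis by simp
    qed
    moreover have "0 < max R1 \<rho>'" using \<kappa>'(2) by simp
    ultimately show ?thesis by (intro exI[of _ "max R1 \<rho>'"] conjI ballI impI)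
  qed
  ultimately have "local_derivation L'' Z L' Y \<psi>" unfolding local_derivation_def by blast
  then show ?thesis unfolding MLD_equivalence_def using fwd \<psi> by blast
qed

end

theorem theorem1p1:
  fixes L :: "'l metric" and L' :: "'m metric"
    and \<Omega> :: "('a::euclidean_space, 'l) pattern set"
    and \<Omega>' :: "('a, 'm) pattern set"
    and h :: "('a, 'l) pattern \<Rightarrow> ('a, 'm) pattern"
  assumes "tiling_space L \<Omega>" and "minimal_space L \<Omega>" and "uniquely_ergodic L \<Omega>"
    and "aperiodic_space \<Omega>" and "FLC \<Omega>"
    and "tiling_space L' \<Omega>'" and "FLC \<Omega>'"
    and "homeomorphic_map (pattern_topology L \<Omega>) (pattern_topology L' \<Omega>') h"
  shows "\<exists>(L'' :: ('a, 'l) pattern metric) (\<Omega>'' :: ('a, ('a, 'l) pattern) pattern set)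
            \<tau> s h_sc \<phi>.
           tiling_space L'' \<Omega>'' \<and> FLC \<Omega>'' \<and>
           homeomorphic_map (pattern_topology L \<Omega>) (pattern_topology L \<Omega>) \<tau> \<and>
           homeomorphic_map (pattern_topology L \<Omega>) (pattern_topology L'' \<Omega>'') h_sc \<and>
           homeomorphic_map (pattern_topology L' \<Omega>') (pattern_topology L'' \<Omega>'') \<phi> \<and>
           (\<forall>T\<in>\<Omega>. \<phi> (h T) = h_sc (\<tau> T)) \<and>
           quasi_translation L \<Omega> s \<tau> \<and>
           shape_change L \<Omega> L'' \<Omega>'' h_sc \<and>
           MLD_equivalence L' \<Omega>' L'' \<Omega>'' \<phi>"
proof -
  obtain k where k: "homeomorphic_maps (pattern_topology L \<Omega>) (pattern_topology L' \<Omega>') h k"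
    using assms(8) homeomorphic_map_maps by blast
  interpret X: flc_space L \<Omega> using assms by unfold_locales
  interpret Y: flc_space L' \<Omega>' using assms by unfold_locales
  obtain \<kappa> \<rho> where \<kappa>: "0 < \<kappa>" "0 < \<rho>" and unique: "\<And>S x y. S \<in> \<Omega>' \<Longrightarrow> norm (x - y) < \<kappa> \<Longrightarrow>
      patch (pattern_minus S x) 0 \<rho> = patch (pattern_minus S y) 0 \<rho> \<Longrightarrow> x = y"
    using Y.small_translation_unique by metis
  interpret flc_map L \<Omega> L' \<Omega>' h
    using k by unfold_locales (simp add: homeomorphic_maps_def)
  interpret tiling_homeo L \<Omega> L' \<Omega>' h k \<kappa> \<rho>
  proof
    show "continuous_map (pattern_topology L' \<Omega>') (pattern_topology L \<Omega>) k"
      "\<And>T. T \<in> \<Omega> \<Longrightarrow> k (h T) = T" "\<And>S. S \<in> \<Omega>' \<Longrightarrow> h (k S) = S"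
      using k by (simp_all add: homeomorphic_maps_def)
    show "\<And>T x. T \<in> \<Omega> \<Longrightarrow> pattern_minus T x = T \<Longrightarrow> x = 0" using assms(4) by (simp add: aperiodic_space_def)
  qed (fact \<kappa> unique)+
  obtain f where f: "\<forall>T\<in>\<Omega>. \<forall>x. h (pattern_minus T x) = pattern_minus (h T) (f T x)"
    "\<forall>T\<in>\<Omega>. \<forall>x y. f T (x + y) = f T x + f (pattern_minus T x) y"
    "\<forall>e>0. \<exists>d>0. \<forall>T\<in>\<Omega>. \<forall>x. norm x < d \<longrightarrow> norm (f T x) < e"
    using exists_cocycle by blast
  have "0 < \<kappa> / 8" using \<kappa>(1) by simp
  from patch_image[OF this, of "\<rho> + \<kappa>"] obtain r
    where r: "\<forall>T\<in>\<Omega>. \<forall>T'\<in>\<Omega>. patch T 0 r = patch T' 0 r \<longrightarrow> near (\<rho> + \<kappa>) (\<kappa> / 8) (h T) (h T')" ..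
  interpret tiling_cocycle L \<Omega> L' \<Omega>' h k \<kappa> \<rho> f "max r 0"
  proof
    show "near (\<rho> + \<kappa>) (\<kappa> / 8) (h T) (h T')"
      if T: "T \<in> \<Omega>" "T' \<in> \<Omega>" "patch T 0 (max r 0) = patch T' 0 (max r 0)" for T T'
      by (rule r[rule_format, OF T(1,2) patch_eq_mono[OF T(3)]]) simp
  qed (use f in auto)
  have "\<Omega> \<noteq> {}"
    using assms(3) prob_space.not_empty unfolding uniquely_ergodic_def invariant_prob_measure_def by metis
  from exists_adapted_bilipschitz[OF assms(3) this] obtain s R c K
    where s: "adapted s R" "0 < c" "0 < K" "continuous_map (pattern_topology L \<Omega>) euclidean s"
    and A: "\<forall>T\<in>\<Omega>. (\<forall>i. locally_elementary (\<lambda>x. corrected s T x \<bullet> i)) \<and>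
      (\<forall>x y. c * norm (x - y) \<le> norm (corrected s T x - corrected s T y)) \<and>
      (\<forall>x y. norm (corrected s T x - corrected s T y) \<le> K * norm (x - y)) \<and>
      homeomorphic_map euclidean euclidean (corrected s T)"
    by (elim exE conjE)
  obtain \<delta> where \<delta>: "0 < \<delta>" "\<forall>T\<in>\<Omega>. \<forall>x. \<exists>v\<in>vertex_set T. dist x v < \<delta>"
    using X.vertices_relatively_dense by blast
  obtain D where D: "\<forall>T\<in>\<Omega>. \<forall>t\<in>T. \<forall>u\<in>fst t. \<forall>v\<in>fst t. dist u v \<le> D"
    using X.tile_diameter_bound by blast
  obtain T v where "T \<in> \<Omega>" "v \<in> vertex_set T" using \<open>\<Omega> \<noteq> {}\<close> \<delta>(2) by blast
  then have T0: "pattern_minus T v \<in> \<Omega>" "0 \<in> vertex_set (pattern_minus T v)" by (simp_all add: vertex_set_minus)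
  define R0 where "R0 = R + 2 + max D (2 * \<delta>)"
  interpret deformation L \<Omega> L' \<Omega>' h k \<kappa> \<rho> f "max r 0" s R c K "pattern_minus T v" R0 \<delta>
  proof
    show "\<exists>x. corrected s T x = z" if "T \<in> \<Omega>" for T z
    proof -
      have "range (corrected s T) = UNIV"
        using A that homeomorphic_imp_surjective_map by (metis topspace_euclidean)
      then show ?thesis by (metis rangeE UNIV_I)
    qed
    show "\<exists>v\<in>vertex_set T. dist x v < \<delta>" if "T \<in> \<Omega>" for T x using \<delta>(2) that by blast
  qed (use s A assms(2) T0 \<delta>(1) in \<open>auto simp: R0_def\<close>)
  have "shape_change L \<Omega> L'' Z deform"
    by (rule shape_change_deform[where D = D]) (use A D T0(1) in \<open>auto simp: R0_def\<close>)
  then show ?thesis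
    by (intro exI[of _ L''] exI[of _ Z] exI[of _ "\<lambda>T. pattern_minus T (drift T)"] exI[of _ drift]
        exI[of _ deform] exI[of _ conjugacy] conjI ballI tiling_space_Z FLC_Z homeomorphic_drift
        homeomorphic_deform homeomorphic_conjugacy quasi_translation_drift MLD_conjugacy deform_drift[symmetric])
qed

end
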